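(* Let $0<\alpha<1<\beta$, $a\in(0,1)$, $p\in P_{\alpha,\beta}$, let $T>0$ (including $T=\infty$), $g\in V(I)$ and $h\in L^2(I)$. Then the problem $$ \begin{cases} p(x)\,u_{tt}+u_{xxxx}+\|u\|_{L_p^2(I)}^2 \,p(x)\, u=0& x\in I,\ t>0\\ u(x,0)=g(x),\quad u_t(x,0)=h(x)& x\in I\\ u(\pm\pi,t)=u_{xx}(\pm \pi,t)=0 & t>0\\ u(\pm a\pi,t)=0& t>0 \end{cases} $$ admits a unique weak solution $u\in C^0([0,T]; V(I))\cap C^1([0,T]; L_p^2(I))$. Furthermore, $pu\in C^2([0,T]; V'(I))$ and $u$ satisfies $$ \frac{1}{2}\|u_t(t)\|_{L_p^2(I)}^2+\frac{1}{2}\|u_{xx}(t)\|_{L^2(I)}^2+\frac{1}{4}\|u(t)\|_{L_p^2(I)}^4=\frac{1}{2}\|h\|_{L_p^2(I)}^2+\frac{1}{2}\|g_{xx}\|_{L^2(I)}^2+\frac{1}{4}\|g\|_{L_p^2(I)}^4 $$ for all times $t>0$ in the interval of definition.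
   Context: $I=(-\pi,\pi)$. For $0<\alpha<1<\beta$, $$P_{\alpha, \beta}:=\Big\{p\in L^\infty(I):\ \int_I p\,dx=2\pi,\ \alpha\leq p\leq\beta \text{ and } p(x)=p(-x) \text{ a.e. in } I\Big\}.$$ $(\cdot,\cdot)$ is the scalar product of $L^2(I)$; $(u,v)_p:=(pu,v)=\int_I p\,uv\,dx$; $L^2_p(I)$ is $L^2(I)$ endowed with $(\cdot,\cdot)_p$, and $\|u\|_{L^2_p(I)}^2=(u,u)_p$. For $a\in(0,1)$, $$V(I):=\{u\in H^2(I)\cap H^1_0(I): u(\pm a\pi)=0\},$$ a Hilbert space with scalar product $(u,v)_V:=(u'',v'')$ and norm $\|u\|_V^2=(u,u)_V$; $V'(I)$ is its dual. An element $w\in L^2(I)$ is identified with the functional $\varphi\mapsto (w,\varphi)$ in $V'(I)$. Weak solution: a function $u\in C^0([0,T]; V(I))\cap C^1([0,T]; L_p^2(I))$ such that $\|u(\cdot,t)-g\|_{V}\to 0$ and $\|u_t(\cdot,t)-h\|_{L^2_p(I)}\to 0$ as $t\to 0^+$, and $$ \int_0^T (u_t(s),\varphi)_p\, \chi'(s) \, ds= \int_0^T \Big\{ (u_{xx}(s),\varphi'') + \|u(s)\|_{L_p^2(I)}^2\,(u(s),\varphi)_p \Big\}\, \chi(s)\, ds $$ for all $\varphi \in V(I)$ and all $\chi \in C_c^\infty(0, T)$. When $T=\infty$, $[0,T]$ is read as $[0,\infty)$. *)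

theory Defs
  imports "HOL-Analysis.Analysis"
begin

text \<open>
  Elements of Lebesgue and Sobolev spaces on \<open>(-\<pi>,\<pi>)\<close> are represented by functions
  \<^typ>\<open>real \<Rightarrow> real\<close> of which only the class modulo almost everywhere equality on
  \<open>(-\<pi>,\<pi>)\<close> matters. The function spaces below, and the class of weights, are closed under such equality.
\<close>

abbreviation I_dom :: "real set" where
  "I_dom \<equiv> {- pi<..<pi}"

abbreviation I_meas :: "real measure" where
  "I_meas \<equiv> lebesgue_on I_dom"

definition P_class :: "real \<Rightarrow> real \<Rightarrow> (real \<Rightarrow> real) set" where
  "P_class \<alpha> \<beta> = {p.
     p \<in> borel_measurable I_meas \<and>
     (\<exists>C. AE x in I_meas. \<bar>p x\<bar> \<le> C) \<and>
     (\<integral>x. p x \<partial>I_meas) = 2 * pi \<and>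
     (AE x in I_meas. \<alpha> \<le> p x \<and> p x \<le> \<beta>) \<and>
     (AE x in I_meas. p x = p (- x))}"


subsection \<open>Square integrable functions\<close>

definition L2 :: "(real \<Rightarrow> real) set" where
  "L2 = {u. u \<in> borel_measurable I_meas \<and> integrable I_meas (\<lambda>x. (u x)\<^sup>2)}"

definition L2_inner :: "(real \<Rightarrow> real) \<Rightarrow> (real \<Rightarrow> real) \<Rightarrow> real" where
  "L2_inner u v = (\<integral>x. u x * v x \<partial>I_meas)"

definition L2_norm :: "(real \<Rightarrow> real) \<Rightarrow> real" where
  "L2_norm u = sqrt (L2_inner u u)"

definition L2p_inner :: "(real \<Rightarrow> real) \<Rightarrow> (real \<Rightarrow> real) \<Rightarrow> (real \<Rightarrow> real) \<Rightarrow> real" where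
  "L2p_inner p u v = L2_inner (\<lambda>x. p x * u x) v"

definition L2p_norm :: "(real \<Rightarrow> real) \<Rightarrow> (real \<Rightarrow> real) \<Rightarrow> real" where
  "L2p_norm p u = sqrt (L2p_inner p u u)"


subsection \<open>Sobolev spaces\<close>

definition test_functions :: "real set \<Rightarrow> (real \<Rightarrow> real) set" where
  "test_functions S = {\<phi>.
     (\<forall>k x. (deriv ^^ k) \<phi> differentiable (at x)) \<and>
     compact (closure {x. \<phi> x \<noteq> 0}) \<and> closure {x. \<phi> x \<noteq> 0} \<subseteq> S}"

definition is_weak_deriv :: "(real \<Rightarrow> real) \<Rightarrow> (real \<Rightarrow> real) \<Rightarrow> bool" where
  "is_weak_deriv u v \<longleftrightarrow>
     v \<in> L2 \<and> (\<forall>\<phi> \<in> test_functions I_dom. L2_inner u (deriv \<phi>) = - L2_inner v \<phi>)"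

text \<open>The weak derivative; unique up to almost everywhere equality when it exists.\<close>

definition wderiv :: "(real \<Rightarrow> real) \<Rightarrow> (real \<Rightarrow> real)" where
  "wderiv u = (SOME v. is_weak_deriv u v)"

definition H1 :: "(real \<Rightarrow> real) set" where
  "H1 = {u \<in> L2. \<exists>v. is_weak_deriv u v}"

definition H1_norm :: "(real \<Rightarrow> real) \<Rightarrow> real" where
  "H1_norm u = sqrt ((L2_norm u)\<^sup>2 + (L2_norm (wderiv u))\<^sup>2)"

definition H2 :: "(real \<Rightarrow> real) set" where
  "H2 = {u \<in> H1. wderiv u \<in> H1}"

text \<open>The closure of the test functions in \<^term>\<open>H1\<close>.\<close>

definition H1_0 :: "(real \<Rightarrow> real) set" where
  "H1_0 = {u \<in> H1. \<exists>\<phi>. (\<forall>n::nat. \<phi> n \<in> test_functions I_dom) \<and>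
                        (\<lambda>n. H1_norm (\<lambda>x. \<phi> n x - u x)) \<longlonglongrightarrow> 0}"

text \<open>
  Point values of a function in \<^term>\<open>H1\<close> are those of its continuous representative, which
  exists and is uniquely determined on \<open>(-\<pi>,\<pi>)\<close>.
\<close>

definition cont_rep :: "(real \<Rightarrow> real) \<Rightarrow> (real \<Rightarrow> real)" where
  "cont_rep u = (SOME v. continuous_on I_dom v \<and> (AE x in I_meas. v x = u x))"

definition V_space :: "real \<Rightarrow> (real \<Rightarrow> real) set" where
  "V_space a = {u \<in> H2 \<inter> H1_0. cont_rep u (a * pi) = 0 \<and> cont_rep u (- (a * pi)) = 0}"

definition V_inner :: "(real \<Rightarrow> real) \<Rightarrow> (real \<Rightarrow> real) \<Rightarrow> real" where
  "V_inner u v = L2_inner (wderiv (wderiv u)) (wderiv (wderiv v))"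

definition V_norm :: "(real \<Rightarrow> real) \<Rightarrow> real" where
  "V_norm u = sqrt (V_inner u u)"

text \<open>
  Bounded linear functionals on \<^term>\<open>V_space a\<close>. Only their values on \<^term>\<open>V_space a\<close> matter;
  boundedness forces them to respect almost everywhere equality.
\<close>

definition V_dual :: "real \<Rightarrow> ((real \<Rightarrow> real) \<Rightarrow> real) set" where
  "V_dual a = {F.
     (\<forall>\<phi> \<in> V_space a. \<forall>\<psi> \<in> V_space a. F (\<lambda>x. \<phi> x + \<psi> x) = F \<phi> + F \<psi>) \<and>
     (\<forall>c. \<forall>\<phi> \<in> V_space a. F (\<lambda>x. c * \<phi> x) = c * F \<phi>) \<and>
     (\<exists>C. \<forall>\<phi> \<in> V_space a. \<bar>F \<phi>\<bar> \<le> C * V_norm \<phi>)}"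

definition V_dual_norm :: "real \<Rightarrow> ((real \<Rightarrow> real) \<Rightarrow> real) \<Rightarrow> real" where
  "V_dual_norm a F = (SUP \<phi> \<in> {\<phi> \<in> V_space a. V_norm \<phi> \<le> 1}. \<bar>F \<phi>\<bar>)"


subsection \<open>Functions of time with values in a normed space\<close>

text \<open>
  The normed space is given by a carrier \<open>X\<close>, consisting of real valued functions, and a norm
  \<open>N\<close> on it. Limits are taken within the time interval \<open>J\<close>, hence are one-sided at its end points.
\<close>

definition has_deriv_in ::
  "('a \<Rightarrow> real) set \<Rightarrow> (('a \<Rightarrow> real) \<Rightarrow> real) \<Rightarrow> real set \<Rightarrow>
   (real \<Rightarrow> 'a \<Rightarrow> real) \<Rightarrow> (real \<Rightarrow> 'a \<Rightarrow> real) \<Rightarrow> bool" where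
  "has_deriv_in X N J u v \<longleftrightarrow>
     (\<forall>t\<in>J. u t \<in> X \<and> v t \<in> X \<and>
        ((\<lambda>s. N (\<lambda>x. (u s x - u t x) / (s - t) - v t x)) \<longlongrightarrow> 0) (at t within J))"

primrec Ck_in ::
  "nat \<Rightarrow> ('a \<Rightarrow> real) set \<Rightarrow> (('a \<Rightarrow> real) \<Rightarrow> real) \<Rightarrow> real set \<Rightarrow>
   (real \<Rightarrow> 'a \<Rightarrow> real) \<Rightarrow> bool" where
  "Ck_in 0 X N J u \<longleftrightarrow>
     (\<forall>t\<in>J. u t \<in> X \<and> ((\<lambda>s. N (\<lambda>x. u s x - u t x)) \<longlongrightarrow> 0) (at t within J))"
| "Ck_in (Suc k) X N J u \<longleftrightarrow> (\<exists>v. has_deriv_in X N J u v \<and> Ck_in k X N J v)"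

text \<open>\<open>[0,T]\<close>, which is \<open>[0,\<infinity>)\<close> for \<open>T = \<infinity>\<close>\<close>

definition time_ivl :: "ereal \<Rightarrow> real set" where
  "time_ivl T = {t. 0 \<le> t \<and> ereal t \<le> T}"

definition open_time_ivl :: "ereal \<Rightarrow> real set" where
  "open_time_ivl T = {t. 0 < t \<and> ereal t < T}"

text \<open>The time derivative \<open>u\<^sub>t\<close> in \<open>L\<^sup>2\<^sub>p\<close>.\<close>

definition tderiv :: "(real \<Rightarrow> real) \<Rightarrow> ereal \<Rightarrow> (real \<Rightarrow> real \<Rightarrow> real) \<Rightarrow> (real \<Rightarrow> real \<Rightarrow> real)" where
  "tderiv p T u = (SOME v. has_deriv_in L2 (L2p_norm p) (time_ivl T) u v)"


subsection \<open>Weak solutions\<close>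

definition weak_solution ::
  "(real \<Rightarrow> real) \<Rightarrow> real \<Rightarrow> ereal \<Rightarrow> (real \<Rightarrow> real) \<Rightarrow> (real \<Rightarrow> real) \<Rightarrow>
   (real \<Rightarrow> real \<Rightarrow> real) \<Rightarrow> bool" where
  "weak_solution p a T g h u \<longleftrightarrow>
     Ck_in 0 (V_space a) V_norm (time_ivl T) u \<and>
     Ck_in 1 L2 (L2p_norm p) (time_ivl T) u \<and>
     ((\<lambda>t. V_norm (\<lambda>x. u t x - g x)) \<longlongrightarrow> 0) (at_right 0) \<and>
     ((\<lambda>t. L2p_norm p (\<lambda>x. tderiv p T u t x - h x)) \<longlongrightarrow> 0) (at_right 0) \<and>
     (\<forall>\<phi> \<in> V_space a. \<forall>\<eta> \<in> test_functions (open_time_ivl T).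
        (\<integral>s. L2p_inner p (tderiv p T u s) \<phi> * deriv \<eta> s \<partial>(lebesgue_on (open_time_ivl T))) =
        (\<integral>s. (L2_inner (wderiv (wderiv (u s))) (wderiv (wderiv \<phi>)) +
               (L2p_norm p (u s))\<^sup>2 * L2p_inner p (u s) \<phi>) * \<eta> s
           \<partial>(lebesgue_on (open_time_ivl T))))"

end

theory Submission
  imports Defs "HOL-Complex_Analysis.Great_Picard"
begin

text \<open>
  Multiplication by \<open>sqrt p\<close> turns the weighted space into a fixed Hilbert space \<open>H\<close> of square
  integrable functions. As the energy space embeds compactly into \<open>H\<close>, the bilaplacian with the given
  boundary conditions has an orthonormal eigenbasis, with eigenvalues \<open>\<omega>\<^sub>n\<^sup>2\<close>. Let \<open>B\<close> be the operator
  with eigenvalues \<open>1 / \<omega>\<^sub>n\<close>. The energy space is the range of \<open>B\<close>, and for \<open>u = B w\<close>, \<open>v = u\<^sub>t\<close> the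
  equation reads \<open>(B w)' = v\<close>, \<open>(B v)' = - w - B (\<parallel>u\<parallel>\<^sup>2 u)\<close>. Rotating the pair \<open>(w, v)\<close> by the angles
  \<open>\<omega>\<^sub>n t\<close> removes the unbounded part and leaves an ordinary differential equation in \<open>H \<times> H\<close> with a locally
  Lipschitz right-hand side. Its solutions are global because the energy is conserved.
\<close>
section \<open>Orthonormal systems and diagonal operators\<close>

text \<open>The frequencies \<open>\<omega>\<^sub>n\<close> are unbounded, so \<open>w\<close> and
  \<open>v\<close> need not be differentiable in \<open>H\<close>; only \<open>B w\<close> and
  \<open>B v\<close> are. Testing the difference of two solutions with its time derivative is
  therefore not justified, and uniqueness, too, is proved in the rotated variables. The nonlinearity
  is cut off at a radius computed from the initial energy, in such a way that it remains a gradient: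
  the modified equation has a globally Lipschitz right-hand side and conserves a modified energy,
  which confines the solution to the region where nothing was cut off. The spectral theorem works
  with the closed set of pairs \<open>(sqrt p u, u'')\<close>, because derivatives are weak and
  functions are classes. Minimising the quotient of the two norms step by step gives the basis, and
  the images \<open>u''\<close> of the basis vectors are orthogonal too, whence the isometry between
  the energy space and \<open>H\<close>. The inner point conditions leave the domain dense, since
  test functions vanishing near both points are dense. The weak form, scalar in time, becomes
  differentiability of \<open>B v\<close> by the lemma of du Bois-Reymond.\<close>

lemma has_vector_derivative_iff_quotient:
  fixes f :: "real \<Rightarrow> 'a::real_normed_vector"
  shows "(f has_vector_derivative f') (at t within A) \<longleftrightarrow>
    ((\<lambda>s. (f s - f t) /\<^sub>R (s - t)) \<longlongrightarrow> f') (at t within A)"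
proof -
  have "(f has_vector_derivative f') (at t within A) \<longleftrightarrow>
      ((\<lambda>s. norm (f s - f t - (s - t) *\<^sub>R f') / norm (s - t)) \<longlongrightarrow> 0) (at t within A)"
    by (simp add: has_vector_derivative_def has_derivative_iff_norm bounded_linear_scaleR_left)
  also have "\<dots> \<longleftrightarrow> ((\<lambda>s. norm ((f s - f t) /\<^sub>R (s - t) - f')) \<longlongrightarrow> 0) (at t within A)"
  proof (rule Lim_cong_within)
    fix s assume "s \<noteq> t"
    then have "(f s - f t) /\<^sub>R (s - t) - f' = (f s - f t - (s - t) *\<^sub>R f') /\<^sub>R (s - t)"
      by (simp add: scaleR_diff_right)
    then show "norm (f s - f t - (s - t) *\<^sub>R f') / norm (s - t) = norm ((f s - f t) /\<^sub>R (s - t) - f')"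
      by (simp add: divide_inverse mult.commute)
  qed auto
  also have "\<dots> \<longleftrightarrow> ((\<lambda>s. (f s - f t) /\<^sub>R (s - t)) \<longlongrightarrow> f') (at t within A)"
    by (simp add: tendsto_norm_zero_iff LIM_zero_iff)
  finally show ?thesis .
qed

locale ons =
  fixes e :: "nat \<Rightarrow> 'h::{real_inner, banach}"
  assumes orth: "i \<noteq> j \<Longrightarrow> e i \<bullet> e j = 0"
    and unit_or_zero: "e i = 0 \<or> norm (e i) = 1"
begin

text \<open>At a padding index the coefficient vanishes together with \<open>e k\<close>; otherwise
  the second factor is 1. This removes the factors \<open>e k \<bullet> e k\<close> left behind by
  the padded sums.\<close>

lemma coeff_inner_self: "(x \<bullet> e k) * (e k \<bullet> e k) = x \<bullet> e k"
  using unit_or_zero[of k] by (auto simp: norm_eq_1)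

lemma inner_sum_e:
  assumes "finite A"
  shows "(\<Sum>n\<in>A. c n *\<^sub>R e n) \<bullet> e k = (if k \<in> A then c k * (e k \<bullet> e k) else 0)"
proof -
  have "(\<Sum>n\<in>A. c n *\<^sub>R e n) \<bullet> e k = (\<Sum>n\<in>A. if n = k then c k * (e k \<bullet> e k) else 0)"
    unfolding inner_sum_left by (rule sum.cong) (auto simp: orth)
  then show ?thesis using assms by (simp add: sum.delta')
qed

lemma norm_sum_e:
  assumes "finite A"
  shows "(norm (\<Sum>n\<in>A. c n *\<^sub>R e n))\<^sup>2 = (\<Sum>n\<in>A. (c n)\<^sup>2 * (e n \<bullet> e n))"
proof -
  have "(norm (\<Sum>n\<in>A. c n *\<^sub>R e n))\<^sup>2 = (\<Sum>k\<in>A. c k * ((\<Sum>n\<in>A. c n *\<^sub>R e n) \<bullet> e k))"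
    by (simp add: power2_norm_eq_inner inner_sum_right)
  also have "\<dots> = (\<Sum>n\<in>A. (c n)\<^sup>2 * (e n \<bullet> e n))"
    by (rule sum.cong) (simp_all add: inner_sum_e assms power2_eq_square mult.assoc)
  finally show ?thesis .
qed

lemma inner_self_le_1: "e n \<bullet> e n \<le> 1"
  using unit_or_zero[of n] by (auto simp: norm_eq_1)

lemma norm_sum_e_le:
  assumes "finite A"
  shows "(norm (\<Sum>n\<in>A. c n *\<^sub>R e n))\<^sup>2 \<le> (\<Sum>n\<in>A. (c n)\<^sup>2)"
  unfolding norm_sum_e[OF assms]
  by (intro sum_mono mult_left_le inner_self_le_1) simp_all

lemma norm_residual:
  assumes "finite A"
  shows "(norm (x - (\<Sum>n\<in>A. (x \<bullet> e n) *\<^sub>R e n)))\<^sup>2 = (norm x)\<^sup>2 - (\<Sum>n\<in>A. (x \<bullet> e n)\<^sup>2)"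
proof -
  let ?p = "\<Sum>n\<in>A. (x \<bullet> e n) *\<^sub>R e n"
  have 1: "x \<bullet> ?p = (\<Sum>n\<in>A. (x \<bullet> e n)\<^sup>2)"
    by (simp add: inner_sum_right power2_eq_square)
  have 2: "?p \<bullet> ?p = (\<Sum>n\<in>A. (x \<bullet> e n)\<^sup>2)"
    unfolding norm_sum_e[OF assms, unfolded power2_norm_eq_inner]
    by (rule sum.cong) (simp_all only: power2_eq_square mult.assoc coeff_inner_self)
  have "(x - ?p) \<bullet> (x - ?p) = x \<bullet> x - 2 * (x \<bullet> ?p) + ?p \<bullet> ?p"
    by (simp add: inner_diff_left inner_diff_right inner_commute)
  then show ?thesis unfolding 1 2 power2_norm_eq_inner by simp
qed

lemma bessel_sum:
  assumes "finite A"
  shows "(\<Sum>n\<in>A. (x \<bullet> e n)\<^sup>2) \<le> (norm x)\<^sup>2"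
  using norm_residual[OF assms, of x] zero_le_power2[of "norm (x - (\<Sum>n\<in>A. (x \<bullet> e n) *\<^sub>R e n))"]
  by linarith

lemma summable_bessel: "summable (\<lambda>n. (x \<bullet> e n)\<^sup>2)"
  by (rule bounded_imp_summable[where B = "(norm x)\<^sup>2"]) (auto intro: bessel_sum)

text \<open>Riesz-Fischer: a block of the vector series has squared norm at most the same block of
  the squared coefficients, so the Cauchy criterion carries over and completeness gives the
  limit.\<close>

lemma summable_scaleR_e:
  assumes "summable (\<lambda>n. (c n)\<^sup>2)"
  shows "summable (\<lambda>n. c n *\<^sub>R e n)"
  unfolding summable_Cauchy
proof (intro allI impI)
  fix \<epsilon> :: real assume \<epsilon>: "0 < \<epsilon>"
  then obtain N where N: "\<And>m n. m \<ge> N \<Longrightarrow> norm (\<Sum>k\<in>{m..<n}. (c k)\<^sup>2) < \<epsilon>\<^sup>2"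
    using assms unfolding summable_Cauchy by (meson zero_less_power)
  have "norm (\<Sum>k\<in>{m..<n}. c k *\<^sub>R e k) < \<epsilon>" if "m \<ge> N" for m n
  proof (rule power_less_imp_less_base[where n = 2])
    show "(norm (\<Sum>k\<in>{m..<n}. c k *\<^sub>R e k))\<^sup>2 < \<epsilon>\<^sup>2"
      using norm_sum_e_le[of "{m..<n}" c] N[OF that, of n] by auto
  qed (use \<epsilon> in simp)
  then show "\<exists>N. \<forall>m\<ge>N. \<forall>n. norm (\<Sum>k\<in>{m..<n}. c k *\<^sub>R e k) < \<epsilon>" by blast
qed

lemma inner_suminf_e:
  assumes "summable (\<lambda>n. (c n)\<^sup>2)"
  shows "(\<Sum>n. c n *\<^sub>R e n) \<bullet> e k = c k * (e k \<bullet> e k)"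
proof -
  have "(\<lambda>n. (c n *\<^sub>R e n) \<bullet> e k) sums ((\<Sum>n. c n *\<^sub>R e n) \<bullet> e k)"
    by (rule bounded_linear.sums[OF bounded_linear_inner_left])
      (simp add: summable_sums summable_scaleR_e assms)
  moreover have "(\<lambda>n. (c n *\<^sub>R e n) \<bullet> e k) sums (\<Sum>n\<in>{k}. (c n *\<^sub>R e n) \<bullet> e k)"
    by (rule sums_finite) (auto simp: orth)
  ultimately show ?thesis by (simp add: sums_unique2)
qed

text \<open>The second hypothesis makes the coefficients at padding indices zero; they would count
  on the right but not on the left.\<close>

lemma norm_suminf_e:
  assumes "summable (\<lambda>n. (c n)\<^sup>2)" "\<And>n. e n = 0 \<Longrightarrow> c n = 0"
  shows "(norm (\<Sum>n. c n *\<^sub>R e n))\<^sup>2 = (\<Sum>n. (c n)\<^sup>2)"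
proof -
  have c: "(c n)\<^sup>2 * (e n \<bullet> e n) = (c n)\<^sup>2" for n
    using unit_or_zero[of n] assms(2)[of n] by (auto simp: norm_eq_1)
  have "(\<lambda>N. (norm (\<Sum>n<N. c n *\<^sub>R e n))\<^sup>2) \<longlonglongrightarrow> (norm (\<Sum>n. c n *\<^sub>R e n))\<^sup>2"
    by (intro tendsto_intros summable_LIMSEQ summable_scaleR_e assms)
  moreover have "(\<lambda>N. \<Sum>n<N. (c n)\<^sup>2) \<longlonglongrightarrow> (\<Sum>n. (c n)\<^sup>2)"
    by (rule summable_LIMSEQ[OF assms(1)])
  ultimately show ?thesis by (simp add: norm_sum_e c LIMSEQ_unique)
qed

end

section \<open>Orthonormal bases and functions of a diagonal operator\<close>

locale onb = ons +
  assumes total: "(\<And>n. x \<bullet> e n = 0) \<Longrightarrow> x = 0"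
begin

text \<open>Totality applied to the difference. Identities between diagonal operators reduce in this
  way to identities between real multipliers.\<close>

lemma eqI_coeff: "(\<And>n. x \<bullet> e n = y \<bullet> e n) \<Longrightarrow> x = y"
  using total[of "x - y"] by (simp add: inner_diff_left)

lemma suminf_coeff: "(\<Sum>n. (x \<bullet> e n) *\<^sub>R e n) = x"
  by (rule eqI_coeff) (simp add: inner_suminf_e summable_bessel coeff_inner_self)

lemma sums_coeff: "(\<lambda>n. (x \<bullet> e n) *\<^sub>R e n) sums x"
  by (metis suminf_coeff summable_bessel summable_scaleR_e summable_sums)

lemma parseval: "(\<lambda>n. (x \<bullet> e n) * (y \<bullet> e n)) sums (x \<bullet> y)"
  using bounded_linear.sums[OF bounded_linear_inner_left sums_coeff[of x], of y]
  by (simp add: inner_commute)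

lemma parseval_norm: "(\<lambda>n. (x \<bullet> e n)\<^sup>2) sums (norm x)\<^sup>2"
  using parseval[of x x] by (simp add: power2_eq_square power2_norm_eq_inner[symmetric])

text \<open>The multiplier \<open>a\<close> is meant to be bounded; this is then the functional
  calculus of an operator with eigenvectors \<open>e\<close>. The unbounded operator itself is never
  formed, only its inverse square root and the sines and cosines.\<close>

definition diag :: "(nat \<Rightarrow> real) \<Rightarrow> 'a \<Rightarrow> 'a" where
  "diag a x = (\<Sum>n. (a n * (x \<bullet> e n)) *\<^sub>R e n)"

lemma summable_diag_coeff:
  assumes "bounded (range a)"
  shows "summable (\<lambda>n. (a n * (x \<bullet> e n))\<^sup>2)"
proof -
  from assms obtain M where M: "\<And>n. \<bar>a n\<bar> \<le> M" by (auto simp: bounded_iff)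
  show ?thesis
  proof (rule summable_comparison_test')
    show "summable (\<lambda>n. M\<^sup>2 * (x \<bullet> e n)\<^sup>2)" by (intro summable_mult summable_bessel)
    show "norm ((a n * (x \<bullet> e n))\<^sup>2) \<le> M\<^sup>2 * (x \<bullet> e n)\<^sup>2" for n
      using M[of n] by (simp add: power_mult_distrib mult_right_mono abs_le_square_iff[symmetric])
  qed
qed

lemma inner_diag:
  assumes "bounded (range a)"
  shows "diag a x \<bullet> e k = a k * (x \<bullet> e k)"
  unfolding diag_def inner_suminf_e[OF summable_diag_coeff[OF assms]]
  by (simp add: mult.assoc coeff_inner_self)

lemma norm_diag_le:
  assumes "\<And>n. \<bar>a n\<bar> \<le> M"
  shows "norm (diag a x) \<le> M * norm x"
proof (rule power2_le_imp_le)
  have b: "bounded (range a)" using assms by (auto simp: bounded_iff)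
  have M: "M \<ge> 0" using assms[of 0] by linarith
  have "(norm (diag a x))\<^sup>2 = (\<Sum>n. (a n * (x \<bullet> e n))\<^sup>2)"
    using parseval_norm[of "diag a x"] by (simp add: inner_diag[OF b] sums_iff)
  also have "\<dots> \<le> (\<Sum>n. M\<^sup>2 * (x \<bullet> e n)\<^sup>2)"
  proof (rule suminf_le)
    show "(a n * (x \<bullet> e n))\<^sup>2 \<le> M\<^sup>2 * (x \<bullet> e n)\<^sup>2" for n
      using assms[of n] by (simp add: power_mult_distrib mult_right_mono abs_le_square_iff[symmetric])
  qed (intro summable_diag_coeff b summable_mult summable_bessel)+
  also have "\<dots> = (M * norm x)\<^sup>2"
    using parseval_norm[of x] by (simp add: suminf_mult summable_bessel sums_iff power_mult_distrib)
  finally show "(norm (diag a x))\<^sup>2 \<le> (M * norm x)\<^sup>2" .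
  show "0 \<le> M * norm x" using M by simp
qed

lemma diag_add: "bounded (range a) \<Longrightarrow> diag a (x + y) = diag a x + diag a y"
  by (rule eqI_coeff) (simp add: inner_diag inner_add_left algebra_simps)

lemma diag_scaleR: "bounded (range a) \<Longrightarrow> diag a (c *\<^sub>R x) = c *\<^sub>R diag a x"
  by (rule eqI_coeff) (simp add: inner_diag)

lemma bounded_linear_diag:
  assumes "bounded (range a)"
  shows "bounded_linear (diag a)"
proof -
  from assms obtain M where M: "\<And>n. \<bar>a n\<bar> \<le> M" by (auto simp: bounded_iff)
  show ?thesis
    by (rule bounded_linear_intro[where K = M])
      (use norm_diag_le[OF M] in \<open>auto simp: diag_add diag_scaleR assms mult.commute\<close>)
qed

lemma bounded_range_mult:
  fixes a b :: "nat \<Rightarrow> real"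
  assumes "bounded (range a)" "bounded (range b)"
  shows "bounded (range (\<lambda>n. a n * b n))"
proof -
  from assms obtain M N where "\<And>n. \<bar>a n\<bar> \<le> M" "\<And>n. \<bar>b n\<bar> \<le> N" by (auto simp: bounded_iff)
  then have "\<bar>a n * b n\<bar> \<le> M * N" for n
    unfolding abs_mult by (intro mult_mono) (auto intro: order_trans[OF abs_ge_zero])
  then show ?thesis by (auto simp: bounded_iff)
qed

lemma diag_diag:
  assumes "bounded (range a)" "bounded (range b)"
  shows "diag a (diag b x) = diag (\<lambda>n. a n * b n) x"
  by (rule eqI_coeff) (simp add: inner_diag assms bounded_range_mult)

lemma diag_self_adjoint:
  assumes "bounded (range a)"
  shows "diag a x \<bullet> y = x \<bullet> diag a y"
  using parseval[of "diag a x" y] parseval[of x "diag a y"]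
  by (simp add: inner_diag assms sums_iff mult_ac)

text \<open>The multipliers converge for each index but not uniformly, as for
  \<open>cos (\<omega> n * s)\<close> with unbounded \<open>\<omega>\<close>, so only strong
  convergence can be expected. A finite section of \<open>x\<close> is treated termwise, and the
  common bound \<open>M\<close> controls the remainder.\<close>

lemma tendsto_diag_const:
  assumes b: "\<And>n. ((\<lambda>s. b s n) \<longlongrightarrow> b0 n) F"
    and M: "\<And>s n. \<bar>b s n\<bar> \<le> M" "\<And>n. \<bar>b0 n\<bar> \<le> M"
  shows "((\<lambda>s. diag (b s) x) \<longlongrightarrow> diag b0 x) F"
proof (rule tendstoI)
  fix \<epsilon> :: real assume \<epsilon>: "0 < \<epsilon>"
  have M0: "M \<ge> 0" using M(2)[of 0] by linarith
  have bd: "bounded (range (b s))" "bounded (range b0)" for s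
    using M by (auto simp: bounded_iff)
  define P where "P N = (\<Sum>n<N. (x \<bullet> e n) *\<^sub>R e n)" for N
  have "P \<longlonglongrightarrow> x" using sums_coeff[of x] unfolding sums_def P_def .
  then have "eventually (\<lambda>N. norm (P N - x) < \<epsilon> / (4 * (M + 1))) sequentially"
    using \<epsilon> M0 by (auto simp flip: dist_norm intro!: tendstoD)
  then obtain N where N: "norm (P N - x) < \<epsilon> / (4 * (M + 1))"
    by (auto simp: eventually_sequentially)
  have diagP: "diag a (P N) = (\<Sum>n<N. (a n * (x \<bullet> e n)) *\<^sub>R e n)" if "bounded (range a)" for a
    by (rule eqI_coeff)
      (simp add: inner_diag that inner_sum_e P_def mult.assoc)
  have "((\<lambda>s. diag (b s) (P N)) \<longlongrightarrow> diag b0 (P N)) F"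
    unfolding diagP[OF bd(1)] diagP[OF bd(2)] by (intro tendsto_intros b)
  then have "eventually (\<lambda>s. dist (diag (b s) (P N)) (diag b0 (P N)) < \<epsilon> / 2) F"
    using \<epsilon> by (intro tendstoD) auto
  then show "eventually (\<lambda>s. dist (diag (b s) x) (diag b0 x) < \<epsilon>) F"
  proof (rule eventually_mono)
    fix s assume s: "dist (diag (b s) (P N)) (diag b0 (P N)) < \<epsilon> / 2"
    have c: "c * (\<epsilon> / (4 * c)) = \<epsilon> / 4" if "c \<noteq> 0" for c :: real using that by simp
    have d: "norm (diag a x - diag a (P N)) < \<epsilon> / 4" if "\<And>n. \<bar>a n\<bar> \<le> M" for a
    proof -
      have "bounded (range a)" using that by (auto simp: bounded_iff)
      then interpret bounded_linear "diag a" by (rule bounded_linear_diag)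
      have "norm (diag a x - diag a (P N)) \<le> M * norm (x - P N)"
        unfolding diff[symmetric] by (rule norm_diag_le[OF that])
      also have "\<dots> \<le> (M + 1) * norm (P N - x)"
        by (simp add: norm_minus_commute mult_right_mono)
      also have "\<dots> < (M + 1) * (\<epsilon> / (4 * (M + 1)))"
        using M0 by (intro mult_strict_left_mono N) simp
      also have "\<dots> = \<epsilon> / 4" using M0 by (intro c) simp
      finally show ?thesis .
    qed
    have "norm (diag (b s) x - diag b0 x) \<le> norm (diag (b s) x - diag (b s) (P N))
        + norm (diag (b s) (P N) - diag b0 (P N)) + norm (diag b0 x - diag b0 (P N))"
      by norm
    then show "dist (diag (b s) x) (diag b0 x) < \<epsilon>"
      using d[of "b s"] d[of b0] s M unfolding dist_norm by fastforce
  qed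
qed

lemma tendsto_diag:
  assumes b: "\<And>n. ((\<lambda>s. b s n) \<longlongrightarrow> b0 n) F"
    and M: "\<And>s n. \<bar>b s n\<bar> \<le> M" "\<And>n. \<bar>b0 n\<bar> \<le> M"
    and \<xi>: "(\<xi> \<longlongrightarrow> x) F"
  shows "((\<lambda>s. diag (b s) (\<xi> s)) \<longlongrightarrow> diag b0 x) F"
proof -
  have bd: "bounded (range (b s))" for s using M by (auto simp: bounded_iff)
  have "((\<lambda>s. diag (b s) (\<xi> s - x)) \<longlongrightarrow> 0) F"
  proof (rule Lim_null_comparison)
    show "eventually (\<lambda>s. norm (diag (b s) (\<xi> s - x)) \<le> M * norm (\<xi> s - x)) F"
      by (intro always_eventually allI norm_diag_le M)
    have "((\<lambda>s. M * norm (\<xi> s - x)) \<longlongrightarrow> M * norm (x - x)) F" by (intro tendsto_intros \<xi>)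
    then show "((\<lambda>s. M * norm (\<xi> s - x)) \<longlongrightarrow> 0) F" by simp
  qed
  moreover have "((\<lambda>s. diag (b s) x) \<longlongrightarrow> diag b0 x) F"
    by (rule tendsto_diag_const[OF b M])
  ultimately have "((\<lambda>s. diag (b s) (\<xi> s - x) + diag (b s) x) \<longlongrightarrow> 0 + diag b0 x) F"
    by (rule tendsto_add)
  then show ?thesis
    by (simp add: bounded_linear_diag[OF bd, THEN bounded_linear.linear, THEN linear_diff])
qed

text \<open>By the mean value theorem the bound on \<open>b'\<close> bounds the difference quotients
  of \<open>b\<close> uniformly in the index, so that their convergence at each index suffices for
  the product rule.\<close>

lemma has_vector_derivative_diag:
  fixes b :: "real \<Rightarrow> nat \<Rightarrow> real"
  assumes b: "\<And>n s. ((\<lambda>s. b s n) has_real_derivative b' s n) (at s)"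
    and M: "\<And>s n. \<bar>b s n\<bar> \<le> M" "\<And>s n. \<bar>b' s n\<bar> \<le> M"
    and \<xi>: "(\<xi> has_vector_derivative \<xi>') (at t within A)"
  shows "((\<lambda>s. diag (b s) (\<xi> s)) has_vector_derivative diag (b' t) (\<xi> t) + diag (b t) \<xi>') (at t within A)"
proof -
  have bd: "bounded (range (b s))" "bounded (range (b' s))" for s using M by (auto simp: bounded_iff intro!: exI[of _ M])
  \<comment> \<open>At \<open>s = t\<close> the quotient is replaced by the derivative, since the
    convergence lemma asks for bounds at every \<open>s\<close>, not only eventually.\<close>
  define q where "q s n = (if s = t then b' t n else (b s n - b t n) / (s - t))" for s n
  have q_le: "\<bar>q s n\<bar> \<le> M" for s n
  proof (cases "s = t")
    case False
    have "\<bar>b s n - b t n\<bar> \<le> M * \<bar>s - t\<bar>"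
      by (rule field_differentiable_bound[where S = UNIV and f' = "\<lambda>s. b' s n", unfolded real_norm_def])
        (use b M in \<open>auto\<close>)
    then show ?thesis using False by (simp add: q_def divide_simps)
  qed (simp add: q_def M)
  have bdq: "bounded (range (q s))" for s using q_le by (auto simp: bounded_iff)
  have q_lim: "((\<lambda>s. q s n) \<longlongrightarrow> b' t n) (at t within A)" for n
  proof -
    have "((\<lambda>s. (b s n - b t n) / (s - t)) \<longlongrightarrow> b' t n) (at t within A)"
      using has_field_derivative_at_within[OF b[where s = t and n = n], of A]
      by (simp add: has_field_derivative_iff)
    then show ?thesis
      by (rule Lim_transform_eventually) (auto simp: q_def eventually_at_filter)
  qed
  have bc: "((\<lambda>s. b s n) \<longlongrightarrow> b t n) (at t within A)" for n
    using DERIV_isCont[OF b[of n t]] by (simp add: isCont_def tendsto_within_subset[where S = UNIV])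
  have \<xi>q: "((\<lambda>s. (\<xi> s - \<xi> t) /\<^sub>R (s - t)) \<longlongrightarrow> \<xi>') (at t within A)"
    using \<xi> unfolding has_vector_derivative_iff_quotient by simp
  have "((\<lambda>s. diag (q s) (\<xi> t) + diag (b s) ((\<xi> s - \<xi> t) /\<^sub>R (s - t)))
      \<longlongrightarrow> diag (b' t) (\<xi> t) + diag (b t) \<xi>') (at t within A)"
    by (intro tendsto_add tendsto_diag[where M = M] tendsto_const q_lim bc q_le M \<xi>q)
  moreover have "eventually (\<lambda>s. diag (q s) (\<xi> t) + diag (b s) ((\<xi> s - \<xi> t) /\<^sub>R (s - t))
      = (diag (b s) (\<xi> s) - diag (b t) (\<xi> t)) /\<^sub>R (s - t)) (at t within A)"
    unfolding eventually_at_filter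
  proof (intro always_eventually allI impI)
    fix s assume "s \<noteq> t"
    then show "diag (q s) (\<xi> t) + diag (b s) ((\<xi> s - \<xi> t) /\<^sub>R (s - t))
      = (diag (b s) (\<xi> s) - diag (b t) (\<xi> t)) /\<^sub>R (s - t)"
      by (intro eqI_coeff)
        (simp add: inner_diag bd bdq inner_add_left inner_diff_left; simp add: q_def divide_inverse algebra_simps)
  qed
  ultimately show ?thesis
    unfolding has_vector_derivative_iff_quotient by (rule Lim_transform_eventually)
qed

end

section \<open>An ordinary differential equation in Banach space\<close>

text \<open>The integral of \<open>D\<close> times the integrating factor
  \<open>exp (- L * s)\<close> has nonpositive derivative and starts at 0. Hence the integral is at
  most 0, and \<open>le\<close> leaves no room for \<open>D\<close> above 0.\<close>

lemma gronwall_zero: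
  fixes D :: "real \<Rightarrow> real"
  assumes D: "continuous_on {0..T} D" and D0: "\<And>t. t \<in> {0..T} \<Longrightarrow> 0 \<le> D t"
    and le: "\<And>t. t \<in> {0..T} \<Longrightarrow> D t \<le> L * integral {0..t} D" and L: "0 \<le> L"
    and t: "t \<in> {0..T}"
  shows "D t = 0"
proof -
  define g where "g s = exp (- L * s) * integral {0..s} D" for s
  have der: "((\<lambda>s. integral {0..s} D) has_real_derivative D s) (at s within {0..T})" if "s \<in> {0..T}" for s
    using integral_has_vector_derivative[OF D that] by (simp add: has_real_derivative_iff_has_vector_derivative)
  have dg: "(g has_real_derivative exp (- L * s) * (D s - L * integral {0..s} D)) (at s within {0..T})"
    if "s \<in> {0..T}" for s
    unfolding g_def by (auto intro!: derivative_eq_intros der[OF that] simp: algebra_simps)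
  have "g t \<le> g 0"
  proof (rule DERIV_nonpos_imp_decreasing_open[where f = g])
    show "0 \<le> t" using t by simp
    fix s assume s: "0 < s" "s < t"
    then have "at s within {0..T} = at s" using t by (intro at_within_interior) auto
    then show "\<exists>y. (g has_real_derivative y) (at s) \<and> y \<le> 0"
      using dg[of s] le[of s] s t by (auto intro!: exI mult_nonneg_nonpos)
  next
    have "continuous_on {0..T} g"
      by (rule DERIV_continuous_on) (rule dg)
    then show "continuous_on {0..t} g" by (rule continuous_on_subset) (use t in auto)
  qed
  then have "integral {0..t} D \<le> 0" by (simp add: g_def mult_le_0_iff not_le)
  then have "L * integral {0..t} D \<le> 0" by (rule mult_nonneg_nonpos[OF L])
  with le[OF t] D0[OF t] show ?thesis by linarith
qed

lemma integral_exp_scaled: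
  fixes L :: real
  assumes "0 < L" "0 \<le> t"
  shows "integral {0..t} (\<lambda>s. L * exp (2 * L * s)) = (exp (2 * L * t) - 1) / 2"
proof -
  have "((\<lambda>s. L * exp (2 * L * s)) has_integral (exp (2 * L * t) / 2 - exp (2 * L * 0) / 2)) {0..t}"
    by (rule fundamental_theorem_of_calculus)
      (use assms in \<open>auto intro!: derivative_eq_intros simp flip: has_real_derivative_iff_has_vector_derivative\<close>)
  then have "integral {0..t} (\<lambda>s. L * exp (2 * L * s)) = exp (2 * L * t) / 2 - exp (2 * L * 0) / 2"
    by (rule integral_unique)
  then show ?thesis by (simp only: diff_divide_distrib mult_zero_right exp_zero)
qed

text \<open>The derivative at \<open>t\<close> only sees a neighbourhood of \<open>t\<close>, so the
  ray may be exchanged for \<open>{0..t + 1}\<close>.\<close>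

lemma integral_has_vector_derivative_ray:
  fixes f :: "real \<Rightarrow> 'e::banach"
  assumes "continuous_on {0..} f" "0 \<le> t"
  shows "((\<lambda>t. integral {0..t} f) has_vector_derivative f t) (at t within {0..})"
proof -
  have "((\<lambda>t. integral {0..t} f) has_vector_derivative f t) (at t within {0..t + 1})"
    by (rule integral_has_vector_derivative)
      (use assms in \<open>auto intro: continuous_on_subset\<close>)
  moreover have "at t within {0..t + 1} = at t within {0..}"
    by (rule at_within_nhd[where S = "{..<t + 1}"]) (use assms in auto)
  ultimately show ?thesis by simp
qed

text \<open>Picard iteration is a contraction for the sup norm weighted by \<open>exp (- 2 L t)\<close>, so
  the solution is global without continuation.\<close>

lemma lipschitz_ivp_exists:
  fixes G :: "real \<Rightarrow> 'e::banach \<Rightarrow> 'e"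
  assumes cont: "continuous_on ({0..} \<times> UNIV) (\<lambda>(t, y). G t y)"
    and lip: "\<And>t x y. 0 \<le> t \<Longrightarrow> norm (G t x - G t y) \<le> L * norm (x - y)"
    and zero: "\<And>t. 0 \<le> t \<Longrightarrow> G t 0 = 0" and L: "0 < L"
  obtains Y where "Y 0 = y0"
    "\<And>t. 0 \<le> t \<Longrightarrow> (Y has_vector_derivative G t (Y t)) (at t within {0..})"
proof -
  \<comment> \<open>The unknown \<open>X\<close> is the solution divided by
    \<open>exp (2 * L * s)\<close>. The weighted norm of the solution becomes the plain sup norm of
    \<open>X\<close>, and the complete space of bounded continuous functions can be used. Its
    elements live on the whole line, which explains \<open>max 0\<close> below: negative times
    repeat the value at 0.\<close>
  define N where "N X s = G s (exp (2 * L * s) *\<^sub>R X s)" for X :: "real \<Rightarrow> 'e" and s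
  define P where "P X t = exp (- (2 * L * max 0 t)) *\<^sub>R (y0 + integral {0..max 0 t} (N X))"
    for X :: "real \<Rightarrow> 'e" and t
  have N_cont: "continuous_on {0..} (N X)" if "continuous_on UNIV X" for X
    unfolding N_def
    by (rule continuous_on_compose2[OF cont, where f = "\<lambda>s. (s, exp (2 * L * s) *\<^sub>R X s)", simplified])
      (auto intro!: continuous_intros continuous_on_subset[OF that])
  have N_int: "N X integrable_on {0..t}" if "continuous_on UNIV X" for X t
    by (rule integrable_continuous_real) (rule continuous_on_subset[OF N_cont[OF that]], auto)
  \<comment> \<open>The weight grows with exponent \<open>2 * L\<close> while the Lipschitz constant
    is \<open>L\<close>; integration gains the factor 1/2 that becomes the contraction
    constant.\<close>
  have int_le: "norm (integral {0..t} f) \<le> exp (2 * L * t) / 2 * M"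
    if f: "f integrable_on {0..t}" and t: "0 \<le> t" and le: "\<And>s. 0 \<le> s \<Longrightarrow> norm (f s) \<le> L * exp (2 * L * s) * M"
    for f :: "real \<Rightarrow> 'e" and t M
  proof -
    have "0 \<le> L * exp (2 * L * 0) * M" by (rule order_trans[OF norm_ge_zero le]) simp
    then have M: "0 \<le> M" using L by (simp add: zero_le_mult_iff)
    have "norm (integral {0..t} f) \<le> integral {0..t} (\<lambda>s. L * exp (2 * L * s) * M)"
      by (rule integral_norm_bound_integral[OF f])
        (use le in \<open>auto intro!: integrable_continuous_real continuous_intros\<close>)
    also have "\<dots> = (exp (2 * L * t) - 1) / 2 * M"
      by (simp only: integral_mult_left integral_exp_scaled[OF L t])
    also have "\<dots> \<le> exp (2 * L * t) / 2 * M" using M by (intro mult_right_mono) auto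
    finally show ?thesis .
  qed
  have P_bcont: "P X \<in> bcontfun" if X: "X \<in> bcontfun" for X
  proof -
    have Xc: "continuous_on UNIV X" using X by (simp add: bcontfun_def)
    from X obtain M where M: "\<And>s. norm (X s) \<le> M" by (auto simp: bcontfun_def bounded_iff)
    have N_le: "norm (N X s) \<le> L * exp (2 * L * s) * M" if "0 \<le> s" for s
    proof -
      have "norm (N X s) \<le> L * norm (exp (2 * L * s) *\<^sub>R X s)"
        using lip[OF that, of "exp (2 * L * s) *\<^sub>R X s" 0] by (simp add: N_def zero[OF that])
      also have "\<dots> \<le> L * (exp (2 * L * s) * M)"
        using L M by (intro mult_left_mono) auto
      finally show ?thesis by (simp add: mult.assoc)
    qed
    have "continuous_on {0..} (\<lambda>t. integral {0..t} (N X))"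
      using integral_has_vector_derivative_ray[OF N_cont[OF Xc]]
      by (auto intro!: continuous_on_vector_derivative)
    then have "continuous_on UNIV (\<lambda>t. integral {0..max 0 t} (N X))"
      by (rule continuous_on_compose2[where f = "max 0"]) (auto intro!: continuous_intros)
    then have "continuous_on UNIV (P X)"
      unfolding P_def by (intro continuous_intros)
    moreover have "norm (P X t) \<le> norm y0 + M / 2" for t
    proof -
      let ?t = "max 0 t"
      have "norm (P X t) = exp (- (2 * L * ?t)) * norm (y0 + integral {0..?t} (N X))"
        by (simp add: P_def)
      also have "\<dots> \<le> exp (- (2 * L * ?t)) * (norm y0 + exp (2 * L * ?t) / 2 * M)"
        by (intro mult_left_mono norm_triangle_le add_left_mono int_le N_int Xc N_le) auto
      also have "\<dots> = exp (- (2 * L * ?t)) * norm y0 + M / 2"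
        by (simp add: distrib_left mult.assoc[symmetric] exp_minus)
      also have "\<dots> \<le> norm y0 + M / 2"
        using L by (simp add: mult_left_le_one_le)
      finally show ?thesis .
    qed
    ultimately show ?thesis by (auto simp: bcontfun_def bounded_iff)
  qed
  define \<Phi> where "\<Phi> X = Bcontfun (P (apply_bcontfun X))" for X
  have \<Phi>: "apply_bcontfun (\<Phi> X) = P (apply_bcontfun X)" for X
    unfolding \<Phi>_def by (rule Bcontfun_inverse) (rule P_bcont, rule apply_bcontfun)
  have "dist (\<Phi> X) (\<Phi> Z) \<le> 1 / 2 * dist X Z" for X Z
  proof (rule dist_bound)
    fix t :: real
    let ?t = "max 0 t"
    have Xc: "continuous_on UNIV (apply_bcontfun X)" for X :: "real \<Rightarrow>\<^sub>C 'e"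
      using apply_bcontfun[of X] by (simp add: bcontfun_def)
    have N_le: "norm (N X s - N Z s) \<le> L * exp (2 * L * s) * dist X Z" if "0 \<le> s" for s
    proof -
      have "norm (N X s - N Z s) \<le> L * (exp (2 * L * s) * dist (X s) (Z s))"
        using lip[OF that, of "exp (2 * L * s) *\<^sub>R X s" "exp (2 * L * s) *\<^sub>R Z s"]
        by (simp add: N_def scaleR_diff_right[symmetric] dist_norm)
      also have "\<dots> \<le> L * (exp (2 * L * s) * dist X Z)"
        using L by (intro mult_left_mono dist_bounded) auto
      finally show ?thesis by (simp add: mult.assoc)
    qed
    have "P X t - P Z t = exp (- (2 * L * ?t)) *\<^sub>R (integral {0..?t} (\<lambda>s. N X s - N Z s))"
      by (simp add: P_def scaleR_diff_right[symmetric] integral_diff N_int Xc)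
    then have "norm (P X t - P Z t) \<le> exp (- (2 * L * ?t)) * (exp (2 * L * ?t) / 2 * dist X Z)"
      by (simp only: norm_scaleR abs_exp_cancel)
        (intro mult_left_mono int_le integrable_diff N_int Xc N_le, auto)
    also have "\<dots> = 1 / 2 * dist X Z"
      by (simp add: mult.assoc[symmetric] exp_minus)
    finally show "dist (\<Phi> X t) (\<Phi> Z t) \<le> 1 / 2 * dist X Z"
      by (simp add: \<Phi> dist_norm)
  qed
  then obtain X where "\<Phi> X = X"
    using banach_fix_type[of "1 / 2" \<Phi>] by auto
  then have X: "apply_bcontfun X = P X" by (metis \<Phi>)
  define Y where "Y t = exp (2 * L * t) *\<^sub>R X t" for t
  have Xc: "continuous_on UNIV (apply_bcontfun X)"
    using apply_bcontfun[of X] by (simp add: bcontfun_def)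
  have Y: "Y t = y0 + integral {0..t} (N X)" if "0 \<le> t" for t
    using that by (subst Y_def, subst X) (simp add: P_def exp_minus)
  show ?thesis
  proof
    show "Y 0 = y0" by (simp add: Y)
    fix t :: real assume t: "0 \<le> t"
    have "((\<lambda>t. y0 + integral {0..t} (N X)) has_vector_derivative 0 + N X t) (at t within {0..})"
      by (intro has_vector_derivative_add has_vector_derivative_const
          integral_has_vector_derivative_ray N_cont Xc t)
    then have "((\<lambda>t. y0 + integral {0..t} (N X)) has_vector_derivative G t (Y t)) (at t within {0..})"
      by (simp add: N_def Y_def)
    then show "(Y has_vector_derivative G t (Y t)) (at t within {0..})"
      by (rule has_vector_derivative_transform[rotated 2]) (use t Y in auto)
  qed
qed

section \<open>Truncation of the cubic nonlinearity\<close>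

lemma abs_min_power2_diff_le:
  fixes x y :: "'a::real_normed_vector"
  assumes r: "0 \<le> r"
  shows "\<bar>(min (norm x) r)\<^sup>2 - (min (norm y) r)\<^sup>2\<bar> \<le> 2 * r * norm (x - y)"
proof -
  let ?a = "min (norm x) r" and ?b = "min (norm y) r"
  have "\<bar>?a - ?b\<bar> \<le> \<bar>norm x - norm y\<bar>" by (auto simp: min_def)
  also have "\<dots> \<le> norm (x - y)" by (rule norm_triangle_ineq3)
  finally have 1: "\<bar>?a - ?b\<bar> \<le> norm (x - y)" .
  have 2: "\<bar>?a + ?b\<bar> \<le> 2 * r" using r by (auto simp: min_def)
  have "\<bar>?a\<^sup>2 - ?b\<^sup>2\<bar> = \<bar>?a + ?b\<bar> * \<bar>?a - ?b\<bar>"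
    by (simp add: abs_mult[symmetric] power2_eq_square algebra_simps)
  also have "\<dots> \<le> (2 * r) * norm (x - y)" using 1 2 r by (intro mult_mono) auto
  finally show ?thesis .
qed

definition cube :: "'a::real_normed_vector \<Rightarrow> 'a" where
  "cube x = (norm x)\<^sup>2 *\<^sub>R x"

text \<open>Only the scalar factor is cut off. The map stays the gradient of a function of
  \<open>norm x\<close>, so that the truncated equation still conserves an energy, and it grows only
  linearly.\<close>

definition trunc_cube :: "real \<Rightarrow> 'a::real_normed_vector \<Rightarrow> 'a" where
  "trunc_cube r x = (min (norm x) r)\<^sup>2 *\<^sub>R x"

lemma trunc_cube_eq_cube: "norm x \<le> r \<Longrightarrow> trunc_cube r x = cube x"
  by (simp add: trunc_cube_def cube_def min_absorb1)

text \<open>If one of the points lies in the ball of radius \<open>r\<close>, the difference is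
  split so that the change of the scalar factor multiplies that point: the summands contribute
  \<open>r\<^sup>2\<close> and \<open>2 * r * r\<close>. If both points lie outside, the map acts on
  them as \<open>r\<^sup>2\<close> times the identity.\<close>

lemma trunc_cube_lipschitz:
  fixes x y :: "'a::real_normed_vector"
  assumes r: "0 \<le> r"
  shows "norm (trunc_cube r x - trunc_cube r y) \<le> 3 * r\<^sup>2 * norm (x - y)"
proof -
  have main: "norm (trunc_cube r x - trunc_cube r y) \<le> 3 * r\<^sup>2 * norm (x - y)" if "norm y \<le> r" for x y :: 'a
  proof -
    let ?m = "\<lambda>z. (min (norm z) r)\<^sup>2"
    have "trunc_cube r x - trunc_cube r y = ?m x *\<^sub>R (x - y) + (?m x - ?m y) *\<^sub>R y"
      by (simp add: trunc_cube_def algebra_simps)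
    also have "norm \<dots> \<le> ?m x * norm (x - y) + \<bar>?m x - ?m y\<bar> * norm y"
      by (rule norm_triangle_le) simp
    also have "\<dots> \<le> r\<^sup>2 * norm (x - y) + (2 * r * norm (x - y)) * r"
      using that r by (intro add_mono mult_mono abs_min_power2_diff_le power_mono) auto
    finally show ?thesis by (simp add: power2_eq_square algebra_simps)
  qed
  consider "norm y \<le> r" | "norm x \<le> r" | "norm x > r" "norm y > r" by linarith
  then show ?thesis
  proof cases
    case 2
    then show ?thesis using main[of x y] by (simp add: norm_minus_commute)
  next
    case 3
    then have "trunc_cube r x - trunc_cube r y = r\<^sup>2 *\<^sub>R (x - y)"
      by (simp add: trunc_cube_def scaleR_diff_right)
    then show ?thesis by (simp add: mult_right_mono)
  qed (rule main)
qed

lemma continuous_on_cube [continuous_intros]: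
  "continuous_on A f \<Longrightarrow> continuous_on A (\<lambda>x. cube (f x))"
  unfolding cube_def by (intro continuous_intros)

lemma continuous_on_trunc_cube [continuous_intros]:
  "continuous_on A f \<Longrightarrow> continuous_on A (\<lambda>x. trunc_cube r (f x))"
  unfolding trunc_cube_def by (intro continuous_intros)

text \<open>The linearisation error is at most \<open>(y - x)\<^sup>2\<close> in each combination of
  signs, so the kink of \<open>max\<close> at 0 does no harm. The function corrects the quartic
  potential beyond the truncation radius.\<close>

lemma has_real_derivative_max0_power2:
  "((\<lambda>x::real. (max 0 x)\<^sup>2) has_real_derivative 2 * max 0 x) (at x)"
proof -
  have le: "\<bar>(max 0 y)\<^sup>2 - (max 0 x)\<^sup>2 - 2 * max 0 x * (y - x)\<bar> \<le> (y - x)\<^sup>2" for y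
  proof -
    consider "0 \<le> x" "0 \<le> y" | "0 \<le> x" "y < 0" | "x < 0" "0 \<le> y" | "x < 0" "y < 0" by linarith
    then show ?thesis
    proof cases
      case 1
      have "y\<^sup>2 - x\<^sup>2 - 2 * x * (y - x) = (y - x)\<^sup>2" by (simp add: power2_eq_square algebra_simps)
      with 1 show ?thesis by simp
    next
      case 2
      then have "x * y \<le> 0" by (simp add: mult_nonneg_nonpos)
      moreover have e: "- x\<^sup>2 - 2 * x * (y - x) = x\<^sup>2 - 2 * (x * y)"
        by (simp add: power2_eq_square algebra_simps)
      moreover have "(y - x)\<^sup>2 = y\<^sup>2 + x\<^sup>2 - 2 * (x * y)"
        by (simp add: power2_eq_square algebra_simps)
      moreover have "(max 0 y)\<^sup>2 - (max 0 x)\<^sup>2 - 2 * max 0 x * (y - x) = - x\<^sup>2 - 2 * x * (y - x)"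
        using 2 by simp
      ultimately show ?thesis using zero_le_power2[of x] zero_le_power2[of y]
        by linarith
    next
      case 3
      then have "x * y \<le> 0" by (simp add: mult_nonpos_nonneg)
      moreover have "(y - x)\<^sup>2 = y\<^sup>2 + x\<^sup>2 - 2 * (x * y)"
        by (simp add: power2_eq_square algebra_simps)
      moreover have "(max 0 y)\<^sup>2 - (max 0 x)\<^sup>2 - 2 * max 0 x * (y - x) = y\<^sup>2"
        using 3 by simp
      ultimately show ?thesis using zero_le_power2[of x] zero_le_power2[of y] by linarith
    qed (simp add: max_def)
  qed
  have "((\<lambda>y. ((max 0 y)\<^sup>2 - (max 0 x)\<^sup>2) / (y - x)) \<longlongrightarrow> 2 * max 0 x) (at x)"
  proof (rule LIM_zero_cancel, rule Lim_null_comparison)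
    show "eventually (\<lambda>y. norm (((max 0 y)\<^sup>2 - (max 0 x)\<^sup>2) / (y - x) - 2 * max 0 x) \<le> \<bar>y - x\<bar>) (at x)"
      unfolding eventually_at_filter
    proof (intro always_eventually allI impI)
      fix y assume "y \<noteq> x"
      then have "((max 0 y)\<^sup>2 - (max 0 x)\<^sup>2) / (y - x) - 2 * max 0 x
          = ((max 0 y)\<^sup>2 - (max 0 x)\<^sup>2 - 2 * max 0 x * (y - x)) / (y - x)"
        by (simp add: diff_divide_distrib)
      with le[of y] \<open>y \<noteq> x\<close> show "norm (((max 0 y)\<^sup>2 - (max 0 x)\<^sup>2) / (y - x) - 2 * max 0 x) \<le> \<bar>y - x\<bar>"
        by (simp add: divide_le_eq power2_eq_square abs_mult[symmetric])
    qed
    have "((\<lambda>y. \<bar>y - x\<bar>) \<longlongrightarrow> \<bar>x - x\<bar>) (at x)" by (intro tendsto_intros)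
    then show "((\<lambda>y. \<bar>y - x\<bar>) \<longlongrightarrow> 0) (at x)" by simp
  qed
  then show ?thesis by (simp add: has_field_derivative_iff)
qed

section \<open>The abstract wave equation\<close>

locale wave = onb +
  fixes \<omega> :: "nat \<Rightarrow> real" and \<kappa> :: real
  assumes \<kappa>: "0 < \<kappa>" "\<And>n. \<kappa> \<le> \<omega> n"
begin

definition B :: "'a \<Rightarrow> 'a" where "B = diag (\<lambda>n. 1 / \<omega> n)"
definition Cs :: "real \<Rightarrow> 'a \<Rightarrow> 'a" where "Cs t = diag (\<lambda>n. cos (\<omega> n * t))"
definition Sn :: "real \<Rightarrow> 'a \<Rightarrow> 'a" where "Sn t = diag (\<lambda>n. sin (\<omega> n * t))"

lemma \<omega>_pos: "0 < \<omega> n"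
  using \<kappa>(1) \<kappa>(2)[of n] by linarith

lemma inverse_\<omega>_le: "\<bar>1 / \<omega> n\<bar> \<le> 1 / \<kappa>"
  using \<omega>_pos[of n] \<kappa> by (simp add: frac_le)

lemma bounded_multipliers:
  "bounded (range (\<lambda>n. 1 / \<omega> n))"
  "bounded (range (\<lambda>n. cos (\<omega> n * t)))"
  "bounded (range (\<lambda>n. sin (\<omega> n * t)))"
  unfolding bounded_iff using inverse_\<omega>_le
  by (intro exI[of _ "1 / \<kappa>"], simp) (intro exI[of _ 1], simp)+

lemmas inner_multipliers =
  inner_diag[OF bounded_multipliers(1), folded B_def]
  inner_diag[OF bounded_multipliers(2), folded Cs_def]
  inner_diag[OF bounded_multipliers(3), folded Sn_def]

lemmas inner_multiplier_simps = inner_multipliers inner_add_left inner_diff_left inner_minus_left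

lemma bounded_linear_multipliers: "bounded_linear B" "bounded_linear (Cs t)" "bounded_linear (Sn t)"
  unfolding B_def Cs_def Sn_def by (intro bounded_linear_diag bounded_multipliers)+

sublocale B: bounded_linear B by (rule bounded_linear_multipliers)
sublocale Cs: bounded_linear "Cs t" for t by (rule bounded_linear_multipliers)
sublocale Sn: bounded_linear "Sn t" for t by (rule bounded_linear_multipliers)

lemma norm_B_le: "norm (B x) \<le> norm x / \<kappa>"
  using norm_diag_le[of "\<lambda>n. 1 / \<omega> n" "1 / \<kappa>" x] inverse_\<omega>_le by (simp add: B_def)

lemma norm_Cs_le: "norm (Cs t x) \<le> norm x" and norm_Sn_le: "norm (Sn t x) \<le> norm x"
  using norm_diag_le[of "\<lambda>n. cos (\<omega> n * t)" 1 x] norm_diag_le[of "\<lambda>n. sin (\<omega> n * t)" 1 x]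
  by (simp_all add: Cs_def Sn_def)

lemma B_inj: "B x = B y \<Longrightarrow> x = y"
proof (rule eqI_coeff)
  fix n assume "B x = B y"
  then have "B x \<bullet> e n = B y \<bullet> e n" by simp
  then show "x \<bullet> e n = y \<bullet> e n" using \<omega>_pos[of n] by (simp add: inner_multiplier_simps)
qed

lemma self_adjoint: "B x \<bullet> y = x \<bullet> B y" "Cs t x \<bullet> y = x \<bullet> Cs t y" "Sn t x \<bullet> y = x \<bullet> Sn t y"
  unfolding B_def Cs_def Sn_def by (intro diag_self_adjoint bounded_multipliers)+

lemma multipliers_commute:
  "B (Cs t x) = Cs t (B x)" "B (Sn t x) = Sn t (B x)" "Sn t (Cs t x) = Cs t (Sn t x)"
  by (rule eqI_coeff, simp add: inner_multiplier_simps)+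

lemma Cs_Sn_sum: "Cs t (Cs t x) + Sn t (Sn t x) = x"
proof (rule eqI_coeff)
  fix n
  have "(Cs t (Cs t x) + Sn t (Sn t x)) \<bullet> e n = ((cos (\<omega> n * t))\<^sup>2 + (sin (\<omega> n * t))\<^sup>2) * (x \<bullet> e n)"
    by (simp only: inner_multiplier_simps power2_eq_square distrib_right mult.assoc)
  then show "(Cs t (Cs t x) + Sn t (Sn t x)) \<bullet> e n = x \<bullet> e n" by simp
qed

lemma Cs_0 [simp]: "Cs 0 x = x" and Sn_0 [simp]: "Sn 0 x = 0"
  by (rule eqI_coeff, simp add: inner_multiplier_simps)+

lemma Cs_Sn_norm: "(norm (Cs t x))\<^sup>2 + (norm (Sn t x))\<^sup>2 = (norm x)\<^sup>2"
proof -
  have "(Cs t (Cs t x) + Sn t (Sn t x)) \<bullet> x = x \<bullet> x" by (simp only: Cs_Sn_sum)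
  then show ?thesis
    by (simp add: inner_add_left self_adjoint power2_norm_eq_inner del: dot_square_norm)
qed

text \<open>The mixed terms cancel because \<open>Cs t\<close> and \<open>Sn t\<close> are
  self-adjoint and commute; what remains is cosine squared plus sine squared.\<close>

lemma rotation_norm:
  "(norm (Cs t x + Sn t y))\<^sup>2 + (norm (Cs t y - Sn t x))\<^sup>2 = (norm x)\<^sup>2 + (norm y)\<^sup>2"
proof -
  have "Cs t x \<bullet> Sn t y = Cs t y \<bullet> Sn t x"
    by (metis self_adjoint(2,3) multipliers_commute(3) inner_commute)
  then show ?thesis
    using Cs_Sn_norm[of t x] Cs_Sn_norm[of t y]
    by (simp add: power2_norm_eq_inner inner_add_left inner_add_right inner_diff_left inner_diff_right
        inner_commute del: dot_square_norm)
qed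

text \<open>Joint continuity in time and vector rests on strong convergence; \<open>Cs\<close> need
  not be continuous in operator norm when the frequencies are unbounded.\<close>

lemma continuous_on_Cs [continuous_intros]:
  fixes \<tau> :: "'b::t2_space \<Rightarrow> real"
  shows
  "continuous_on A \<tau> \<Longrightarrow> continuous_on A \<xi> \<Longrightarrow> continuous_on A (\<lambda>s. Cs (\<tau> s) (\<xi> s))"
  unfolding continuous_on_def Cs_def
  by (rule ballI, rule tendsto_diag[where M = 1]) (auto intro!: tendsto_intros)

lemma continuous_on_Sn [continuous_intros]:
  fixes \<tau> :: "'b::t2_space \<Rightarrow> real"
  shows
  "continuous_on A \<tau> \<Longrightarrow> continuous_on A \<xi> \<Longrightarrow> continuous_on A (\<lambda>s. Sn (\<tau> s) (\<xi> s))"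
  unfolding continuous_on_def Sn_def
  by (rule ballI, rule tendsto_diag[where M = 1]) (auto intro!: tendsto_intros)

lemma continuous_on_B [continuous_intros]: "continuous_on A \<xi> \<Longrightarrow> continuous_on A (\<lambda>s. B (\<xi> s))"
  by (rule B.continuous_on)

text \<open>The factor \<open>1 / \<omega> n\<close> from \<open>B\<close> cancels the
  \<open>\<omega> n\<close> of the chain rule, so the differentiated multiplier is bounded.
  \<open>1 + 1 / \<kappa>\<close> bounds both it and the multiplier
  \<open>cos (\<omega> n * s) / \<omega> n\<close>.\<close>

lemma has_vector_derivative_B_Cs:
  assumes "(\<xi> has_vector_derivative \<xi>') (at t within A)"
  shows "((\<lambda>s. B (Cs s (\<xi> s))) has_vector_derivative (B (Cs t \<xi>') - Sn t (\<xi> t))) (at t within A)"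
proof -
  have eq: "B (Cs s x) = diag (\<lambda>n. cos (\<omega> n * s) / \<omega> n) x" for s x
    unfolding B_def Cs_def by (subst diag_diag) (simp_all add: bounded_multipliers)
  have deriv: "((\<lambda>s. diag (\<lambda>n. cos (\<omega> n * s) / \<omega> n) (\<xi> s)) has_vector_derivative
      diag (\<lambda>n. - sin (\<omega> n * t)) (\<xi> t) + diag (\<lambda>n. cos (\<omega> n * t) / \<omega> n) \<xi>') (at t within A)"
  proof (rule has_vector_derivative_diag[where M = "1 + 1 / \<kappa>", OF _ _ _ assms])
    fix n s
    have "((\<lambda>s. cos (\<omega> n * s) / \<omega> n) has_real_derivative - (sin (\<omega> n * s) * \<omega> n) / \<omega> n) (at s)"
      by (auto intro!: derivative_eq_intros)
    then show "((\<lambda>s. cos (\<omega> n * s) / \<omega> n) has_real_derivative - sin (\<omega> n * s)) (at s)"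
      using \<omega>_pos[of n] by simp
    have "\<bar>cos (\<omega> n * s) * (1 / \<omega> n)\<bar> \<le> 1 * (1 / \<kappa>)"
      unfolding abs_mult by (intro mult_mono inverse_\<omega>_le) auto
    then show "\<bar>cos (\<omega> n * s) / \<omega> n\<bar> \<le> 1 + 1 / \<kappa>" by simp
    have "\<bar>sin (\<omega> n * s)\<bar> \<le> 1" by simp
    then show "\<bar>- sin (\<omega> n * s)\<bar> \<le> 1 + 1 / \<kappa>" using \<kappa>(1) by (simp add: add_increasing2)
  qed
  have bounded_minus: "bounded (range (\<lambda>n. - sin (\<omega> n * t)))"
    by (auto simp: bounded_iff intro!: exI[of _ 1])
  have "diag (\<lambda>n. - sin (\<omega> n * t)) x = - Sn t x" for x
    by (rule eqI_coeff) (simp add: inner_multiplier_simps inner_diag[OF bounded_minus])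
  with deriv show ?thesis by (simp add: eq)
qed

lemma has_vector_derivative_B_Sn:
  assumes "(\<xi> has_vector_derivative \<xi>') (at t within A)"
  shows "((\<lambda>s. B (Sn s (\<xi> s))) has_vector_derivative (B (Sn t \<xi>') + Cs t (\<xi> t))) (at t within A)"
proof -
  have eq: "B (Sn s x) = diag (\<lambda>n. sin (\<omega> n * s) / \<omega> n) x" for s x
    unfolding B_def Sn_def by (subst diag_diag) (simp_all add: bounded_multipliers)
  have "((\<lambda>s. diag (\<lambda>n. sin (\<omega> n * s) / \<omega> n) (\<xi> s)) has_vector_derivative
      diag (\<lambda>n. cos (\<omega> n * t)) (\<xi> t) + diag (\<lambda>n. sin (\<omega> n * t) / \<omega> n) \<xi>') (at t within A)"
  proof (rule has_vector_derivative_diag[where M = "1 + 1 / \<kappa>", OF _ _ _ assms])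
    fix n s
    have "((\<lambda>s. sin (\<omega> n * s) / \<omega> n) has_real_derivative (cos (\<omega> n * s) * \<omega> n) / \<omega> n) (at s)"
      by (auto intro!: derivative_eq_intros)
    then show "((\<lambda>s. sin (\<omega> n * s) / \<omega> n) has_real_derivative cos (\<omega> n * s)) (at s)"
      using \<omega>_pos[of n] by simp
    have "\<bar>sin (\<omega> n * s) * (1 / \<omega> n)\<bar> \<le> 1 * (1 / \<kappa>)"
      unfolding abs_mult by (intro mult_mono inverse_\<omega>_le) auto
    then show "\<bar>sin (\<omega> n * s) / \<omega> n\<bar> \<le> 1 + 1 / \<kappa>" by simp
    have "\<bar>cos (\<omega> n * s)\<bar> \<le> 1" by simp
    then show "\<bar>cos (\<omega> n * s)\<bar> \<le> 1 + 1 / \<kappa>" using \<kappa>(1) by (simp add: add_increasing2)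
  qed
  then show ?thesis by (simp add: eq Cs_def add.commute)
qed

text \<open>The regularity class in Hilbert space form: with \<open>u = B w\<close>, continuity of
  \<open>w\<close> is continuity of \<open>u\<close> in the energy space, \<open>v\<close> is the
  time derivative of \<open>u\<close>, and the last clause is the equation in the dual of the energy
  space after an application of \<open>B\<close>.\<close>

definition wave_sol :: "real set \<Rightarrow> (real \<Rightarrow> 'a) \<Rightarrow> (real \<Rightarrow> 'a) \<Rightarrow> bool" where
  "wave_sol J w v \<longleftrightarrow> continuous_on J w \<and> continuous_on J v \<and>
     (\<forall>t\<in>J. ((\<lambda>s. B (w s)) has_vector_derivative v t) (at t within J)) \<and>
     (\<forall>t\<in>J. ((\<lambda>s. B (v s)) has_vector_derivative (- w t - B (cube (B (w t))))) (at t within J))"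

text \<open>In the application the norms are those of \<open>u\<^sub>t\<close>, of the second space
  derivative of \<open>u\<close>, and of \<open>u\<close> itself, the first and the last being
  weighted.\<close>

definition energy :: "'a \<Rightarrow> 'a \<Rightarrow> real" where
  "energy w v = 1 / 2 * (norm v)\<^sup>2 + 1 / 2 * (norm w)\<^sup>2 + 1 / 4 * norm (B w) ^ 4"

text \<open>In the rotated variables \<open>W\<close>, \<open>V\<close> the unbounded linear part disappears and the wave equation
  becomes an ordinary differential equation with a Lipschitz right-hand side.\<close>

theorem wave_sol_exists:
  obtains w v where "wave_sol {0..} w v" "w 0 = w0" "v 0 = v0"
    "\<And>t. 0 \<le> t \<Longrightarrow> energy (w t) (v t) = energy w0 v0"
proof -
  \<comment> \<open>The bound to be expected for \<open>norm (B (w t))\<close>: energy conservation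
    bounds \<open>norm (w t)\<close> by the square root of twice the initial energy, and
    \<open>B\<close> costs a factor \<open>1 / \<kappa>\<close>.\<close>
  define \<rho> where "\<rho> = sqrt (2 * energy w0 v0) / \<kappa>"
  have energy_nonneg: "0 \<le> energy w0 v0" by (simp add: energy_def)
  have \<rho>: "0 \<le> \<rho>" using \<kappa> energy_nonneg by (simp add: \<rho>_def)
  define N where "N t y = trunc_cube \<rho> (B (Cs t (fst y) + Sn t (snd y)))" for t and y :: "'a \<times> 'a"
  define G where "G t y = (Sn t (N t y), - Cs t (N t y))" for t and y :: "'a \<times> 'a"
  \<comment> \<open>The truncated cube has Lipschitz constant \<open>3 * \<rho>\<^sup>2\<close>,
    \<open>B\<close> contributes \<open>1 / \<kappa>\<close>, and the two components of the pair
    give a factor 2. The added 1 keeps \<open>L\<close> positive when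
    \<open>\<rho> = 0\<close>.\<close>
  define L where "L = 6 * \<rho>\<^sup>2 / \<kappa> + 1"
  have Lpos: "0 < L" using \<kappa> by (simp add: L_def add_nonneg_pos)
  have N0: "N t 0 = 0" for t
    by (simp add: N_def trunc_cube_def B.zero Cs.zero Sn.zero)
  have G0: "G t 0 = 0" for t
    unfolding G_def N0 by (simp add: Sn.zero Cs.zero zero_prod_def)
  have "continuous_on ({0..} \<times> UNIV) (\<lambda>p. G (fst p) (snd p))"
    unfolding G_def N_def by (intro continuous_intros)
  then have cont: "continuous_on ({0..} \<times> UNIV) (\<lambda>(t, y). G t y)" by (simp add: case_prod_beta)
  have lip: "norm (G t x - G t y) \<le> L * norm (x - y)" for t x y
  proof -
    let ?d = "x - y"
    have "G t x - G t y = (Sn t (N t x - N t y), - Cs t (N t x - N t y))"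
      by (simp add: G_def Sn.diff Cs.diff)
    then have "norm (G t x - G t y) = sqrt ((norm (N t x - N t y))\<^sup>2)"
      using Cs_Sn_norm[of t "N t x - N t y"] by (simp add: norm_Pair add.commute del: real_sqrt_abs)
    also have "\<dots> = norm (N t x - N t y)" by simp
    also have "\<dots> \<le> 3 * \<rho>\<^sup>2 * norm (B (Cs t (fst x) + Sn t (snd x)) - B (Cs t (fst y) + Sn t (snd y)))"
      unfolding N_def by (rule trunc_cube_lipschitz[OF \<rho>])
    also have "B (Cs t (fst x) + Sn t (snd x)) - B (Cs t (fst y) + Sn t (snd y))
        = B (Cs t (fst ?d) + Sn t (snd ?d))"
      by (simp add: B.diff[symmetric] Cs.diff Sn.diff algebra_simps)
    also have "norm \<dots> \<le> (norm (fst ?d) + norm (snd ?d)) / \<kappa>"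
      using \<kappa>(1) by (intro order_trans[OF norm_B_le] divide_right_mono norm_triangle_le add_mono
          norm_Cs_le norm_Sn_le) auto
    also have "\<dots> \<le> (norm ?d + norm ?d) / \<kappa>"
      using \<kappa>(1) norm_fst_le[of "fst ?d" "snd ?d"] norm_snd_le[of "snd ?d" "fst ?d"]
      by (intro divide_right_mono add_mono) (simp_all only: prod.collapse less_imp_le)
    finally have "norm (G t x - G t y) \<le> 3 * \<rho>\<^sup>2 * ((norm ?d + norm ?d) / \<kappa>)"
      by (simp add: mult_left_mono)
    also have "\<dots> \<le> L * norm ?d" by (simp add: L_def algebra_simps)
    finally show ?thesis .
  qed
  obtain Y where Y0: "Y 0 = (w0, v0)"
    and Y: "\<And>t. 0 \<le> t \<Longrightarrow> (Y has_vector_derivative G t (Y t)) (at t within {0..})"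
    using lipschitz_ivp_exists[OF cont lip G0 Lpos, of "(w0, v0)"] by blast
  define W where "W t = fst (Y t)" for t
  define V where "V t = snd (Y t)" for t
  define w where "w t = Cs t (W t) + Sn t (V t)" for t
  define v where "v t = Cs t (V t) - Sn t (W t)" for t
  define f where "f t = trunc_cube \<rho> (B (w t))" for t
  have GY: "G t (Y t) = (Sn t (f t), - Cs t (f t))" for t
    by (simp add: G_def N_def f_def w_def W_def V_def)
  have W: "(W has_vector_derivative Sn t (f t)) (at t within {0..})" if "0 \<le> t" for t
    using bounded_linear.has_vector_derivative[OF bounded_linear_fst Y[OF that]]
    by (simp add: W_def[abs_def] GY)
  have V: "(V has_vector_derivative - Cs t (f t)) (at t within {0..})" if "0 \<le> t" for t
    using bounded_linear.has_vector_derivative[OF bounded_linear_snd Y[OF that]]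
    by (simp add: V_def[abs_def] GY)
  have Wc: "continuous_on {0..} W" "continuous_on {0..} V"
    using W V by (auto intro!: continuous_on_vector_derivative)
  have wc: "continuous_on {0..} w" "continuous_on {0..} v"
    unfolding w_def v_def by (intro continuous_intros Wc)+
  have Bw: "((\<lambda>s. B (w s)) has_vector_derivative v t) (at t within {0..})" if t: "0 \<le> t" for t
  proof -
    have "((\<lambda>s. B (Cs s (W s)) + B (Sn s (V s))) has_vector_derivative
        (B (Cs t (Sn t (f t))) - Sn t (W t)) + (B (Sn t (- Cs t (f t))) + Cs t (V t))) (at t within {0..})"
      by (intro has_vector_derivative_add has_vector_derivative_B_Cs has_vector_derivative_B_Sn W V t)
    then show ?thesis by (simp add: w_def v_def B.add B.neg Sn.neg multipliers_commute)
  qed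
  have Bv: "((\<lambda>s. B (v s)) has_vector_derivative (- w t - B (f t))) (at t within {0..})" if t: "0 \<le> t" for t
  proof -
    have "((\<lambda>s. B (Cs s (V s)) - B (Sn s (W s))) has_vector_derivative
        (B (Cs t (- Cs t (f t))) - Sn t (V t)) - (B (Sn t (Sn t (f t))) + Cs t (W t))) (at t within {0..})"
      by (intro has_vector_derivative_diff has_vector_derivative_B_Cs has_vector_derivative_B_Sn W V t)
    moreover have "(B (Cs t (- Cs t (f t))) - Sn t (V t)) - (B (Sn t (Sn t (f t))) + Cs t (W t))
        = - w t - B (Cs t (Cs t (f t)) + Sn t (Sn t (f t)))"
      by (simp add: w_def B.add B.neg Cs.neg)
    ultimately show ?thesis by (simp add: v_def B.diff Cs_Sn_sum)
  qed
  \<comment> \<open>A primitive of \<open>min r (\<rho>\<^sup>2) / 2\<close>, so that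
    \<open>\<psi>\<close> of the squared norm has the truncated cube as its gradient. Up to
    \<open>\<rho>\<^sup>2\<close> it is \<open>r\<^sup>2 / 4\<close>, the quartic term of the true
    energy.\<close>
  define \<psi> where "\<psi> r = r\<^sup>2 / 4 - (max 0 (r - \<rho>\<^sup>2))\<^sup>2 / 4" for r :: real
  have d\<psi>: "(\<psi> has_real_derivative min r (\<rho>\<^sup>2) / 2) (at r)" for r
  proof -
    have "((\<lambda>r. (max 0 (r - \<rho>\<^sup>2))\<^sup>2) has_real_derivative 2 * max 0 (r - \<rho>\<^sup>2) * 1) (at r)"
      by (rule DERIV_chain2[OF has_real_derivative_max0_power2]) (auto intro!: derivative_eq_intros)
    then have "(\<psi> has_real_derivative 2 * r / 4 - 2 * max 0 (r - \<rho>\<^sup>2) * 1 / 4) (at r)"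
      unfolding \<psi>_def by (intro DERIV_diff DERIV_cdivide) (auto intro!: derivative_eq_intros)
    then show ?thesis by (rule DERIV_cong) (auto simp: max_def min_def field_simps)
  qed
  \<comment> \<open>The energy of the truncated equation, with its quadratic part in the rotated
    variables, which are differentiable while \<open>w\<close> and \<open>v\<close> need not
    be.\<close>
  define E where "E t = (W t \<bullet> W t + V t \<bullet> V t) / 2 + \<psi> (B (w t) \<bullet> B (w t))" for t
  have dE: "(E has_real_derivative 0) (at t within {0..})" if t: "0 \<le> t" for t
  proof -
    have ip: "((\<lambda>s. \<xi> s \<bullet> \<xi> s) has_real_derivative 2 * (\<xi> t \<bullet> \<xi>')) (at t within {0..})"
      if "(\<xi> has_vector_derivative \<xi>') (at t within {0..})" for \<xi> :: "real \<Rightarrow> 'a" and \<xi>'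
      using bounded_bilinear.has_vector_derivative[OF bounded_bilinear_inner that that]
      by (simp add: has_real_derivative_iff_has_vector_derivative inner_commute)
    have E': "(E has_real_derivative (2 * (W t \<bullet> Sn t (f t)) + 2 * (V t \<bullet> - Cs t (f t))) / 2
        + min (B (w t) \<bullet> B (w t)) (\<rho>\<^sup>2) / 2 * (2 * (B (w t) \<bullet> v t))) (at t within {0..})"
      unfolding E_def
      by (intro DERIV_add DERIV_cdivide ip W V t DERIV_chain2[OF d\<psi>] Bw)
    have "min (B (w t) \<bullet> B (w t)) (\<rho>\<^sup>2) = (min (norm (B (w t))) \<rho>)\<^sup>2"
      using \<rho> by (auto simp: min_def power2_norm_eq_inner[symmetric] power_mono not_le
          dest: power2_le_imp_le power_strict_mono intro: antisym)
    then have "min (B (w t) \<bullet> B (w t)) (\<rho>\<^sup>2) * (B (w t) \<bullet> v t) = f t \<bullet> v t"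
      by (simp add: f_def trunc_cube_def)
    moreover have "f t \<bullet> v t = V t \<bullet> Cs t (f t) - W t \<bullet> Sn t (f t)"
      using self_adjoint(2)[of t "V t" "f t"] self_adjoint(3)[of t "W t" "f t"]
      by (simp add: v_def inner_diff_right inner_commute)
    ultimately have "(2 * (W t \<bullet> Sn t (f t)) + 2 * (V t \<bullet> - Cs t (f t))) / 2
        + min (B (w t) \<bullet> B (w t)) (\<rho>\<^sup>2) / 2 * (2 * (B (w t) \<bullet> v t)) = 0"
      by (simp add: diff_divide_distrib)
    then show ?thesis by (rule DERIV_cong[OF E'])
  qed
  then obtain c where c: "\<And>t. 0 \<le> t \<Longrightarrow> E t = c"
    using has_field_derivative_zero_constant[of "{0..}" E] by auto
  have sum_eq: "W t \<bullet> W t + V t \<bullet> V t = (norm (w t))\<^sup>2 + (norm (v t))\<^sup>2" for t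
    by (simp add: w_def v_def rotation_norm power2_norm_eq_inner[symmetric])
  have \<psi>_nonneg: "0 \<le> \<psi> r" if "0 \<le> r" for r
  proof -
    have "(max 0 (r - \<rho>\<^sup>2))\<^sup>2 \<le> r\<^sup>2" using that by (intro power_mono) auto
    then show ?thesis by (simp add: \<psi>_def)
  qed
  have w0: "w 0 = w0" "v 0 = v0" by (simp_all add: w_def v_def W_def V_def Y0)
  have E_le: "E t \<le> energy w0 v0" if "0 \<le> t" for t
  proof -
    have "E t = E 0" using c[OF that] c[of 0] by simp
    also have "\<dots> \<le> energy w0 v0"
      unfolding E_def sum_eq w0 energy_def \<psi>_def
      by (simp add: power2_norm_eq_inner[symmetric] add_divide_distrib)
    finally show ?thesis .
  qed
  \<comment> \<open>As \<open>\<psi>\<close> is nonnegative, the truncated energy controls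
    \<open>w\<close>, and it never exceeds the true initial energy. The solution therefore stays
    where the truncation is inactive, and the truncated equation is the original one along
    it.\<close>
  have small: "norm (B (w t)) \<le> \<rho>" if "0 \<le> t" for t
  proof -
    have "((norm (w t))\<^sup>2 + (norm (v t))\<^sup>2) / 2 \<le> E t"
      unfolding E_def sum_eq by (simp add: \<psi>_nonneg)
    also note E_le[OF that]
    finally have "(norm (w t))\<^sup>2 + (norm (v t))\<^sup>2 \<le> 2 * energy w0 v0" by simp
    then have "(norm (w t))\<^sup>2 \<le> 2 * energy w0 v0" by (rule order_trans[rotated]) simp
    then have "norm (w t) \<le> sqrt (2 * energy w0 v0)" by (rule real_le_rsqrt)
    then show ?thesis
      using \<kappa>(1) by (intro order_trans[OF norm_B_le]) (simp add: \<rho>_def divide_right_mono)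
  qed
  have E_eq: "E t = energy (w t) (v t)" if "0 \<le> t" for t
  proof -
    have "(norm (B (w t)))\<^sup>2 \<le> \<rho>\<^sup>2" by (intro power_mono small that) auto
    then show ?thesis
      unfolding E_def sum_eq energy_def \<psi>_def
      by (simp add: power2_norm_eq_inner[symmetric] add_divide_distrib)
  qed
  show ?thesis
  proof
    show "wave_sol {0..} w v"
      unfolding wave_sol_def using wc Bw Bv by (auto simp: f_def trunc_cube_eq_cube small)
    show "w 0 = w0" "v 0 = v0" by (fact w0)+
    show "energy (w t) (v t) = energy w0 v0" if "0 \<le> t" for t
      using E_eq[OF that] E_eq[of 0] c[OF that] c[of 0] w0 by simp
  qed
qed

text \<open>The rotated variables of a solution satisfy an integral equation. As \<open>Cs\<close> and \<open>Sn\<close> are only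
  differentiable on the range of \<open>B\<close>, it is derived after applying \<open>B\<close> twice.\<close>

lemma wave_sol_integral_eq:
  assumes sol: "wave_sol {0..T} w v" and t: "t \<in> {0..T}"
  defines "f \<equiv> \<lambda>s. cube (B (w s))"
  shows "Cs t (w t) - Sn t (v t) = w 0 + integral {0..t} (\<lambda>s. Sn s (f s))"
    and "Cs t (v t) + Sn t (w t) = v 0 - integral {0..t} (\<lambda>s. Cs s (f s))"
proof -
  have sub: "{0..t} \<subseteq> {0..T}" using t by auto
  have wc: "continuous_on {0..t} w" "continuous_on {0..t} v"
    using sol sub by (auto simp: wave_sol_def intro: continuous_on_subset)
  have dw: "((\<lambda>s. B (w s)) has_vector_derivative v s) (at s within {0..t})" if "s \<in> {0..t}" for s
    using sol sub that unfolding wave_sol_def by (blast intro: has_vector_derivative_within_subset)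
  have dv: "((\<lambda>s. B (v s)) has_vector_derivative (- w s - B (f s))) (at s within {0..t})" if "s \<in> {0..t}" for s
    using sol sub that unfolding wave_sol_def f_def by (blast intro: has_vector_derivative_within_subset)
  have BB: "x = y" if "B (B x) = B (B y)" for x y using that by (blast dest: B_inj)
  have fc: "continuous_on {0..t} f" unfolding f_def by (intro continuous_intros wc)
  have int: "(\<lambda>s. Sn s (f s)) integrable_on {0..t}" "(\<lambda>s. Cs s (f s)) integrable_on {0..t}"
    by (intro integrable_continuous_real continuous_intros fc)+
  have BBint: "integral {0..t} (\<lambda>s. B (B (g s))) = B (B (integral {0..t} g))"
    if "g integrable_on {0..t}" for g
    using integral_linear[OF that bounded_linear_compose[OF bounded_linear_multipliers(1) bounded_linear_multipliers(1)]]
    by (simp add: o_def)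
  show "Cs t (w t) - Sn t (v t) = w 0 + integral {0..t} (\<lambda>s. Sn s (f s))"
  proof (rule BB)
    \<comment> \<open>One factor \<open>B\<close> makes the rotation differentiable, the other makes
      \<open>w\<close> and \<open>v\<close> differentiable. The linear terms cancel and only the
      nonlinearity is left.\<close>
    have "((\<lambda>s. B (B (Sn s (f s)))) has_integral
        (B (Cs t (B (w t))) - B (Sn t (B (v t)))) - (B (Cs 0 (B (w 0))) - B (Sn 0 (B (v 0))))) {0..t}"
    proof (rule fundamental_theorem_of_calculus)
      fix s assume s: "s \<in> {0..t}"
      have "((\<lambda>s. B (Cs s (B (w s))) - B (Sn s (B (v s)))) has_vector_derivative
          (B (Cs s (v s)) - Sn s (B (w s))) - (B (Sn s (- w s - B (f s))) + Cs s (B (v s)))) (at s within {0..t})"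
        by (intro has_vector_derivative_diff has_vector_derivative_B_Cs has_vector_derivative_B_Sn dw dv s)
      then show "((\<lambda>s. B (Cs s (B (w s))) - B (Sn s (B (v s)))) has_vector_derivative B (B (Sn s (f s)))) (at s within {0..t})"
        by (simp add: Sn.diff Sn.neg B.diff B.neg multipliers_commute)
    qed (use t in simp)
    then have "B (B (Cs t (w t) - Sn t (v t))) - B (B (w 0)) = B (B (integral {0..t} (\<lambda>s. Sn s (f s))))"
      by (simp add: integral_unique BBint[OF int(1), symmetric] B.diff multipliers_commute B.zero)
    then show "B (B (Cs t (w t) - Sn t (v t))) = B (B (w 0 + integral {0..t} (\<lambda>s. Sn s (f s))))"
      by (simp add: B.add algebra_simps)
  qed
  show "Cs t (v t) + Sn t (w t) = v 0 - integral {0..t} (\<lambda>s. Cs s (f s))"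
  proof (rule BB)
    have hi: "((\<lambda>s. - B (B (Cs s (f s)))) has_integral
        (B (Cs t (B (v t))) + B (Sn t (B (w t)))) - (B (Cs 0 (B (v 0))) + B (Sn 0 (B (w 0))))) {0..t}"
    proof (rule fundamental_theorem_of_calculus)
      fix s assume s: "s \<in> {0..t}"
      have "((\<lambda>s. B (Cs s (B (v s))) + B (Sn s (B (w s)))) has_vector_derivative
          (B (Cs s (- w s - B (f s))) - Sn s (B (v s))) + (B (Sn s (v s)) + Cs s (B (w s)))) (at s within {0..t})"
        by (intro has_vector_derivative_add has_vector_derivative_B_Cs has_vector_derivative_B_Sn dw dv s)
      then show "((\<lambda>s. B (Cs s (B (v s))) + B (Sn s (B (w s)))) has_vector_derivative - B (B (Cs s (f s)))) (at s within {0..t})"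
        by (simp add: Cs.diff Cs.neg B.diff B.neg multipliers_commute)
    qed (use t in simp)
    have "B (B (Cs t (v t) + Sn t (w t))) - B (B (v 0)) = - B (B (integral {0..t} (\<lambda>s. Cs s (f s))))"
      using integral_unique[OF hi]
      by (simp add: BBint[OF int(2), symmetric] B.add multipliers_commute B.zero)
    then show "B (B (Cs t (v t) + Sn t (w t))) = B (B (v 0 - integral {0..t} (\<lambda>s. Cs s (f s))))"
      by (simp add: B.diff algebra_simps)
  qed
qed

text \<open>The rotated differences satisfy integral equations free of unbounded operators, so a
  Gronwall argument works at the regularity of the energy space. On the compact interval
  \<open>B\<close> of both solutions is bounded by some \<open>r\<close>, and there the cube has the
  Lipschitz constant of its truncation at \<open>r\<close>.\<close>

theorem wave_sol_unique:
  assumes sol1: "wave_sol {0..T} w1 v1" and sol2: "wave_sol {0..T} w2 v2"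
    and init: "w1 0 = w2 0" "v1 0 = v2 0" and t: "t \<in> {0..T}"
  shows "w1 t = w2 t"
proof -
  have wc: "continuous_on {0..T} w1" "continuous_on {0..T} v1" "continuous_on {0..T} w2" "continuous_on {0..T} v2"
    using sol1 sol2 by (auto simp: wave_sol_def)
  have "compact ((\<lambda>s. B (w1 s)) ` {0..T} \<union> (\<lambda>s. B (w2 s)) ` {0..T})"
    by (intro compact_Un compact_continuous_image continuous_intros wc) auto
  then have "bounded ((\<lambda>s. B (w1 s)) ` {0..T} \<union> (\<lambda>s. B (w2 s)) ` {0..T})"
    by (rule compact_imp_bounded)
  then obtain r where "\<forall>x\<in>(\<lambda>s. B (w1 s)) ` {0..T} \<union> (\<lambda>s. B (w2 s)) ` {0..T}. norm x \<le> r"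
    unfolding bounded_iff by blast
  then have r: "\<And>s. s \<in> {0..T} \<Longrightarrow> norm (B (w1 s)) \<le> r" "\<And>s. s \<in> {0..T} \<Longrightarrow> norm (B (w2 s)) \<le> r"
    by auto
  have r0: "0 \<le> r" using order_trans[OF norm_ge_zero r(1)[OF t]] .
  define f1 where "f1 s = cube (B (w1 s))" for s
  define f2 where "f2 s = cube (B (w2 s))" for s
  define W where "W s = Cs s (w1 s - w2 s) - Sn s (v1 s - v2 s)" for s
  define V where "V s = Cs s (v1 s - v2 s) + Sn s (w1 s - w2 s)" for s
  define D where "D s = norm (W s) + norm (V s)" for s
  have fc: "continuous_on {0..T} f1" "continuous_on {0..T} f2"
    unfolding f1_def f2_def by (intro continuous_intros wc)+
  have Dc: "continuous_on {0..T} D"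
    unfolding D_def W_def V_def by (intro continuous_intros wc)
  have unrotate: "w1 s - w2 s = Cs s (W s) + Sn s (V s)" for s
  proof -
    have "Cs s (W s) + Sn s (V s) = Cs s (Cs s (w1 s - w2 s)) + Sn s (Sn s (w1 s - w2 s))"
      by (simp add: W_def V_def Cs.diff Sn.diff Sn.add Cs.add multipliers_commute)
    then show ?thesis by (simp only: Cs_Sn_sum)
  qed
  have f_le: "norm (f1 s - f2 s) \<le> 3 * r\<^sup>2 / \<kappa> * D s" if "s \<in> {0..T}" for s
  proof -
    have "norm (f1 s - f2 s) \<le> 3 * r\<^sup>2 * norm (B (w1 s) - B (w2 s))"
      using trunc_cube_lipschitz[OF r0, of "B (w1 s)" "B (w2 s)"]
      by (simp add: f1_def f2_def trunc_cube_eq_cube[OF r(1)[OF that]] trunc_cube_eq_cube[OF r(2)[OF that]])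
    also have "norm (B (w1 s) - B (w2 s)) \<le> D s / \<kappa>"
    proof -
      have "norm (w1 s - w2 s) \<le> D s"
        unfolding unrotate D_def by (intro norm_triangle_le add_mono norm_Cs_le norm_Sn_le)
      then show ?thesis
        using \<kappa>(1) unfolding B.diff[symmetric]
        by (intro order_trans[OF norm_B_le]) (simp add: divide_right_mono)
    qed
    finally show ?thesis by (simp add: mult_left_mono)
  qed
  \<comment> \<open>The Lipschitz bound \<open>3 * r\<^sup>2 / \<kappa>\<close> enters once for each
    of the two rotated components.\<close>
  define L where "L = 6 * r\<^sup>2 / \<kappa>"
  have "D t = 0"
  proof (rule gronwall_zero[OF Dc _ _ _ t])
    show "0 \<le> L" using \<kappa>(1) by (simp add: L_def)
    show "0 \<le> D s" for s by (simp add: D_def)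
    fix s assume s: "s \<in> {0..T}"
    have sub: "{0..s} \<subseteq> {0..T}" using s by auto
    have fs: "continuous_on {0..s} f1" "continuous_on {0..s} f2" "continuous_on {0..s} D"
      by (rule continuous_on_subset[OF _ sub], fact fc Dc)+
    have int: "(\<lambda>s. Sn s (f1 s)) integrable_on {0..s}" "(\<lambda>s. Cs s (f1 s)) integrable_on {0..s}"
        "(\<lambda>s. Sn s (f2 s)) integrable_on {0..s}" "(\<lambda>s. Cs s (f2 s)) integrable_on {0..s}"
        "D integrable_on {0..s}"
      by (intro integrable_continuous_real continuous_intros fs)+
    have *: "norm (integral {0..s} g) \<le> 3 * r\<^sup>2 / \<kappa> * integral {0..s} D"
      if "g integrable_on {0..s}" "\<And>x. x \<in> {0..s} \<Longrightarrow> norm (g x) \<le> norm (f1 x - f2 x)" for g :: "real \<Rightarrow> 'a"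
    proof -
      have "norm (integral {0..s} g) \<le> integral {0..s} (\<lambda>x. 3 * r\<^sup>2 / \<kappa> * D x)"
        using that f_le sub
        by (intro integral_norm_bound_integral integrable_on_mult_right int) (auto intro: order_trans)
      then show ?thesis by simp
    qed
    have "W s = integral {0..s} (\<lambda>x. Sn x (f1 x) - Sn x (f2 x))"
      using wave_sol_integral_eq(1)[OF sol1 s] wave_sol_integral_eq(1)[OF sol2 s] init
      by (simp add: W_def f1_def[symmetric] f2_def[symmetric] Cs.diff Sn.diff integral_diff int algebra_simps)
    then have "norm (W s) \<le> 3 * r\<^sup>2 / \<kappa> * integral {0..s} D"
      by (simp only:) (intro * integrable_diff int, simp only: Sn.diff[symmetric] norm_Sn_le)
    moreover have "V s = integral {0..s} (\<lambda>x. Cs x (f2 x) - Cs x (f1 x))"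
      using wave_sol_integral_eq(2)[OF sol1 s] wave_sol_integral_eq(2)[OF sol2 s] init
      by (simp add: V_def f1_def[symmetric] f2_def[symmetric] Cs.diff Sn.diff integral_diff int algebra_simps)
    then have "norm (V s) \<le> 3 * r\<^sup>2 / \<kappa> * integral {0..s} D"
      by (simp only:) (intro * integrable_diff int,
        simp only: Cs.diff[symmetric] norm_minus_commute[of "f1 _"] norm_Cs_le)
    ultimately have "D s \<le> 3 * r\<^sup>2 / \<kappa> * integral {0..s} D + 3 * r\<^sup>2 / \<kappa> * integral {0..s} D"
      unfolding D_def[of s] by (rule add_mono)
    then show "D s \<le> L * integral {0..s} D" by (simp add: L_def field_simps)
  qed
  then have "W t = 0" "V t = 0" by (simp_all add: D_def add_nonneg_eq_0_iff)
  then show ?thesis using unrotate[of t] by (simp add: Cs.zero Sn.zero)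
qed

end

section \<open>A spectral theorem\<close>

text \<open>The first-variation argument: for small \<open>t\<close> of sign opposite to
  \<open>a\<close> the linear term wins. The chosen \<open>t\<close> makes the quadratic term at
  most half as large as the linear one.\<close>

lemma quadratic_nonneg_imp_zero:
  fixes a b :: real
  assumes "\<And>t. 0 \<le> 2 * t * a + t\<^sup>2 * b"
  shows "a = 0"
proof (rule ccontr)
  assume a: "a \<noteq> 0"
  define t where "t = - a / (\<bar>b\<bar> + 1)"
  have "t\<^sup>2 * b \<le> t\<^sup>2 * (\<bar>b\<bar> + 1)" by (intro mult_left_mono) auto
  also have "\<dots> = - t * a" by (simp add: t_def power2_eq_square)
  finally have "2 * t * a + t\<^sup>2 * b \<le> t * a" by linarith
  moreover have "0 < a\<^sup>2 / (\<bar>b\<bar> + 1)" using a by (intro divide_pos_pos) auto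
  then have "t * a < 0" by (simp add: t_def power2_eq_square)
  ultimately show False using assms[of t] by linarith
qed

lemma norm_add_scaleR_power2:
  fixes x z :: "'a::real_inner"
  shows "(norm (x + t *\<^sub>R z))\<^sup>2 = (norm x)\<^sup>2 + 2 * t * (x \<bullet> z) + t\<^sup>2 * (norm z)\<^sup>2"
  unfolding power2_norm_eq_inner
  by (simp add: inner_add_left inner_add_right inner_commute power2_eq_square[of t] del: dot_square_norm)

text \<open>\<open>\<Gamma>\<close> is the graph of an unbounded operator with domain \<open>fst ` \<Gamma>\<close>; the Rayleigh quotient is
  \<open>(norm y / norm x)\<^sup>2\<close>.\<close>

lemma rayleigh_minimizer:
  fixes \<Gamma> :: "('h::{real_inner, banach} \<times> 'h) set"
  assumes sub: "subspace \<Gamma>" and cl: "closed \<Gamma>"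
    and compact: "\<And>X M. (\<And>n. X n \<in> \<Gamma>) \<Longrightarrow> (\<And>n. norm (snd (X n)) \<le> M) \<Longrightarrow>
        \<exists>r. strict_mono (r :: nat \<Rightarrow> nat) \<and> convergent (\<lambda>n. fst (X (r n)))"
    and nontriv: "\<exists>(x, y)\<in>\<Gamma>. x \<noteq> 0"
  obtains x y where "(x, y) \<in> \<Gamma>" "norm x = 1"
    "\<And>x' y'. (x', y') \<in> \<Gamma> \<Longrightarrow> norm y * norm x' \<le> norm y'"
    "\<And>x' y'. (x', y') \<in> \<Gamma> \<Longrightarrow> y \<bullet> y' = (norm y)\<^sup>2 * (x \<bullet> x')"
proof -
  define S where "S = {norm y |x y. (x, y) \<in> \<Gamma> \<and> norm x = 1}"
  define m where "m = Inf S"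
  have scale: "(c *\<^sub>R x, c *\<^sub>R y) \<in> \<Gamma>" if "(x, y) \<in> \<Gamma>" for x y c
    using subspace_scale[OF sub that, of c] by simp
  obtain x0 y0 where "(x0, y0) \<in> \<Gamma>" "x0 \<noteq> 0" using nontriv by auto
  then have "(x0 /\<^sub>R norm x0, y0 /\<^sub>R norm x0) \<in> \<Gamma>" "norm (x0 /\<^sub>R norm x0) = 1"
    using scale[of x0 y0 "inverse (norm x0)"] by simp_all
  then have "norm (y0 /\<^sub>R norm x0) \<in> S" unfolding S_def by blast
  then have ne: "S \<noteq> {}" by auto
  have bdd: "bdd_below S" by (rule bdd_belowI[of _ 0]) (auto simp: S_def)
  have m0: "0 \<le> m" unfolding m_def by (rule cInf_greatest[OF ne]) (auto simp: S_def)
  have m_le: "m * norm x \<le> norm y" if "(x, y) \<in> \<Gamma>" for x y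
  proof (cases "x = 0")
    case False
    then have "(x /\<^sub>R norm x, y /\<^sub>R norm x) \<in> \<Gamma>" "norm (x /\<^sub>R norm x) = 1"
      using scale[OF that, of "inverse (norm x)"] by simp_all
    then have "norm (y /\<^sub>R norm x) \<in> S" unfolding S_def by blast
    then have "m \<le> norm (y /\<^sub>R norm x)" unfolding m_def by (rule cInf_lower[OF _ bdd])
    then show ?thesis using False by (simp add: field_simps)
  qed simp
  have "\<exists>X\<in>\<Gamma>. norm (fst X) = 1 \<and> norm (snd X) < m + inverse (real (Suc n))" for n
  proof -
    have "\<exists>s\<in>S. s < m + inverse (real (Suc n))"
      unfolding m_def by (rule cInf_lessD[OF ne]) simp
    then show ?thesis by (force simp: S_def)
  qed
  then obtain X where X: "\<And>n. X n \<in> \<Gamma>" "\<And>n. norm (fst (X n)) = 1"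
    "\<And>n. norm (snd (X n)) < m + inverse (real (Suc n))" by metis
  have X_le: "norm (snd (X n)) \<le> m + 1" for n
    using X(3)[of n] by (rule less_imp_le[OF less_le_trans]) (simp add: inverse_le_1_iff)
  then obtain r x where r: "strict_mono (r :: nat \<Rightarrow> nat)" and x: "(\<lambda>n. fst (X (r n))) \<longlonglongrightarrow> x"
    using compact[of X "m + 1"] X(1) X_le by (auto simp: convergent_def)
  define a where "a n = fst (X (r n))" for n
  define b where "b n = snd (X (r n))" for n
  have ab: "(a n, b n) \<in> \<Gamma>" "norm (a n) = 1" for n using X by (simp_all add: a_def b_def)
  have a: "a \<longlonglongrightarrow> x" using x by (simp add: a_def[abs_def])
  have blim: "(\<lambda>n. norm (b n)) \<longlonglongrightarrow> m"
  proof (rule tendsto_sandwich)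
    show "eventually (\<lambda>n. m \<le> norm (b n)) sequentially"
      using m_le[OF ab(1)] ab(2) by (simp add: always_eventually)
    show "eventually (\<lambda>n. norm (b n) \<le> m + inverse (real (Suc n))) sequentially"
    proof (intro always_eventually allI)
      fix n
      have "norm (b n) \<le> m + inverse (real (Suc (r n)))" using X(3)[of "r n"] by (simp add: b_def)
      also have "inverse (real (Suc (r n))) \<le> inverse (real (Suc n))"
        using seq_suble[OF r, of n] by (intro le_imp_inverse_le) auto
      finally show "norm (b n) \<le> m + inverse (real (Suc n))" by simp
    qed
    show "(\<lambda>n. m + inverse (real (Suc n))) \<longlonglongrightarrow> m"
      using tendsto_add[OF tendsto_const LIMSEQ_inverse_real_of_nat, of m] by simp
  qed simp
  \<comment> \<open>Compactness yields convergence of the first components only; the parallelogram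
    law supplies it for the second ones. As \<open>norm (a i + a j)\<close> tends to 2 and
    \<open>m\<close> times it bounds \<open>norm (b i + b j)\<close> from below, nothing is left in
    the limit for the difference.\<close>
  have par: "(norm (b i - b j))\<^sup>2 \<le> 2 * (norm (b i))\<^sup>2 + 2 * (norm (b j))\<^sup>2 - m\<^sup>2 * (norm (a i + a j))\<^sup>2" for i j
  proof -
    have "m * norm (a i + a j) \<le> norm (b i + b j)"
      using m_le subspace_add[OF sub ab(1) ab(1)] by simp
    then have "(m * norm (a i + a j))\<^sup>2 \<le> (norm (b i + b j))\<^sup>2"
      by (rule power_mono) (use m0 in simp)
    moreover have "(norm (b i + b j))\<^sup>2 + (norm (b i - b j))\<^sup>2 = 2 * (norm (b i))\<^sup>2 + 2 * (norm (b j))\<^sup>2"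
      by (simp add: power2_norm_eq_inner inner_add_left inner_add_right inner_diff_left inner_diff_right
          inner_commute del: dot_square_norm)
    ultimately show ?thesis by (simp add: power_mult_distrib)
  qed
  have "Cauchy b"
  proof (rule metric_CauchyI)
    fix \<epsilon> :: real assume \<epsilon>: "0 < \<epsilon>"
    have lim: "((\<lambda>(i, j). 2 * (norm (b i))\<^sup>2 + 2 * (norm (b j))\<^sup>2 - m\<^sup>2 * (norm (a i + a j))\<^sup>2) \<longlongrightarrow>
        2 * m\<^sup>2 + 2 * m\<^sup>2 - m\<^sup>2 * (norm (x + x))\<^sup>2) (sequentially \<times>\<^sub>F sequentially)"
      unfolding case_prod_beta
      by (intro tendsto_intros filterlim_compose[OF blim] filterlim_compose[OF a] filterlim_fst filterlim_snd)
    have "norm x = 1" using LIMSEQ_unique[OF tendsto_norm[OF a]] by (simp add: ab)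
    then have z: "2 * m\<^sup>2 + 2 * m\<^sup>2 - m\<^sup>2 * (norm (x + x))\<^sup>2 = 0"
      by (simp add: scaleR_2[symmetric] power_mult_distrib del: scaleR_2)
    have "eventually (\<lambda>p. (case p of (i, j) \<Rightarrow> 2 * (norm (b i))\<^sup>2 + 2 * (norm (b j))\<^sup>2 - m\<^sup>2 * (norm (a i + a j))\<^sup>2) < \<epsilon>\<^sup>2)
        (sequentially \<times>\<^sub>F sequentially)"
      by (rule order_tendstoD(2)[OF lim[unfolded z]]) (use \<epsilon> in simp)
    then have "eventually (\<lambda>(i, j). dist (b i) (b j) < \<epsilon>) (sequentially \<times>\<^sub>F sequentially)"
    proof (rule eventually_mono, clarify)
      fix i j assume "2 * (norm (b i))\<^sup>2 + 2 * (norm (b j))\<^sup>2 - m\<^sup>2 * (norm (a i + a j))\<^sup>2 < \<epsilon>\<^sup>2"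
      then have "(norm (b i - b j))\<^sup>2 < \<epsilon>\<^sup>2" using par[of i j] by linarith
      then show "dist (b i) (b j) < \<epsilon>" using \<epsilon> by (simp add: dist_norm power_less_imp_less_base)
    qed
    then show "\<exists>M. \<forall>i\<ge>M. \<forall>j\<ge>M. dist (b i) (b j) < \<epsilon>"
      by (auto simp: eventually_prod_sequentially)
  qed
  then obtain y where b: "b \<longlonglongrightarrow> y" using Cauchy_convergent_iff convergent_def by blast
  have xy: "(x, y) \<in> \<Gamma>"
    by (rule closed_sequentially[OF cl ab(1) tendsto_Pair[OF a b]])
  have x1: "norm x = 1" using LIMSEQ_unique[OF tendsto_norm[OF a]] by (simp add: ab)
  have ym: "norm y = m" using LIMSEQ_unique[OF tendsto_norm[OF b] blim] .
  have "y \<bullet> y' = (norm y)\<^sup>2 * (x \<bullet> x')" if "(x', y') \<in> \<Gamma>" for x' y'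
  proof -
    \<comment> \<open>The squared norm of the second component minus \<open>m\<^sup>2\<close> times
      that of the first is nonnegative on \<open>\<Gamma>\<close> and vanishes at the minimiser, so
      its first variation vanishes in every direction.\<close>
    have "0 \<le> 2 * t * (y \<bullet> y' - m\<^sup>2 * (x \<bullet> x')) + t\<^sup>2 * ((norm y')\<^sup>2 - m\<^sup>2 * (norm x')\<^sup>2)" for t
    proof -
      have "(x + t *\<^sub>R x', y + t *\<^sub>R y') \<in> \<Gamma>"
        using subspace_add[OF sub xy scale[OF that]] by simp
      then have "(m * norm (x + t *\<^sub>R x'))\<^sup>2 \<le> (norm (y + t *\<^sub>R y'))\<^sup>2"
        by (intro power_mono m_le) (use m0 in auto)
      moreover have "(norm (x + t *\<^sub>R x'))\<^sup>2 = 1 + 2 * t * (x \<bullet> x') + t\<^sup>2 * (norm x')\<^sup>2"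
        by (simp add: norm_add_scaleR_power2 x1)
      moreover have "(norm (y + t *\<^sub>R y'))\<^sup>2 = m\<^sup>2 + 2 * t * (y \<bullet> y') + t\<^sup>2 * (norm y')\<^sup>2"
        by (simp add: norm_add_scaleR_power2 ym)
      ultimately show ?thesis by (simp add: power_mult_distrib algebra_simps)
    qed
    then have "y \<bullet> y' - m\<^sup>2 * (x \<bullet> x') = 0" by (rule quadratic_nonneg_imp_zero)
    then show ?thesis by (simp add: ym)
  qed
  with that[OF xy x1] m_le ym show ?thesis by blast
qed

text \<open>Let \<open>T\<close> be the operator with graph \<open>\<Gamma>\<close>. Successive
  minimisers of the Rayleigh quotient, each orthogonal to the previous ones, are eigenvectors of the
  adjoint of \<open>T\<close> composed with \<open>T\<close>, with eigenvalues
  \<open>(\<omega> n)\<^sup>2\<close>. Their normalised images under \<open>T\<close> are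
  orthonormal as well, and comparing the expansions of both components of a pair shows that
  \<open>B\<close> maps onto the domain with the stated norms.\<close>

theorem spectral_basis:
  fixes \<Gamma> :: "('h::{real_inner, banach} \<times> 'h) set"
  assumes sub: "subspace \<Gamma>" and cl: "closed \<Gamma>"
    and compact: "\<And>X M. (\<And>n. X n \<in> \<Gamma>) \<Longrightarrow> (\<And>n. norm (snd (X n)) \<le> M) \<Longrightarrow>
        \<exists>r. strict_mono (r :: nat \<Rightarrow> nat) \<and> convergent (\<lambda>n. fst (X (r n)))"
    and poincare: "\<And>x y. (x, y) \<in> \<Gamma> \<Longrightarrow> norm x \<le> K * norm y" and K: "0 < K"
    and inj: "\<And>y. (0, y) \<in> \<Gamma> \<Longrightarrow> y = 0"
    and dense: "\<And>x. (\<And>q. q \<in> \<Gamma> \<Longrightarrow> x \<bullet> fst q = 0) \<Longrightarrow> x = 0"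
  obtains e \<omega> \<kappa> where "wave e \<omega> \<kappa>"
    "\<And>x y. (x, y) \<in> \<Gamma> \<Longrightarrow> \<exists>w. x = wave.B e \<omega> w \<and> norm w = norm y"
    "\<And>w. \<exists>y. (wave.B e \<omega> w, y) \<in> \<Gamma>"
proof -
  define U where "U D = {p\<in>\<Gamma>. \<forall>d\<in>D. fst p \<bullet> d = 0}" for D
  \<comment> \<open>The first alternative is the default: when the orthogonal complement contains no
    pair with nonzero first component, the pair 0 is taken.\<close>
  define good where "good D p \<longleftrightarrow> p \<in> U D \<and> ((\<forall>q\<in>U D. fst q = 0) \<and> p = 0 \<or>
      norm (fst p) = 1 \<and> (\<forall>q\<in>U D. norm (snd p) * norm (fst q) \<le> norm (snd q)) \<and>
      (\<forall>q\<in>U D. snd p \<bullet> snd q = (norm (snd p))\<^sup>2 * (fst p \<bullet> fst q)))" for D p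
  have "\<exists>p. good D p" for D
  proof (cases "\<forall>q\<in>U D. fst q = 0")
    case True
    then have "good D 0" using subspace_0[OF sub] by (simp add: good_def U_def)
    then show ?thesis ..
  next
    case False
    have UD: "U D = \<Gamma> \<inter> (\<Inter>d\<in>D. {p. fst p \<bullet> d = 0})" by (auto simp: U_def)
    have subU: "subspace (U D)"
      unfolding subspace_def U_def using sub
      by (auto simp: subspace_0 subspace_add subspace_scale inner_add_left)
    have clU: "closed (U D)"
      unfolding UD by (intro closed_Int cl closed_INT ballI closed_Collect_eq continuous_intros)
    have compactU: "\<exists>r. strict_mono (r :: nat \<Rightarrow> nat) \<and> convergent (\<lambda>n. fst (X (r n)))"
      if "\<And>n. X n \<in> U D" "\<And>n. norm (snd (X n)) \<le> M" for X M
      using compact[of X M] that by (simp add: U_def)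
    have nt: "\<exists>(x, y)\<in>U D. x \<noteq> 0" using False by auto
    obtain x y where xy: "(x, y) \<in> U D" "norm x = 1"
      "\<And>x' y'. (x', y') \<in> U D \<Longrightarrow> norm y * norm x' \<le> norm y'"
      "\<And>x' y'. (x', y') \<in> U D \<Longrightarrow> y \<bullet> y' = (norm y)\<^sup>2 * (x \<bullet> x')"
      by (rule rayleigh_minimizer[OF subU clU], use compactU in blast, rule nt, rule that)
    have "good D (x, y)"
      unfolding good_def using xy by (auto simp only: fst_conv snd_conv)
    then show ?thesis ..
  qed
  then obtain step where step: "\<And>D. good D (step D)" by metis
  define D where "D = rec_nat {} (\<lambda>_ D. insert (fst (step D)) D)"
  define p where "p n = step (D n)" for n
  define e where "e n = fst (p n)" for n
  define f where "f n = snd (p n)" for n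
  have D: "D n = e ` {..<n}" for n
    by (induction n) (simp_all add: D_def e_def p_def lessThan_Suc)
  have p: "good (D n) (p n)" for n by (simp add: p_def step)
  have pef: "p n = (e n, f n)" for n by (simp add: e_def f_def)
  have p\<Gamma>: "p n \<in> \<Gamma>" for n using p[of n] by (simp add: good_def U_def)
  have orth_lt: "e n \<bullet> e k = 0" if "k < n" for k n
    using p[of n] that by (auto simp: good_def U_def D e_def)
  have orth: "e i \<bullet> e j = 0" if "i \<noteq> j" for i j
    using orth_lt[of i j] orth_lt[of j i] that by (cases "i < j") (auto simp: inner_commute)
  have unit: "e n = 0 \<or> norm (e n) = 1" for n
    using p[of n] by (auto simp: good_def e_def)
  have f0: "f n = 0" if "e n = 0" for n
    using p[of n] that by (auto simp: good_def e_def f_def)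
  interpret ons e by standard (use orth unit in auto)
  have residual: "q - (\<Sum>k<n. (fst q \<bullet> e k) *\<^sub>R p k) \<in> U (D n)" if "q \<in> \<Gamma>" for q n
  proof -
    have "q - (\<Sum>k<n. (fst q \<bullet> e k) *\<^sub>R p k) \<in> \<Gamma>"
      by (intro subspace_diff sub subspace_sum subspace_scale p\<Gamma> that)
    moreover have "(fst q - (\<Sum>k<n. (fst q \<bullet> e k) *\<^sub>R e k)) \<bullet> e j = 0" if "j < n" for j
      using that by (simp add: inner_diff_left inner_sum_e coeff_inner_self)
    ultimately show ?thesis by (auto simp: U_def D fst_sum e_def)
  qed
  \<comment> \<open>Minimality gives the eigenvalue equation only against pairs orthogonal to the
    earlier vectors. By induction \<open>f n\<close> is orthogonal to the earlier
    \<open>f k\<close>, so subtracting the projection of \<open>q\<close> changes neither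
    side.\<close>
  have eig: "f n \<bullet> snd q = (norm (f n))\<^sup>2 * (e n \<bullet> fst q)" if "q \<in> \<Gamma>" for n q
    using that
  proof (induction n arbitrary: q rule: less_induct)
    case (less n)
    show ?case
    proof (cases "e n = 0")
      case False
      let ?q = "q - (\<Sum>k<n. (fst q \<bullet> e k) *\<^sub>R p k)"
      have "\<forall>q\<in>U (D n). f n \<bullet> snd q = (norm (f n))\<^sup>2 * (e n \<bullet> fst q)"
        using p[of n] False by (auto simp: good_def e_def f_def)
      then have "f n \<bullet> snd ?q = (norm (f n))\<^sup>2 * (e n \<bullet> fst ?q)"
        using residual[OF less.prems] by blast
      moreover have "f n \<bullet> f k = 0" if "k < n" for k
        using less.IH[OF that p\<Gamma>[of n]] orth_lt[OF that] by (simp add: e_def f_def inner_commute)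
      then have "f n \<bullet> snd ?q = f n \<bullet> snd q"
        by (simp add: snd_sum inner_diff_right inner_sum_right f_def)
      moreover have "e n \<bullet> fst ?q = e n \<bullet> fst q"
        using orth_lt[of _ n] by (simp add: fst_sum inner_diff_right inner_sum_right e_def)
      ultimately show ?thesis by simp
    qed (simp add: f0)
  qed
  \<comment> \<open>The value 1 at padding indices keeps \<open>\<omega>\<close> positive; the lower
    bound \<open>\<kappa>\<close> is accordingly the minimum of 1 and the Poincare bound
    \<open>1 / K\<close>.\<close>
  define \<omega> where "\<omega> n = (if e n = 0 then 1 else norm (f n))" for n
  define \<kappa> where "\<kappa> = min 1 (1 / K)"
  have \<kappa>: "0 < \<kappa>" "\<kappa> \<le> \<omega> n" for n
  proof -
    show "0 < \<kappa>" using K by (simp add: \<kappa>_def)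
    have "1 / K \<le> norm (f n)" if "e n \<noteq> 0"
      using poincare[of "e n" "f n"] p\<Gamma>[of n] unit[of n] that K by (simp add: pef field_simps)
    then show "\<kappa> \<le> \<omega> n" by (auto simp: \<kappa>_def \<omega>_def min_le_iff_disj)
  qed
  have \<omega>pos: "0 < \<omega> n" for n using \<kappa>(1) \<kappa>(2)[of n] by linarith
  define \<phi> where "\<phi> n = f n /\<^sub>R \<omega> n" for n
  have \<phi>0: "\<phi> n = 0 \<longleftrightarrow> e n = 0" for n
    using \<omega>pos[of n] f0[of n] by (auto simp: \<phi>_def \<omega>_def split: if_splits)
  interpret \<phi>: ons \<phi>
  proof
    show "\<phi> i \<bullet> \<phi> j = 0" if "i \<noteq> j" for i j
      using eig[OF p\<Gamma>, of i j] orth[OF that] by (simp add: \<phi>_def pef)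
    show "\<phi> n = 0 \<or> norm (\<phi> n) = 1" for n
      using \<phi>0[of n] \<omega>pos[of n] by (auto simp: \<phi>_def \<omega>_def split: if_splits)
  qed
  have coeff: "y \<bullet> \<phi> n = \<omega> n * (x \<bullet> e n)" if "(x, y) \<in> \<Gamma>" for x y n
    using eig[OF that, of n] \<omega>pos[of n] f0[of n]
    by (auto simp: \<phi>_def \<omega>_def inner_commute power2_eq_square field_simps)
  have f\<phi>: "f n = \<omega> n *\<^sub>R \<phi> n" for n using \<omega>pos[of n] by (simp add: \<phi>_def)
  \<comment> \<open>If the residuals stayed above \<open>\<epsilon>\<close>, minimality at stage
    \<open>N\<close>, applied to the residual, would bound every \<open>norm (f N)\<close> by
    \<open>norm (snd q) / \<epsilon>\<close>. Compactness would then give a convergent subsequence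
    of the orthonormal \<open>e\<close>, whose members have mutual distance
    \<open>sqrt 2\<close>.\<close>
  have small: "\<exists>N. norm (fst q - (\<Sum>k<N. (fst q \<bullet> e k) *\<^sub>R e k)) < \<epsilon>" if q: "q \<in> \<Gamma>" and \<epsilon>: "0 < \<epsilon>" for q \<epsilon>
  proof (cases "\<exists>N. e N = 0")
    case True
    then obtain N where "e N = 0" ..
    then have "\<forall>q\<in>U (D N). fst q = 0" using p[of N] by (auto simp: good_def e_def)
    then have "fst q - (\<Sum>k<N. (fst q \<bullet> e k) *\<^sub>R e k) = 0"
      using residual[OF q, of N] by (auto simp: fst_sum e_def)
    then show ?thesis using \<epsilon> by (intro exI[of _ N]) simp
  next
    case False
    show ?thesis
    proof (rule ccontr)
      assume "\<not> ?thesis"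
      then have large: "\<epsilon> \<le> norm (fst q - (\<Sum>k<N. (fst q \<bullet> e k) *\<^sub>R e k))" for N by (simp add: not_less)
      have f_le: "norm (f N) \<le> norm (snd q) / \<epsilon>" for N
      proof -
        let ?r = "q - (\<Sum>k<N. (fst q \<bullet> e k) *\<^sub>R p k)"
        have "\<forall>q\<in>U (D N). norm (f N) * norm (fst q) \<le> norm (snd q)"
          using p[of N] False by (auto simp: good_def e_def f_def)
        then have "norm (f N) * norm (fst ?r) \<le> norm (snd ?r)" using residual[OF q] by blast
        moreover have "fst ?r = fst q - (\<Sum>k<N. (fst q \<bullet> e k) *\<^sub>R e k)"
          by (simp add: fst_sum e_def)
        moreover have "snd ?r = snd q - (\<Sum>k<N. (snd q \<bullet> \<phi> k) *\<^sub>R \<phi> k)"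
          using coeff[of "fst q" "snd q"] q by (simp add: snd_sum f_def[symmetric] f\<phi> mult.commute)
        moreover have "norm (snd q - (\<Sum>k<N. (snd q \<bullet> \<phi> k) *\<^sub>R \<phi> k)) \<le> norm (snd q)"
          by (rule power2_le_imp_le) (simp_all add: \<phi>.norm_residual sum_nonneg)
        ultimately have "norm (f N) * \<epsilon> \<le> norm (snd q)"
          using mult_left_mono[OF large[of N] norm_ge_zero[of "f N"]] by simp
        then show ?thesis using \<epsilon> by (simp add: field_simps)
      qed
      obtain r where r: "strict_mono r" "convergent (\<lambda>n. e (r n))"
        using compact[of p, OF p\<Gamma>] f_le by (auto simp: e_def f_def)
      then have "Cauchy (\<lambda>n. e (r n))" by (simp add: convergent_Cauchy)
      then obtain N where "\<forall>i\<ge>N. \<forall>j\<ge>N. dist (e (r i)) (e (r j)) < 1"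
        unfolding Cauchy_def by (meson zero_less_one)
      then have "norm (e (r N) - e (r (Suc N))) < 1" by (simp add: dist_norm)
      then have "(norm (e (r N) - e (r (Suc N))))\<^sup>2 < 1" by (simp add: power_less_one_iff)
      moreover have "r N \<noteq> r (Suc N)" using r(1) by (simp add: strict_mono_eq)
      then have "(norm (e (r N) - e (r (Suc N))))\<^sup>2 = (norm (e (r N)))\<^sup>2 + (norm (e (r (Suc N))))\<^sup>2"
        by (simp add: power2_norm_eq_inner inner_diff_left inner_diff_right orth del: dot_square_norm)
      ultimately show False using unit False by auto
    qed
  qed
  interpret wave e \<omega> \<kappa>
  proof
    show "0 < \<kappa>" "\<kappa> \<le> \<omega> n" for n using \<kappa> by auto
    fix x assume x: "\<And>n. x \<bullet> e n = 0"
    have "x \<bullet> fst q = 0" if q: "q \<in> \<Gamma>" for q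
    proof (rule ccontr)
      assume "x \<bullet> fst q \<noteq> 0"
      define \<epsilon> where "\<epsilon> = \<bar>x \<bullet> fst q\<bar> / (norm x + 1)"
      have "0 < \<epsilon>" using \<open>x \<bullet> fst q \<noteq> 0\<close> by (simp add: \<epsilon>_def add_nonneg_pos)
      then obtain N where N: "norm (fst q - (\<Sum>k<N. (fst q \<bullet> e k) *\<^sub>R e k)) < \<epsilon>"
        using small[OF q] by blast
      have "x \<bullet> fst q = x \<bullet> (fst q - (\<Sum>k<N. (fst q \<bullet> e k) *\<^sub>R e k))"
        by (simp add: inner_diff_right inner_sum_right x)
      then have "\<bar>x \<bullet> fst q\<bar> \<le> norm x * norm (fst q - (\<Sum>k<N. (fst q \<bullet> e k) *\<^sub>R e k))"
        by (metis Cauchy_Schwarz_ineq2)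
      also have "\<dots> \<le> norm x * \<epsilon>" using N by (intro mult_left_mono) auto
      also have "\<dots> < (norm x + 1) * \<epsilon>" using \<open>0 < \<epsilon>\<close> by simp
      also have "\<dots> = \<bar>x \<bullet> fst q\<bar>" by (simp add: \<epsilon>_def add_nonneg_eq_0_iff)
      finally show False by simp
    qed
    then show "x = 0" by (rule dense)
  qed
  \<comment> \<open>Finite sections of \<open>B w\<close> belong to the graph together with their
    images. The images converge because the coefficients of \<open>w\<close> are square summable,
    and the graph is closed.\<close>
  have range: "\<exists>y. (B w, y) \<in> \<Gamma> \<and> norm y = norm w" for w
  proof -
    let ?P = "\<lambda>N. \<Sum>n<N. ((w \<bullet> e n) / \<omega> n) *\<^sub>R p n"
    define y where "y = (\<Sum>n. (w \<bullet> e n) *\<^sub>R \<phi> n)"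
    have P\<Gamma>: "?P N \<in> \<Gamma>" for N by (intro sub subspace_sum subspace_scale p\<Gamma>)
    have "(\<lambda>N. fst (?P N)) \<longlonglongrightarrow> B w"
      using sums_coeff[of "B w"] by (simp add: sums_def inner_multipliers fst_sum e_def[symmetric])
    moreover have "(\<lambda>N. snd (?P N)) \<longlonglongrightarrow> y"
      using summable_LIMSEQ[OF \<phi>.summable_scaleR_e[OF summable_bessel[of w]]]
      by (simp add: y_def snd_sum f_def[symmetric] \<phi>_def divide_inverse)
    ultimately have "?P \<longlonglongrightarrow> (B w, y)"
      using tendsto_Pair[of "\<lambda>N. fst (?P N)" "B w" sequentially "\<lambda>N. snd (?P N)" y] by simp
    then have "(B w, y) \<in> \<Gamma>" by (rule closed_sequentially[OF cl P\<Gamma>])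
    moreover have "(norm y)\<^sup>2 = (norm w)\<^sup>2"
      unfolding y_def using parseval_norm[of w]
      by (subst \<phi>.norm_suminf_e) (auto simp: summable_bessel \<phi>0 sums_iff)
    ultimately show ?thesis by auto
  qed
  have "\<exists>w. x = B w \<and> norm w = norm y" if xy: "(x, y) \<in> \<Gamma>" for x y
  proof -
    define w where "w = (\<Sum>n. (y \<bullet> \<phi> n) *\<^sub>R e n)"
    have "w \<bullet> e n = \<omega> n * (x \<bullet> e n) * (e n \<bullet> e n)" for n
      unfolding w_def by (subst inner_suminf_e[OF \<phi>.summable_bessel]) (simp add: coeff[OF xy])
    then have "B w \<bullet> e n = x \<bullet> e n" for n
      using unit[of n] \<omega>pos[of n] by (auto simp: inner_multipliers norm_eq_1)
    then have x: "x = B w" by (intro eqI_coeff) simp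
    obtain y' where y': "(B w, y') \<in> \<Gamma>" "norm y' = norm w" using range by blast
    \<comment> \<open>The norm identity is known for the second component obtained from
      \<open>w\<close>; the graph being single-valued, that component is \<open>y\<close>.\<close>
    have "(0, y - y') \<in> \<Gamma>" using subspace_diff[OF sub xy y'(1)] x by simp
    then have "y = y'" using inj by force
    then show ?thesis using x y' by auto
  qed
  with that[OF wave_axioms] range show ?thesis by blast
qed

section \<open>The Hilbert space of square integrable functions\<close>

lemma space_I [simp]: "space I_meas = I_dom"
  by (simp add: space_restrict_space)

lemma finite_measure_I: "finite_measure I_meas"
proof
  have "emeasure I_meas (space I_meas) = emeasure lebesgue I_dom"
    by (simp add: emeasure_restrict_space)
  then show "emeasure I_meas (space I_meas) \<noteq> \<infinity>" by simp
qed

lemma measure_I: "measure I_meas I_dom = 2 * pi"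
  by (simp add: measure_restrict_space)

interpretation I: finite_measure I_meas by (rule finite_measure_I)

lemma L2_measurable [measurable_dest]: "u \<in> L2 \<Longrightarrow> u \<in> borel_measurable I_meas"
  and L2_square: "u \<in> L2 \<Longrightarrow> integrable I_meas (\<lambda>x. (u x)\<^sup>2)"
  by (simp_all add: L2_def)

lemma L2_mult_integrable:
  assumes "u \<in> L2" "v \<in> L2"
  shows "integrable I_meas (\<lambda>x. u x * v x)"
proof (rule Bochner_Integration.integrable_bound)
  show "integrable I_meas (\<lambda>x. (u x)\<^sup>2 + (v x)\<^sup>2)"
    using assms by (simp add: L2_square)
  show "(\<lambda>x. u x * v x) \<in> borel_measurable I_meas"
    by (intro borel_measurable_times L2_measurable assms)
  have "\<bar>a * b\<bar> \<le> a\<^sup>2 + b\<^sup>2" for a b :: real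
  proof -
    have "0 \<le> (\<bar>a\<bar> - \<bar>b\<bar>)\<^sup>2" by simp
    then have "2 * \<bar>a * b\<bar> \<le> a\<^sup>2 + b\<^sup>2" by (simp add: abs_mult power2_diff)
    with abs_ge_zero[of "a * b"] show ?thesis by linarith
  qed
  then show "AE x in I_meas. norm (u x * v x) \<le> norm ((u x)\<^sup>2 + (v x)\<^sup>2)" by simp
qed

lemma L2_integrable: "u \<in> L2 \<Longrightarrow> integrable I_meas u"
  by (rule I.square_integrable_imp_integrable) (rule L2_measurable L2_square; assumption)+

lemma L2_scale:
  assumes "u \<in> L2"
  shows "(\<lambda>x. c * u x) \<in> L2"
proof -
  have "(\<lambda>x. c * u x) \<in> borel_measurable I_meas"
    using borel_measurable_times[OF borel_measurable_const L2_measurable[OF assms]] .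
  moreover have "integrable I_meas (\<lambda>x. c\<^sup>2 * (u x)\<^sup>2)"
    by (intro integrable_mult_right L2_square assms)
  ultimately show ?thesis by (simp only: L2_def power_mult_distrib mem_Collect_eq simp_thms)
qed

lemma L2_add:
  assumes "u \<in> L2" "v \<in> L2"
  shows "(\<lambda>x. u x + v x) \<in> L2"
proof -
  have "integrable I_meas (\<lambda>x. (u x)\<^sup>2 + (v x)\<^sup>2 + 2 * (u x * v x))"
    by (intro Bochner_Integration.integrable_add integrable_mult_right L2_square L2_mult_integrable assms)
  moreover have "(\<lambda>x. u x + v x) \<in> borel_measurable I_meas"
    by (intro borel_measurable_add L2_measurable assms)
  ultimately show ?thesis by (simp only: L2_def power2_sum mult.assoc mem_Collect_eq simp_thms)
qed

lemma L2_diff: "u \<in> L2 \<Longrightarrow> v \<in> L2 \<Longrightarrow> (\<lambda>x. u x - v x) \<in> L2"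
  using L2_add[of u "\<lambda>x. (-1) * v x"] L2_scale[of v "-1"] by simp

lemma L2_uminus: "u \<in> L2 \<Longrightarrow> (\<lambda>x. - u x) \<in> L2"
  using L2_scale[of u "-1"] by simp

lemma L2_zero: "(\<lambda>x. 0) \<in> L2"
  by (simp add: L2_def)

lemma L2_bounded_mult:
  assumes "u \<in> L2" "w \<in> borel_measurable I_meas" "AE x in I_meas. \<bar>w x\<bar> \<le> C"
  shows "(\<lambda>x. w x * u x) \<in> L2"
proof -
  have "integrable I_meas (\<lambda>x. (w x * u x)\<^sup>2)"
  proof (rule Bochner_Integration.integrable_bound)
    show "integrable I_meas (\<lambda>x. C\<^sup>2 * (u x)\<^sup>2)" using assms by (simp add: L2_square)
    show "(\<lambda>x. (w x * u x)\<^sup>2) \<in> borel_measurable I_meas"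
      by (intro borel_measurable_power borel_measurable_times L2_measurable assms)
    show "AE x in I_meas. norm ((w x * u x)\<^sup>2) \<le> norm (C\<^sup>2 * (u x)\<^sup>2)"
      using assms(3)
    proof (rule AE_mp, intro AE_I2 impI)
      fix x assume "\<bar>w x\<bar> \<le> C"
      then have "(w x)\<^sup>2 \<le> C\<^sup>2" by (metis abs_ge_zero power2_abs power_mono)
      then show "norm ((w x * u x)\<^sup>2) \<le> norm (C\<^sup>2 * (u x)\<^sup>2)"
        by (simp add: power_mult_distrib mult_right_mono)
    qed
  qed
  moreover have "(\<lambda>x. w x * u x) \<in> borel_measurable I_meas"
    by (intro borel_measurable_times L2_measurable assms)
  ultimately show ?thesis by (simp add: L2_def)
qed

lemma L2_bounded:
  assumes "w \<in> borel_measurable I_meas" "\<And>x. \<bar>w x\<bar> \<le> C"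
  shows "w \<in> L2"
  using L2_bounded_mult[of "\<lambda>_. 1" w C] assms by (simp add: L2_def I.integrable_const)

lemma L2_inner_cong_AE:
  assumes "u \<in> L2" "u' \<in> L2" "v \<in> L2" "v' \<in> L2"
    "AE x in I_meas. u x = u' x" "AE x in I_meas. v x = v' x"
  shows "L2_inner u v = L2_inner u' v'"
  unfolding L2_inner_def
proof (rule integral_cong_AE)
  show "AE x in I_meas. u x * v x = u' x * v' x" using assms(5,6) by eventually_elim simp
qed (intro borel_measurable_times L2_measurable assms)+

lemma L2_inner_add_left:
  "u \<in> L2 \<Longrightarrow> u' \<in> L2 \<Longrightarrow> v \<in> L2 \<Longrightarrow> L2_inner (\<lambda>x. u x + u' x) v = L2_inner u v + L2_inner u' v"
  by (simp add: L2_inner_def distrib_right L2_mult_integrable)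

lemma L2_inner_scale_left:
  "L2_inner (\<lambda>x. c * u x) v = c * L2_inner u v"
  by (simp add: L2_inner_def mult.assoc)

lemma L2_inner_commute: "L2_inner u v = L2_inner v u"
  by (simp add: L2_inner_def mult.commute)

lemma L2_inner_self_eq_0:
  assumes "u \<in> L2"
  shows "L2_inner u u = 0 \<longleftrightarrow> (AE x in I_meas. u x = 0)"
  using integral_nonneg_eq_0_iff_AE[OF L2_square[OF assms]] by (simp add: L2_inner_def power2_eq_square)

section \<open>The quotient by equality almost everywhere\<close>

definition l2_rel :: "(real \<Rightarrow> real) \<Rightarrow> (real \<Rightarrow> real) \<Rightarrow> bool" where
  "l2_rel u v \<longleftrightarrow> u \<in> L2 \<and> v \<in> L2 \<and> (AE x in I_meas. u x = v x)"

quotient_type l2 = "real \<Rightarrow> real" / partial: l2_rel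
proof (rule part_equivpI)
  show "\<exists>u. l2_rel u u" using L2_zero by (auto simp: l2_rel_def)
  show "symp l2_rel"
  proof (rule sympI)
    fix u v assume "l2_rel u v"
    moreover have "AE x in I_meas. v x = u x" if "AE x in I_meas. u x = v x"
      using that by eventually_elim simp
    ultimately show "l2_rel v u" by (simp add: l2_rel_def)
  qed
  show "transp l2_rel"
  proof (rule transpI)
    fix u v w assume *: "l2_rel u v" "l2_rel v w"
    then have "AE x in I_meas. u x = v x" "AE x in I_meas. v x = w x" by (simp_all add: l2_rel_def)
    then have "AE x in I_meas. u x = w x" by eventually_elim simp
    with * show "l2_rel u w" by (simp add: l2_rel_def)
  qed
qed

lemma l2_rel_refl: "l2_rel u u \<longleftrightarrow> u \<in> L2"
  by (simp add: l2_rel_def)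

instantiation l2 :: real_vector
begin

lift_definition zero_l2 :: l2 is "\<lambda>x. 0" by (simp add: l2_rel_def L2_zero)

lift_definition plus_l2 :: "l2 \<Rightarrow> l2 \<Rightarrow> l2" is "\<lambda>u v x. u x + v x"
  unfolding l2_rel_def by (auto intro!: L2_add elim: AE_mp)

lift_definition minus_l2 :: "l2 \<Rightarrow> l2 \<Rightarrow> l2" is "\<lambda>u v x. u x - v x"
  unfolding l2_rel_def by (auto intro!: L2_diff elim: AE_mp)

lift_definition uminus_l2 :: "l2 \<Rightarrow> l2" is "\<lambda>u x. - u x"
  unfolding l2_rel_def by (auto intro!: L2_uminus elim: AE_mp)

lift_definition scaleR_l2 :: "real \<Rightarrow> l2 \<Rightarrow> l2" is "\<lambda>c u x. c * u x"
  unfolding l2_rel_def by (auto intro!: L2_scale elim: AE_mp)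

instance
proof
  fix x y z :: l2 and a b :: real
  show "x + y + z = x + (y + z)"
    by transfer (auto simp: l2_rel_def add.assoc intro!: L2_add)
  show "x + y = y + x"
    by transfer (auto simp: l2_rel_def add.commute intro!: L2_add)
  show "0 + x = x"
    by transfer (auto simp: l2_rel_def)
  show "- x + x = 0"
    by transfer (auto simp: l2_rel_def L2_zero)
  show "x - y = x + - y"
    by transfer (auto simp: l2_rel_def intro!: L2_diff)
  show "a *\<^sub>R (x + y) = a *\<^sub>R x + a *\<^sub>R y"
    by transfer (auto simp: l2_rel_def distrib_left intro!: L2_add L2_scale)
  show "(a + b) *\<^sub>R x = a *\<^sub>R x + b *\<^sub>R x"
    by transfer (auto simp: l2_rel_def distrib_right intro!: L2_add L2_scale)
  show "a *\<^sub>R b *\<^sub>R x = (a * b) *\<^sub>R x"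
    by transfer (auto simp: l2_rel_def mult.assoc intro!: L2_scale)
  show "1 *\<^sub>R x = x"
    by transfer (auto simp: l2_rel_def)
qed

end

instantiation l2 :: real_inner
begin

lift_definition inner_l2 :: "l2 \<Rightarrow> l2 \<Rightarrow> real" is L2_inner
  unfolding l2_rel_def by (auto intro: L2_inner_cong_AE)

definition norm_l2 :: "l2 \<Rightarrow> real" where "norm_l2 x = sqrt (inner x x)"
definition sgn_l2 :: "l2 \<Rightarrow> l2" where "sgn_l2 x = x /\<^sub>R norm x"
definition dist_l2 :: "l2 \<Rightarrow> l2 \<Rightarrow> real" where "dist_l2 x y = norm (x - y)"
definition uniformity_l2 :: "(l2 \<times> l2) filter" where
  "uniformity_l2 = (INF e\<in>{0<..}. principal {(x, y). dist x y < e})"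
definition open_l2 :: "l2 set \<Rightarrow> bool" where
  "open_l2 U \<longleftrightarrow> (\<forall>x\<in>U. eventually (\<lambda>(x', y). x' = x \<longrightarrow> y \<in> U) uniformity)"

instance
proof
  fix x y z :: l2 and a :: real
  show "dist x y = norm (x - y)" by (rule dist_l2_def)
  show "sgn x = x /\<^sub>R norm x" by (rule sgn_l2_def)
  show "uniformity = (INF e\<in>{0<..}. principal {(x::l2, y). dist x y < e})" by (rule uniformity_l2_def)
  show "open U \<longleftrightarrow> (\<forall>x\<in>U. eventually (\<lambda>(x', y). x' = x \<longrightarrow> y \<in> U) uniformity)" for U :: "l2 set"
    by (rule open_l2_def)
  show "x \<bullet> y = y \<bullet> x"
    by transfer (rule L2_inner_commute)
  show "(x + y) \<bullet> z = x \<bullet> z + y \<bullet> z"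
    by transfer (simp add: l2_rel_def L2_inner_add_left)
  show "(a *\<^sub>R x) \<bullet> y = a * (x \<bullet> y)"
    by transfer (rule L2_inner_scale_left)
  show "0 \<le> x \<bullet> x"
    by transfer (simp add: L2_inner_def)
  show "x \<bullet> x = 0 \<longleftrightarrow> x = 0"
    by transfer (simp add: l2_rel_def L2_inner_self_eq_0 L2_zero)
  show "norm x = sqrt (x \<bullet> x)" by (rule norm_l2_def)
qed

end

definition cls :: "(real \<Rightarrow> real) \<Rightarrow> l2" where "cls = abs_l2"
definition fn :: "l2 \<Rightarrow> real \<Rightarrow> real" where "fn = rep_l2"

lemma fn_L2 [simp]: "fn x \<in> L2"
  using Quotient3_rep_reflp[OF Quotient3_l2, of x] by (simp add: fn_def l2_rel_refl)

lemma cls_fn [simp]: "cls (fn x) = x"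
  using Quotient3_abs_rep[OF Quotient3_l2] by (simp add: cls_def fn_def)

lemma cls_eq_iff: "u \<in> L2 \<Longrightarrow> v \<in> L2 \<Longrightarrow> cls u = cls v \<longleftrightarrow> (AE x in I_meas. u x = v x)"
  using Quotient3_rel[OF Quotient3_l2, of u v] by (auto simp: cls_def l2_rel_def)

lemma cls_zero: "cls (\<lambda>x. 0) = 0"
  by (simp add: cls_def zero_l2_def)

lemma cls_add: "u \<in> L2 \<Longrightarrow> v \<in> L2 \<Longrightarrow> cls (\<lambda>x. u x + v x) = cls u + cls v"
  by (simp add: cls_def plus_l2.abs_eq l2_rel_refl)

lemma cls_diff: "u \<in> L2 \<Longrightarrow> v \<in> L2 \<Longrightarrow> cls (\<lambda>x. u x - v x) = cls u - cls v"
  by (simp add: cls_def minus_l2.abs_eq l2_rel_refl)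

lemma cls_scale: "u \<in> L2 \<Longrightarrow> cls (\<lambda>x. c * u x) = c *\<^sub>R cls u"
  by (simp add: cls_def scaleR_l2.abs_eq l2_rel_refl)

lemma inner_cls: "u \<in> L2 \<Longrightarrow> v \<in> L2 \<Longrightarrow> cls u \<bullet> cls v = L2_inner u v"
  by (simp add: cls_def inner_l2.abs_eq l2_rel_refl)

lemma norm_cls: "u \<in> L2 \<Longrightarrow> norm (cls u) = L2_norm u"
  by (simp add: norm_eq_sqrt_inner inner_cls L2_norm_def)

lemma norm_cls_power2: "u \<in> L2 \<Longrightarrow> (norm (cls u))\<^sup>2 = (\<integral>x. (u x)\<^sup>2 \<partial>I_meas)"
  unfolding power2_norm_eq_inner
  by (simp add: inner_cls L2_inner_def power2_eq_square del: dot_square_norm)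

lemma norm_cls_le_bound:
  assumes "u \<in> L2" "AE x in I_meas. \<bar>u x\<bar> \<le> C" "0 \<le> C"
  shows "norm (cls u) \<le> C * sqrt (2 * pi)"
proof (rule power2_le_imp_le)
  have "(\<integral>x. (u x)\<^sup>2 \<partial>I_meas) \<le> (\<integral>x. C\<^sup>2 \<partial>I_meas)"
  proof (rule integral_mono_AE)
    show "AE x in I_meas. (u x)\<^sup>2 \<le> C\<^sup>2"
      using assms(2) by eventually_elim (metis abs_ge_zero power2_abs power_mono)
  qed (use assms in \<open>simp_all add: L2_square I.integrable_const\<close>)
  then show "(norm (cls u))\<^sup>2 \<le> (C * sqrt (2 * pi))\<^sup>2"
    by (simp add: norm_cls_power2 assms measure_I power_mult_distrib mult.commute)
qed (use assms in simp)

text \<open>Cauchy-Schwarz against the constant 1, whose norm is at most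
  \<open>sqrt (2 * pi)\<close>.\<close>

lemma integral_abs_le_norm_cls:
  assumes "u \<in> L2"
  shows "(\<integral>x. \<bar>u x\<bar> \<partial>I_meas) \<le> sqrt (2 * pi) * norm (cls u)"
proof -
  have m: "(\<lambda>x. \<bar>u x\<bar>) \<in> L2" using assms L2_measurable[OF assms] by (simp add: L2_def)
  have 1: "(\<lambda>x. 1) \<in> L2" by (simp add: L2_def I.integrable_const)
  have "(\<integral>x. \<bar>u x\<bar> \<partial>I_meas) = cls (\<lambda>x. 1) \<bullet> cls (\<lambda>x. \<bar>u x\<bar>)"
    by (simp add: inner_cls m 1 L2_inner_def)
  also have "\<dots> \<le> norm (cls (\<lambda>x. 1)) * norm (cls (\<lambda>x. \<bar>u x\<bar>))" by (rule norm_cauchy_schwarz)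
  also have "norm (cls (\<lambda>x. 1)) \<le> 1 * sqrt (2 * pi)" by (rule norm_cls_le_bound[OF 1]) auto
  also have "norm (cls (\<lambda>x. \<bar>u x\<bar>)) = norm (cls u)"
    by (simp add: norm_cls m assms L2_norm_def L2_inner_def)
  finally show ?thesis by (simp add: mult_right_mono)
qed

text \<open>A rapidly converging subsequence converges almost everywhere because its increments are
  summable in \<open>L\<^sup>1\<close>; Fatou's lemma then gives convergence in \<open>L\<^sup>2\<close>.\<close>

instance l2 :: complete_space
proof
  fix X :: "nat \<Rightarrow> l2" assume X: "Cauchy X"
  have "\<exists>N. \<forall>m\<ge>N. \<forall>n\<ge>N. norm (X m - X n) < (1 / 2) ^ k" for k
    using X unfolding Cauchy_def dist_norm by simp
  then obtain N where N: "\<And>k m n. m \<ge> N k \<Longrightarrow> n \<ge> N k \<Longrightarrow> norm (X m - X n) < (1 / 2) ^ k" by metis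
  \<comment> \<open>The sum makes \<open>r k\<close> at least \<open>N k\<close>; the summand
    \<open>k\<close> makes the sequence strictly increasing.\<close>
  define r where "r k = (\<Sum>i\<le>k. N i) + k" for k
  have rN: "N k \<le> r k" for k unfolding r_def by (rule trans_le_add1) (rule member_le_sum, auto)
  have r: "strict_mono r" by (rule strict_monoI_Suc) (simp add: r_def)
  define f where "f k = fn (X (r k))" for k
  have fL: "f k \<in> L2" for k by (simp add: f_def)
  have f_meas: "f k \<in> borel_measurable I_meas" for k by (rule L2_measurable[OF fL])
  have cls_f: "cls (f k) = X (r k)" for k by (simp add: f_def)
  have inc: "norm (cls (\<lambda>x. f (Suc k) x - f k x)) \<le> (1 / 2) ^ k" for k
    using N[of k "r (Suc k)" "r k"] rN[of k] strict_mono_less_eq[OF r, of k "Suc k"]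
    by (simp add: cls_diff fL cls_f)
  have int: "integrable I_meas (\<lambda>x. f (Suc k) x - f k x)" for k
    by (intro L2_integrable L2_diff fL)
  have "AE x in I_meas. summable (\<lambda>k. norm (f (Suc k) x - f k x))"
  proof -
    have "(\<integral>\<^sup>+x. (\<Sum>k. ennreal (norm (f (Suc k) x - f k x))) \<partial>I_meas)
        = (\<Sum>k. \<integral>\<^sup>+x. ennreal (norm (f (Suc k) x - f k x)) \<partial>I_meas)"
      by (rule nn_integral_suminf) (use f_meas in measurable)
    also have "\<dots> = (\<Sum>k. ennreal (\<integral>x. norm (f (Suc k) x - f k x) \<partial>I_meas))"
      by (intro suminf_cong nn_integral_eq_integral integrable_norm int) auto
    also have "\<dots> \<le> (\<Sum>k. ennreal (sqrt (2 * pi) * (1 / 2) ^ k))"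
    proof (intro suminf_le ennreal_leI)
      fix k
      have "(\<integral>x. \<bar>f (Suc k) x - f k x\<bar> \<partial>I_meas) \<le> sqrt (2 * pi) * norm (cls (\<lambda>x. f (Suc k) x - f k x))"
        by (intro integral_abs_le_norm_cls L2_diff fL)
      also have "\<dots> \<le> sqrt (2 * pi) * (1 / 2) ^ k" by (intro mult_left_mono inc) simp
      finally show "(\<integral>x. norm (f (Suc k) x - f k x) \<partial>I_meas) \<le> sqrt (2 * pi) * (1 / 2) ^ k" by simp
    qed auto
    also have "\<dots> = ennreal (\<Sum>k. sqrt (2 * pi) * (1 / 2) ^ k)"
      by (intro suminf_ennreal2 summable_mult summable_geometric) auto
    also have "\<dots> < \<infinity>" by simp
    finally have "(\<integral>\<^sup>+x. (\<Sum>k. ennreal (norm (f (Suc k) x - f k x))) \<partial>I_meas) \<noteq> \<infinity>" by simp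
    then have "AE x in I_meas. (\<Sum>k. ennreal (norm (f (Suc k) x - f k x))) \<noteq> \<infinity>"
      by (intro nn_integral_PInf_AE) (use f_meas in measurable)
    then show ?thesis
      by eventually_elim (rule summable_suminf_not_top, auto)
  qed
  then have conv: "AE x in I_meas. convergent (\<lambda>k. f k x)"
  proof eventually_elim
    case (elim x)
    then have "summable (\<lambda>k. f (Suc k) x - f k x)" by (rule summable_norm_cancel)
    then have "convergent (\<lambda>n. \<Sum>k<n. f (Suc k) x - f k x)" by (simp add: summable_iff_convergent)
    then have "convergent (\<lambda>n. f n x - f 0 x)" using sum_lessThan_telescope[of "\<lambda>k. f k x"] by simp
    then show ?case by (simp add: convergent_diff_const_right_iff)
  qed
  define F where "F x = lim (\<lambda>k. f k x)" for x
  have F_meas: "F \<in> borel_measurable I_meas"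
    unfolding F_def by (rule borel_measurable_lim_metric) (rule f_meas)
  have lim: "AE x in I_meas. (\<lambda>k. f k x) \<longlonglongrightarrow> F x"
    using conv by eventually_elim (simp add: F_def convergent_LIMSEQ_iff)
  have sq_meas: "(\<lambda>x. ennreal ((f m x - f k x)\<^sup>2)) \<in> borel_measurable I_meas" for m k
    by (intro measurable_compose[OF _ measurable_ennreal] borel_measurable_power borel_measurable_diff f_meas)
  have fatou: "(\<integral>\<^sup>+x. ennreal ((F x - f k x)\<^sup>2) \<partial>I_meas) \<le> ennreal (((1 / 2) ^ k)\<^sup>2)" for k
  proof -
    have "(\<integral>\<^sup>+x. ennreal ((F x - f k x)\<^sup>2) \<partial>I_meas)
        = (\<integral>\<^sup>+x. liminf (\<lambda>m. ennreal ((f m x - f k x)\<^sup>2)) \<partial>I_meas)"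
    proof (rule nn_integral_cong_AE, use lim in eventually_elim)
      case (elim x)
      have "(\<lambda>m. ennreal ((f m x - f k x)\<^sup>2)) \<longlonglongrightarrow> ennreal ((F x - f k x)\<^sup>2)"
        by (intro tendsto_intros elim)
      then show ?case by (rule lim_imp_Liminf[OF sequentially_bot, symmetric])
    qed
    also have "\<dots> \<le> liminf (\<lambda>m. \<integral>\<^sup>+x. ennreal ((f m x - f k x)\<^sup>2) \<partial>I_meas)"
      by (rule nn_integral_liminf) (rule sq_meas)
    also have "\<dots> \<le> ennreal (((1 / 2) ^ k)\<^sup>2)"
    proof (rule Liminf_le[OF sequentially_bot], rule eventually_sequentiallyI[of k])
      fix m assume "k \<le> m"
      then have "norm (cls (\<lambda>x. f m x - f k x)) \<le> (1 / 2) ^ k"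
        using N[of k "r m" "r k"] rN[of k] strict_mono_less_eq[OF r, of k m]
        by (simp add: cls_diff fL cls_f)
      then have "(norm (cls (\<lambda>x. f m x - f k x)))\<^sup>2 \<le> ((1 / 2) ^ k)\<^sup>2" by (rule power_mono) simp
      moreover have "(\<integral>\<^sup>+x. ennreal ((f m x - f k x)\<^sup>2) \<partial>I_meas) = ennreal ((norm (cls (\<lambda>x. f m x - f k x)))\<^sup>2)"
        unfolding norm_cls_power2[OF L2_diff[OF fL fL]]
        by (intro nn_integral_eq_integral L2_square L2_diff fL) auto
      ultimately show "(\<integral>\<^sup>+x. ennreal ((f m x - f k x)\<^sup>2) \<partial>I_meas) \<le> ennreal (((1 / 2) ^ k)\<^sup>2)"
        by (simp add: ennreal_leI)
    qed
    finally show ?thesis .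
  qed
  have FfL: "(\<lambda>x. F x - f k x) \<in> L2" for k
  proof -
    have "integrable I_meas (\<lambda>x. (F x - f k x)\<^sup>2)"
    proof (rule integrableI_bounded)
      show "(\<integral>\<^sup>+x. ennreal (norm ((F x - f k x)\<^sup>2)) \<partial>I_meas) < \<infinity>"
        using le_less_trans[OF fatou[of k], of \<infinity>] by simp
    qed (intro borel_measurable_power borel_measurable_diff f_meas F_meas)
    then show ?thesis by (simp add: L2_def borel_measurable_diff f_meas F_meas)
  qed
  have FL: "F \<in> L2" using L2_add[OF FfL[of 0] fL[of 0]] by simp
  have "norm (cls F - X (r k)) \<le> (1 / 2) ^ k" for k
  proof -
    have "(\<integral>\<^sup>+x. ennreal ((F x - f k x)\<^sup>2) \<partial>I_meas) = ennreal ((norm (cls (\<lambda>x. F x - f k x)))\<^sup>2)"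
      unfolding norm_cls_power2[OF FfL] by (rule nn_integral_eq_integral[OF L2_square[OF FfL]]) simp
    with fatou[of k] have "(norm (cls (\<lambda>x. F x - f k x)))\<^sup>2 \<le> ((1 / 2) ^ k)\<^sup>2"
      by (simp only: ennreal_le_iff[OF zero_le_power2])
    then have "norm (cls (\<lambda>x. F x - f k x)) \<le> (1 / 2) ^ k"
      by (rule power2_le_imp_le) simp
    then show ?thesis by (simp add: cls_diff FL fL cls_f)
  qed
  then have le: "dist (X (r k)) (cls F) \<le> (1 / 2) ^ k" for k
    by (simp only: dist_norm norm_minus_commute)
  have "(X \<circ> r) \<longlonglongrightarrow> cls F"
  proof (rule metric_tendsto_imp_tendsto)
    show "(\<lambda>k. (1 / 2 :: real) ^ k) \<longlonglongrightarrow> 0" by (rule LIMSEQ_realpow_zero) auto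
    show "eventually (\<lambda>k. dist ((X \<circ> r) k) (cls F) \<le> dist ((1 / 2 :: real) ^ k) 0) sequentially"
      by (rule eventuallyI) (simp add: le)
  qed
  from Cauchy_converges_subseq[OF X r this] show "convergent X" by (rule convergentI)
qed

instance l2 :: banach ..

section \<open>Test functions\<close>

text \<open>Recursion through \<open>deriv f\<close>, with the function as a parameter, lets closure
  under sums, products and affine substitutions be proved by induction over all functions at
  once.\<close>

primrec Cn :: "nat \<Rightarrow> (real \<Rightarrow> real) \<Rightarrow> bool" where
  "Cn 0 f \<longleftrightarrow> True"
| "Cn (Suc k) f \<longleftrightarrow> (\<forall>x. f differentiable (at x)) \<and> Cn k (deriv f)"

lemma all_Cn_iff: "(\<forall>k. Cn k f) \<longleftrightarrow> (\<forall>k x. (deriv ^^ k) f differentiable (at x))"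
proof -
  have "Cn k f \<longleftrightarrow> (\<forall>j<k. \<forall>x. (deriv ^^ j) f differentiable (at x))" for k f
  proof (induction k arbitrary: f)
    case (Suc k)
    show ?case
      by (simp add: Suc.IH All_less_Suc2 funpow_Suc_right del: funpow.simps(2))
  qed simp
  then show ?thesis by blast
qed

lemma DERIV_deriv_real: "(f :: real \<Rightarrow> real) differentiable (at x) \<Longrightarrow> (f has_real_derivative deriv f x) (at x)"
  by (simp add: DERIV_deriv_iff_real_differentiable)

lemma Cn_SucD: "Cn (Suc k) f \<Longrightarrow> Cn k f"
proof (induction k arbitrary: f)
  case (Suc k)
  then show ?case using Suc.IH[of "deriv f"] by simp
qed simp

lemma Cn_SucI:
  assumes "\<And>x. (f has_real_derivative f' x) (at x)" "Cn k f'"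
  shows "Cn (Suc k) f"
proof -
  have "deriv f = f'" using assms(1) by (intro ext DERIV_imp_deriv)
  then show ?thesis using assms by (auto simp: real_differentiable_def)
qed

lemma Cn_const: "Cn k (\<lambda>x. c)"
proof (induction k arbitrary: c)
  case (Suc k)
  show ?case by (rule Cn_SucI[where f' = "\<lambda>x. 0"]) (auto simp: Suc)
qed simp

lemma Cn_add: "Cn k f \<Longrightarrow> Cn k g \<Longrightarrow> Cn k (\<lambda>x. f x + g x)"
proof (induction k arbitrary: f g)
  case (Suc k)
  show ?case
  proof (rule Cn_SucI)
    show "((\<lambda>x. f x + g x) has_real_derivative deriv f x + deriv g x) (at x)" for x
      using Suc.prems by (intro DERIV_add DERIV_deriv_real) auto
    show "Cn k (\<lambda>x. deriv f x + deriv g x)"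
      using Suc.prems by (intro Suc.IH) auto
  qed
qed simp

lemma Cn_mult: "Cn k f \<Longrightarrow> Cn k g \<Longrightarrow> Cn k (\<lambda>x. f x * g x)"
proof (induction k arbitrary: f g)
  case (Suc k)
  show ?case
  proof (rule Cn_SucI[where f' = "\<lambda>x. deriv f x * g x + deriv g x * f x"])
    show "((\<lambda>x. f x * g x) has_real_derivative deriv f x * g x + deriv g x * f x) (at x)" for x
      using Suc.prems by (intro DERIV_mult DERIV_deriv_real) auto
    show "Cn k (\<lambda>x. deriv f x * g x + deriv g x * f x)"
      using Suc.prems Cn_SucD[OF Suc.prems(1)] Cn_SucD[OF Suc.prems(2)]
      by (intro Cn_add Suc.IH) simp_all
  qed
qed simp

lemma Cn_affine: "Cn k f \<Longrightarrow> Cn k (\<lambda>x. f (m * x + q))"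
proof (induction k arbitrary: f)
  case (Suc k)
  show ?case
  proof (rule Cn_SucI[where f' = "\<lambda>x. deriv f (m * x + q) * m"])
    show "((\<lambda>x. f (m * x + q)) has_real_derivative deriv f (m * x + q) * m) (at x)" for x
      by (rule DERIV_chain2[OF DERIV_deriv_real]) (use Suc.prems in \<open>auto intro!: derivative_eq_intros\<close>)
    show "Cn k (\<lambda>x. deriv f (m * x + q) * m)"
      using Suc.prems by (intro Cn_mult Cn_const Suc.IH) auto
  qed
qed simp

section \<open>Smooth cut-off functions\<close>

definition flat :: "nat \<Rightarrow> real \<Rightarrow> real" where
  "flat n x = (if 0 < x then (1 / x) ^ n * exp (- 1 / x) else 0)"

lemma tendsto_flat_0: "(flat n \<longlongrightarrow> 0) (at 0)"
proof -
  have "((\<lambda>x::real. (1 / x) ^ n / exp (1 / x)) \<longlongrightarrow> 0) (at_right 0)"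
    using filterlim_compose[OF tendsto_power_div_exp_0[of n] filterlim_inverse_at_top_right]
    by (simp add: inverse_eq_divide)
  then have "(flat n \<longlongrightarrow> 0) (at_right 0)"
    by (rule Lim_transform_eventually)
      (auto simp: flat_def exp_minus divide_inverse eventually_at_right_less intro!: eventually_mono[OF eventually_at_right_less[of 0]])
  moreover have "(flat n \<longlongrightarrow> 0) (at_left 0)"
    by (rule Lim_transform_eventually[OF tendsto_const])
      (auto simp: flat_def eventually_at_filter)
  ultimately show ?thesis by (simp add: filterlim_split_at)
qed

text \<open>The powers of \<open>1 / x\<close> make the span of the family closed under
  differentiation, which gives smoothness of each member by induction on the order. At 0 the
  difference quotient of \<open>flat n\<close> is \<open>flat (Suc n)\<close>, which tends to
  0.\<close>

lemma flat_has_derivative: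
  "(flat n has_real_derivative - real n * flat (Suc n) x + flat (Suc (Suc n)) x) (at x)"
proof -
  consider "0 < x" | "x < 0" | "x = 0" by linarith
  then show ?thesis
  proof cases
    case 1
    have "((\<lambda>x. (1 / x) ^ n * exp (- 1 / x)) has_real_derivative - real n * flat (Suc n) x + flat (Suc (Suc n)) x) (at x)"
    proof -
      have inv: "((\<lambda>x. 1 / x) has_real_derivative - (1 / x * (1 / x))) (at x)"
        using 1 by (auto intro!: derivative_eq_intros simp: power2_eq_square)
      have pow: "((\<lambda>x. (1 / x) ^ n) has_real_derivative - real n * (1 / x) ^ Suc n) (at x)" for n
      proof (induction n)
        case (Suc n)
        show ?case
          using DERIV_mult[OF inv Suc] by (simp add: algebra_simps diff_divide_distrib)
      qed simp
      have "((\<lambda>x. exp (- 1 / x)) has_real_derivative exp (- 1 / x) * (1 / x * (1 / x))) (at x)"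
        using DERIV_fun_exp[OF DERIV_minus[OF inv]] by simp
      from DERIV_mult[OF pow this] show ?thesis
        using 1 by (simp add: flat_def algebra_simps)
    qed
    then show ?thesis
      by (rule DERIV_cong_ev[THEN iffD1, rotated -1])
        (use 1 eventually_nhds_in_open[of "{0<..}" x] in \<open>auto simp: flat_def elim!: eventually_mono\<close>)
  next
    case 2
    have "((\<lambda>x. 0) has_real_derivative 0) (at x)" by simp
    then have "(flat n has_real_derivative 0) (at x)"
      by (rule DERIV_cong_ev[THEN iffD1, rotated -1])
        (use 2 eventually_nhds_in_open[of "{..<0}" x] in \<open>auto simp: flat_def elim!: eventually_mono\<close>)
    then show ?thesis using 2 by (simp add: flat_def)
  next
    case 3
    have "((\<lambda>y. (flat n y - flat n 0) / (y - 0)) \<longlongrightarrow> 0) (at 0)"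
      by (rule Lim_transform_eventually[OF tendsto_flat_0[of "Suc n"]])
        (auto simp: flat_def eventually_at_filter)
    then show ?thesis using 3 by (simp add: has_field_derivative_iff flat_def)
  qed
qed

lemma Cn_flat: "Cn k (flat n)"
proof (induction k arbitrary: n)
  case (Suc k)
  show ?case
    by (rule Cn_SucI[OF flat_has_derivative]) (intro Cn_add Cn_mult Cn_const Suc)
qed simp

text \<open>A smooth substitute for the indicator of the positive half-line: for positive
  \<open>j\<close> it vanishes up to \<open>1 / j\<close>, and it tends to 1 at each positive
  point.\<close>

definition step :: "nat \<Rightarrow> real \<Rightarrow> real" where
  "step j x = flat 0 (real j * x + (- 1))"

lemma Cn_step: "Cn k (\<lambda>x. step j (m * x + q))"
  unfolding step_def by (intro Cn_affine[OF Cn_affine, OF Cn_flat])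

lemma step_bounds: "0 \<le> step j x" "step j x \<le> 1"
  by (auto simp: step_def flat_def)

lemma step_eq_0: "real j * x \<le> 1 \<Longrightarrow> step j x = 0"
  by (simp add: step_def flat_def)

lemma tendsto_step: "(\<lambda>j. step j x) \<longlonglongrightarrow> (if 0 < x then 1 else 0)"
proof (cases "0 < x")
  case True
  have lim: "filterlim (\<lambda>j. real j * x + (- 1)) at_top sequentially"
    using True by real_asymp
  have "((\<lambda>y::real. exp (- 1 / y)) \<longlongrightarrow> 1) at_top" by real_asymp
  then have "(flat 0 \<longlongrightarrow> 1) at_top"
    by (rule Lim_transform_eventually)
      (auto simp: flat_def intro!: eventually_mono[OF eventually_gt_at_top[of 0]])
  from filterlim_compose[OF this lim] True show ?thesis by (simp add: step_def)
next
  case False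
  then have "step j x = 0" for j by (intro step_eq_0) (simp add: mult_nonneg_nonpos order_trans[of _ 0])
  then show ?thesis using False by simp
qed

definition bump :: "nat \<Rightarrow> real \<Rightarrow> real \<Rightarrow> real \<Rightarrow> real" where
  "bump j c d x = step j (x - c) * step j (d - x)"

text \<open>Vanishes near \<open>b\<close> and tends to 1 elsewhere. As a factor of a test function
  it enforces a point condition at \<open>b\<close> and disappears in the limit.\<close>

definition hole :: "nat \<Rightarrow> real \<Rightarrow> real \<Rightarrow> real" where
  "hole j b x = step j (x - b) + step j (b - x)"

lemma Cn_bump: "Cn k (bump j c d)"
proof -
  have "Cn k (\<lambda>x. step j (1 * x + (- c)) * step j (- 1 * x + d))" by (intro Cn_mult Cn_step)
  then show ?thesis by (simp add: bump_def[abs_def])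
qed

lemma Cn_hole: "Cn k (hole j b)"
proof -
  have "Cn k (\<lambda>x. step j (1 * x + (- b)) + step j (- 1 * x + b))" by (intro Cn_add Cn_step)
  then show ?thesis by (simp add: hole_def[abs_def])
qed

lemma tendsto_bump: "(\<lambda>j. bump j c d x) \<longlonglongrightarrow> indicator {c<..<d} x"
proof -
  have "(\<lambda>j. bump j c d x) \<longlonglongrightarrow> (if 0 < x - c then 1 else 0) * (if 0 < d - x then 1 else 0)"
    unfolding bump_def by (intro tendsto_mult tendsto_step)
  then show ?thesis by (simp add: indicator_def split: if_splits)
qed

lemma tendsto_hole: "x \<noteq> b \<Longrightarrow> (\<lambda>j. hole j b x) \<longlonglongrightarrow> 1"
proof -
  assume "x \<noteq> b"
  have "(\<lambda>j. hole j b x) \<longlonglongrightarrow> (if 0 < x - b then 1 else 0) + (if 0 < b - x then 1 else 0)"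
    unfolding hole_def by (intro tendsto_add tendsto_step)
  then show ?thesis using \<open>x \<noteq> b\<close> by (auto split: if_splits)
qed

lemma bump_bounds: "0 \<le> bump j c d x" "bump j c d x \<le> 1"
  unfolding bump_def by (auto intro!: mult_nonneg_nonneg mult_le_one step_bounds)

lemma hole_bounds: "0 \<le> hole j b x" "hole j b x \<le> 2"
  using step_bounds[of j "x - b"] step_bounds[of j "b - x"] by (auto simp: hole_def)

lemma bump_eq_0: "x - c \<le> 1 / real j \<or> d - x \<le> 1 / real j \<Longrightarrow> 0 < j \<Longrightarrow> bump j c d x = 0"
  unfolding bump_def by (auto intro!: step_eq_0 simp: field_simps)

lemma hole_eq_0: "\<bar>x - b\<bar> \<le> 1 / real j \<Longrightarrow> 0 < j \<Longrightarrow> hole j b x = 0"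
  unfolding hole_def by (auto intro!: add_nonneg_eq_0_iff[THEN iffD2] step_eq_0 step_bounds simp: abs_le_iff field_simps)

section \<open>Calculus of test functions\<close>

lemma test_functionsI:
  assumes "\<And>k. Cn k \<phi>" "compact K" "K \<subseteq> S" "\<And>x. x \<notin> K \<Longrightarrow> \<phi> x = 0"
  shows "\<phi> \<in> test_functions S"
proof -
  have "closure {x. \<phi> x \<noteq> 0} \<subseteq> K"
    using assms by (intro closure_minimal compact_imp_closed) auto
  moreover from this have "compact (closure {x. \<phi> x \<noteq> 0})"
    using assms(2) by (metis closed_closure compact_Int_closed inf.absorb2)
  ultimately show ?thesis
    unfolding test_functions_def using assms all_Cn_iff[of \<phi>] by auto
qed

lemma test_functions_Cn: "\<phi> \<in> test_functions S \<Longrightarrow> Cn k \<phi>"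
  using all_Cn_iff[of \<phi>] by (auto simp: test_functions_def)

lemma test_functions_mono: "S \<subseteq> T \<Longrightarrow> test_functions S \<subseteq> test_functions T"
  by (auto simp: test_functions_def)

lemma test_functions_eq_0: "\<phi> \<in> test_functions S \<Longrightarrow> x \<notin> S \<Longrightarrow> \<phi> x = 0"
  using closure_subset[of "{x. \<phi> x \<noteq> 0}"] by (auto simp: test_functions_def)

lemma test_functions_has_derivative:
  "\<phi> \<in> test_functions S \<Longrightarrow> (\<phi> has_real_derivative deriv \<phi> x) (at x)"
  using test_functions_Cn[of \<phi> S "Suc 0"] by (intro DERIV_deriv_real) simp

lemma test_functions_deriv:
  assumes "\<phi> \<in> test_functions S"
  shows "deriv \<phi> \<in> test_functions S"
proof (rule test_functionsI)
  define Z where "Z = {x. \<phi> x \<noteq> 0}"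
  have "Cn (Suc k) \<phi>" for k by (rule test_functions_Cn[OF assms])
  then show "Cn k (deriv \<phi>)" for k by (simp only: Cn.simps)
  show "compact (closure Z)" "closure Z \<subseteq> S"
    using assms by (simp_all add: test_functions_def Z_def)
  fix x assume x: "x \<notin> closure Z"
  have ev: "eventually (\<lambda>y. y \<in> - closure Z) (nhds x)"
    by (rule eventually_nhds_in_open) (use x open_Compl[OF closed_closure, of Z] in simp_all)
  have "\<phi> y = 0" if "y \<in> - closure Z" for y
    using subsetD[OF closure_subset, of y Z] that by (auto simp: Z_def)
  then have "eventually (\<lambda>y. \<phi> y = 0) (nhds x)" by (rule eventually_mono[OF ev])
  then have "(\<phi> has_real_derivative 0) (at x) \<longleftrightarrow> ((\<lambda>x. 0) has_real_derivative 0) (at x)"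
    by (intro DERIV_cong_ev refl)
  then have "(\<phi> has_real_derivative 0) (at x)" by simp
  then show "deriv \<phi> x = 0" by (rule DERIV_imp_deriv)
qed

lemma test_functions_continuous:
  assumes "\<phi> \<in> test_functions S"
  shows "continuous_on A \<phi>"
  by (rule continuous_at_imp_continuous_on)
    (intro ballI DERIV_isCont[OF test_functions_has_derivative[OF assms]])

lemma test_functions_bounded:
  assumes "\<phi> \<in> test_functions S"
  obtains C where "\<And>x. \<bar>\<phi> x\<bar> \<le> C"
proof -
  let ?K = "closure {x. \<phi> x \<noteq> 0}"
  have "compact (\<phi> ` ?K)"
    using assms by (intro compact_continuous_image test_functions_continuous[OF assms])
      (simp only: test_functions_def mem_Collect_eq)
  then have "bounded (\<phi> ` ?K)" by (rule compact_imp_bounded)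
  then obtain C where C: "\<forall>y\<in>\<phi> ` ?K. norm y \<le> C" unfolding bounded_iff by blast
  have "\<bar>\<phi> x\<bar> \<le> max C 0" for x
  proof (cases "\<phi> x = 0")
    case False
    then have "x \<in> {x. \<phi> x \<noteq> 0}" by simp
    then have "x \<in> ?K" by (rule subsetD[OF closure_subset])
    then have "norm (\<phi> x) \<le> C" using C by blast
    then show ?thesis by simp
  qed simp
  then show ?thesis by (rule that)
qed

lemma continuous_measurable_I: "continuous_on UNIV f \<Longrightarrow> f \<in> borel_measurable I_meas"
  for f :: "real \<Rightarrow> real"
  by (rule continuous_imp_measurable_on_sets_lebesgue) (auto elim: continuous_on_subset)

lemma test_functions_L2:
  assumes "\<phi> \<in> test_functions S"
  shows "\<phi> \<in> L2"
proof -
  obtain C where "\<And>x. \<bar>\<phi> x\<bar> \<le> C" using test_functions_bounded[OF assms] by blast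
  then show ?thesis
    by (rule L2_bounded[OF continuous_measurable_I[OF test_functions_continuous[OF assms]]])
qed

text \<open>These functions approximate the indicator of \<open>{c<..<d}\<close> boundedly and
  almost everywhere while staying away from the two points. Within distance \<open>\<delta>\<close>
  of each forbidden point one factor vanishes, which leaves a compact support.\<close>

lemma test_functions_bump_hole:
  assumes "0 < j" "{c<..<d} \<subseteq> S"
  shows "(\<lambda>x. bump j c d x * (hole j b1 x * hole j b2 x)) \<in> test_functions (S - {b1, b2})"
proof -
  define \<delta> where "\<delta> = 1 / real j"
  have \<delta>: "0 < \<delta>" using assms(1) by (simp add: \<delta>_def)
  let ?K = "{c + \<delta>..d - \<delta>} \<inter> {x. \<delta> \<le> \<bar>x - b1\<bar>} \<inter> {x. \<delta> \<le> \<bar>x - b2\<bar>}"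
  show ?thesis
  proof (rule test_functionsI)
    show "Cn k (\<lambda>x. bump j c d x * (hole j b1 x * hole j b2 x))" for k
      by (intro Cn_mult Cn_bump Cn_hole)
    have "closed {x. \<delta> \<le> \<bar>x - b\<bar>}" for b by (intro closed_Collect_le continuous_intros)
    then show "compact ?K" by (intro compact_Int_closed compact_Icc)
    show "?K \<subseteq> S - {b1, b2}"
    proof
      fix x assume x: "x \<in> ?K"
      then have "x \<in> {c<..<d}" "x \<noteq> b1" "x \<noteq> b2" using \<delta> by auto
      then show "x \<in> S - {b1, b2}" using assms(2) by blast
    qed
    fix x assume "x \<notin> ?K"
    then have "x - c \<le> \<delta> \<or> d - x \<le> \<delta> \<or> \<bar>x - b1\<bar> \<le> \<delta> \<or> \<bar>x - b2\<bar> \<le> \<delta>" by auto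
    then have "bump j c d x = 0 \<or> hole j b1 x = 0 \<or> hole j b2 x = 0"
      using bump_eq_0[of x c j d] hole_eq_0[of x b1 j] hole_eq_0[of x b2 j] assms(1)
      unfolding \<delta>_def by blast
    then show "bump j c d x * (hole j b1 x * hole j b2 x) = 0" by auto
  qed
qed

section \<open>Weak derivatives and the energy space\<close>

lemma AE_I_neq: "AE x in I_meas. x \<noteq> b"
proof -
  have "AE x in lebesgue. x \<noteq> b" by (rule AE_completion) (rule AE_lborel_singleton)
  then have "AE x in lebesgue. x \<in> I_dom \<longrightarrow> x \<noteq> b" by eventually_elim simp
  then show ?thesis by (subst AE_restrict_space_iff) simp_all
qed

text \<open>Dominated convergence along products of bumps and holes: the bound 4 is 1 for the bump
  times 2 for each hole, and the two exceptional points are null. \<open>Suc j\<close> excludes the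
  index 0.\<close>

lemma integral_indicator_eq_0:
  assumes v: "v \<in> L2"
    and test: "\<And>\<phi>. \<phi> \<in> test_functions (I_dom - {b1, b2}) \<Longrightarrow> L2_inner v \<phi> = 0"
    and cd: "- pi \<le> c" "d \<le> pi"
  shows "(\<integral>x. v x * indicator {c<..<d} x \<partial>I_meas) = 0"
proof -
  define \<phi> where "\<phi> j x = bump (Suc j) c d x * (hole (Suc j) b1 x * hole (Suc j) b2 x)" for j x
  have sub: "{c<..<d} \<subseteq> I_dom"
    using cd by (simp add: greaterThanLessThan_subseteq_greaterThanLessThan)
  have \<phi>: "\<phi> j \<in> test_functions (I_dom - {b1, b2})" for j
    unfolding \<phi>_def by (rule test_functions_bump_hole[OF _ sub]) simp
  have \<phi>_meas: "\<phi> j \<in> borel_measurable I_meas" for j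
    by (rule L2_measurable[OF test_functions_L2[OF \<phi>]])
  have "(\<lambda>j. \<integral>x. v x * \<phi> j x \<partial>I_meas) \<longlonglongrightarrow> (\<integral>x. v x * indicator {c<..<d} x \<partial>I_meas)"
  proof (rule integral_dominated_convergence[where w = "\<lambda>x. 4 * \<bar>v x\<bar>"])
    have "indicator {c<..<d} \<in> borel_measurable I_meas"
      by (rule measurable_restrict_space1[OF borel_measurable_indicator]) simp
    then show "(\<lambda>x. v x * indicator {c<..<d} x) \<in> borel_measurable I_meas"
      by (rule borel_measurable_times[OF L2_measurable[OF v]])
    show "(\<lambda>x. v x * \<phi> j x) \<in> borel_measurable I_meas" for j
      by (rule borel_measurable_times[OF L2_measurable[OF v] \<phi>_meas])
    show "integrable I_meas (\<lambda>x. 4 * \<bar>v x\<bar>)"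
      using L2_integrable[OF v] by simp
    show "AE x in I_meas. (\<lambda>j. v x * \<phi> j x) \<longlonglongrightarrow> v x * indicator {c<..<d} x"
      using AE_I_neq[of b1] AE_I_neq[of b2]
    proof eventually_elim
      case (elim x)
      have "(\<lambda>j. \<phi> j x) \<longlonglongrightarrow> indicator {c<..<d} x * (1 * 1)"
        unfolding \<phi>_def
        by (intro tendsto_mult LIMSEQ_Suc tendsto_bump tendsto_hole elim)
      then show ?case by (simp add: tendsto_mult_left)
    qed
    show "AE x in I_meas. norm (v x * \<phi> j x) \<le> 4 * \<bar>v x\<bar>" for j
    proof (rule AE_I2)
      fix x
      have "\<bar>\<phi> j x\<bar> \<le> 1 * (2 * 2)"
        unfolding \<phi>_def abs_mult
        by (intro mult_mono) (use bump_bounds hole_bounds in \<open>auto simp: abs_of_nonneg\<close>)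
      then have "\<bar>v x\<bar> * \<bar>\<phi> j x\<bar> \<le> \<bar>v x\<bar> * 4" by (intro mult_left_mono) auto
      then show "norm (v x * \<phi> j x) \<le> 4 * \<bar>v x\<bar>" by (simp add: abs_mult)
    qed
  qed
  moreover have "(\<integral>x. v x * \<phi> j x \<partial>I_meas) = 0" for j
    using test[OF \<phi>] by (simp add: L2_inner_def)
  ultimately show ?thesis by (simp add: LIMSEQ_const_iff)
qed

text \<open>The Borel sets over which \<open>f\<close> integrates to 0 include the open intervals,
  an intersection-stable generator; they are closed under complements, thanks to \<open>all\<close>,
  and under disjoint countable unions.\<close>

lemma density_zero_lborel:
  fixes f :: "real \<Rightarrow> real"
  assumes f: "integrable lborel f"
    and ivl: "\<And>c d. (\<integral>x. indicator {c<..<d} x * f x \<partial>lborel) = 0"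
    and all: "(\<integral>x. f x \<partial>lborel) = 0"
  shows "AE x in lborel. f x = 0"
proof -
  have sets_eq: "sets (borel :: real measure) = sigma_sets UNIV (range (\<lambda>(a, b). {a<..<b}))"
    by (subst borel_eq_box) (simp add: case_prod_unfold box_real)
  show ?thesis
  proof (rule sigma_finite_measure.density_zero[OF sigma_finite_lborel f])
    fix A :: "real set" assume "A \<in> sets lborel"
    then have A: "A \<in> sigma_sets UNIV (range (\<lambda>(a, b). {a<..<b::real}))"
      by (simp add: sets_eq)
    have stable: "Int_stable (range (\<lambda>(a, b). {a<..<b::real}))"
      by (auto simp: Int_stable_def)
    have sub: "range (\<lambda>(a, b). {a<..<b::real}) \<subseteq> Pow UNIV" by simp
    from stable sub A show "set_lebesgue_integral lborel A f = 0"
    proof (induction rule: sigma_sets_induct_disjoint)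
      case (basic A)
      then show ?case using ivl by (auto simp: set_lebesgue_integral_def)
    next
      case (compl A)
      then have A: "A \<in> sets lborel" by (simp add: sets_eq)
      have "(\<integral>x. indicator (UNIV - A) x *\<^sub>R f x \<partial>lborel) = (\<integral>x. f x - indicator A x *\<^sub>R f x \<partial>lborel)"
        by (rule Bochner_Integration.integral_cong) (auto simp: indicator_def)
      also have "\<dots> = (\<integral>x. f x \<partial>lborel) - (\<integral>x. indicator A x *\<^sub>R f x \<partial>lborel)"
        by (intro Bochner_Integration.integral_diff f integrable_mult_indicator A)
      finally show ?case using compl all by (simp add: set_lebesgue_integral_def)
    next
      case (union A)
      then have A: "A i \<in> sets lborel" for i by (auto simp: sets_eq)
      have "set_integrable lborel (\<Union>i. A i) f"
        unfolding set_integrable_def using A by (intro integrable_mult_indicator f sets.countable_UN) auto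
      moreover have "A i \<inter> A j = {}" if "i \<noteq> j" for i j
        using union(1) that by (auto simp: disjoint_family_on_def)
      ultimately show ?case using union A by (subst lebesgue_integral_countable_add) auto
    qed (simp_all add: set_lebesgue_integral_def)
  qed
qed

text \<open>The fundamental lemma of the calculus of variations, for test functions that avoid two
  points. The generator argument concerns Borel sets, so \<open>v\<close> is extended by 0 to the
  line and replaced by a Borel representative.\<close>

lemma fundamental_lemma:
  assumes v: "v \<in> L2"
    and test: "\<And>\<phi>. \<phi> \<in> test_functions (I_dom - {b1, b2}) \<Longrightarrow> L2_inner v \<phi> = 0"
  shows "AE x in I_meas. v x = 0"
proof -
  define v1 where "v1 x = indicator I_dom x * v x" for x
  have I_sets: "I_dom \<inter> space lebesgue \<in> sets lebesgue" by simp
  have v1: "integrable lebesgue v1"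
    using L2_integrable[OF v] integrable_restrict_space[OF I_sets, of v] by (simp add: v1_def[abs_def])
  obtain v' where v': "v' \<in> borel_measurable lborel" "AE x in lborel. v1 x = v' x"
    using completion_ex_borel_measurable_real[OF borel_measurable_integrable[OF v1]] by blast
  have AE_eq: "AE x in lebesgue. v1 x = v' x" by (rule AE_completion) (rule v'(2))
  have v'_meas: "v' \<in> borel_measurable lebesgue" using v'(1) by (rule measurable_completion)
  have "integrable lebesgue v'"
    using v1 integrable_cong_AE[OF borel_measurable_integrable[OF v1] v'_meas AE_eq] by simp
  then have v'_int: "integrable lborel v'" using integrable_completion[OF v'(1)] by simp
  have ivl: "(\<integral>x. indicator {c<..<d} x * v' x \<partial>lborel) = 0" for c d
  proof -
    have ind: "(\<lambda>x. indicator {c<..<d} x * v' x) \<in> borel_measurable lborel"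
      using v'(1) by (intro borel_measurable_times) auto
    have "(\<integral>x. indicator {c<..<d} x * v' x \<partial>lborel) = (\<integral>x. indicator {c<..<d} x * v' x \<partial>lebesgue)"
      by (rule integral_completion[OF ind, symmetric])
    also have "\<dots> = (\<integral>x. indicator {c<..<d} x * v1 x \<partial>lebesgue)"
    proof (rule integral_cong_AE)
      show "(\<lambda>x. indicator {c<..<d} x * v' x) \<in> borel_measurable lebesgue"
        using ind by (rule measurable_completion)
      show "(\<lambda>x. indicator {c<..<d} x * v1 x) \<in> borel_measurable lebesgue"
        by (intro borel_measurable_times borel_measurable_integrable[OF v1] borel_measurable_indicator) simp
      show "AE x in lebesgue. indicator {c<..<d} x * v' x = indicator {c<..<d} x * v1 x"
        using AE_eq by eventually_elim simp
    qed
    also have "\<dots> = (\<integral>x. indicator I_dom x *\<^sub>R (v x * indicator {max c (- pi)<..<min d pi} x) \<partial>lebesgue)"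
      by (rule Bochner_Integration.integral_cong) (auto simp: v1_def indicator_def)
    also have "\<dots> = (\<integral>x. v x * indicator {max c (- pi)<..<min d pi} x \<partial>I_meas)"
      by (rule integral_restrict_space[OF I_sets, symmetric])
    also have "\<dots> = 0" by (rule integral_indicator_eq_0[OF v test]) auto
    finally show ?thesis .
  qed
  have "(\<integral>x. v' x \<partial>lborel) = (\<integral>x. indicator {- pi<..<pi} x * v' x \<partial>lborel)"
  proof (rule integral_cong_AE)
    show "(\<lambda>x. indicator {- pi<..<pi} x * v' x) \<in> borel_measurable lborel"
      using v'(1) by (intro borel_measurable_times) auto
    show "AE x in lborel. v' x = indicator {- pi<..<pi} x * v' x"
      using v'(2)
    proof eventually_elim
      case (elim x)
      then have "v' x = indicator I_dom x * v x" by (simp add: v1_def)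
      then show ?case by (simp add: indicator_def)
    qed
  qed (rule v'(1))
  then have "AE x in lborel. v' x = 0" by (intro density_zero_lborel v'_int) (simp_all add: ivl)
  then have "AE x in lebesgue. v' x = 0" by (rule AE_completion)
  with AE_eq have "AE x in lebesgue. x \<in> I_dom \<longrightarrow> v x = 0"
    by eventually_elim (auto simp: v1_def indicator_def)
  then show ?thesis by (simp add: AE_restrict_space_iff)
qed

text \<open>Taken at the points of the inner conditions, this shows that the energy space is dense;
  with coinciding points it also yields uniqueness of weak derivatives.\<close>

lemma cls_eq_0I:
  assumes "\<And>\<phi>. \<phi> \<in> test_functions (I_dom - {b1, b2}) \<Longrightarrow> x \<bullet> cls \<phi> = 0"
  shows "x = 0"
proof -
  have "AE t in I_meas. fn x t = 0"
  proof (rule fundamental_lemma[OF fn_L2])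
    fix \<phi> assume "\<phi> \<in> test_functions (I_dom - {b1, b2})"
    then show "L2_inner (fn x) \<phi> = 0"
      using assms[of \<phi>] inner_cls[OF fn_L2 test_functions_L2, of \<phi> _ x] by simp
  qed
  then have "cls (fn x) = cls (\<lambda>x. 0)" by (subst cls_eq_iff) (simp_all add: L2_zero)
  then show ?thesis by (simp add: cls_zero)
qed

section \<open>Primitives of square integrable functions\<close>

definition ind_le :: "real \<Rightarrow> l2" where "ind_le t = cls (indicator {..t})"

text \<open>The integral of \<open>y\<close> from the left end to \<open>t\<close>, written as a
  scalar product with an indicator: continuity in \<open>y\<close> is then immediate, and continuity
  in \<open>t\<close> is that of the indicators.\<close>

definition prim :: "l2 \<Rightarrow> real \<Rightarrow> real" where "prim y t = ind_le t \<bullet> y"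

lemma indicator_L2: "A \<in> sets lebesgue \<Longrightarrow> indicator A \<in> L2"
  by (rule L2_bounded[where C = 1])
    (auto intro: measurable_restrict_space1[OF borel_measurable_indicator] simp: indicator_def)

lemma norm_ind_le_diff: "norm (ind_le t - ind_le s) \<le> sqrt \<bar>t - s\<bar>"
proof (rule real_le_rsqrt)
  let ?A = "{min s t<..max s t}"
  have L: "indicator {..t} \<in> L2" for t :: real by (rule indicator_L2) auto
  have "(norm (ind_le t - ind_le s))\<^sup>2 = (\<integral>x. (indicator {..t} x - indicator {..s} x)\<^sup>2 \<partial>I_meas)"
    unfolding ind_le_def cls_diff[OF L L, symmetric] by (rule norm_cls_power2[OF L2_diff[OF L L]])
  also have "\<dots> = (\<integral>x. indicator I_dom x *\<^sub>R (indicator {..t} x - indicator {..s} x)\<^sup>2 \<partial>lebesgue)"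
    by (rule integral_restrict_space) simp
  also have "\<dots> = (\<integral>x. indicator (I_dom \<inter> ?A) x \<partial>lebesgue)"
    by (rule Bochner_Integration.integral_cong) (auto simp: indicator_def)
  also have "\<dots> = measure lebesgue (I_dom \<inter> ?A)" by simp
  also have "\<dots> \<le> measure lebesgue ?A"
    by (intro measure_mono_fmeasurable) (auto simp: fmeasurableI)
  also have "\<dots> = \<bar>t - s\<bar>" by (simp add: max_def min_def)
  finally show "(norm (ind_le t - ind_le s))\<^sup>2 \<le> \<bar>t - s\<bar>" .
qed

lemma ind_le_0: "t \<le> - pi \<Longrightarrow> ind_le t = 0"
proof -
  assume t: "t \<le> - pi"
  have "cls (indicator {..t}) = cls (\<lambda>x. 0)"
  proof (subst cls_eq_iff)
    show "AE x in I_meas. indicator {..t} x = (0 :: real)"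
    proof (rule AE_I2)
      fix x assume "x \<in> space I_meas"
      then have "\<not> x \<le> t" using t by auto
      then show "indicator {..t} x = (0 :: real)" by simp
    qed
  qed (simp_all add: indicator_L2 L2_zero)
  then show ?thesis by (simp add: ind_le_def cls_zero)
qed

text \<open>Hoelder continuity with exponent 1/2, by Cauchy-Schwarz. The modulus depends on
  \<open>y\<close> through its norm only, which later gives equicontinuity.\<close>

lemma prim_diff_le: "\<bar>prim y t - prim y s\<bar> \<le> sqrt \<bar>t - s\<bar> * norm y"
proof -
  have "\<bar>prim y t - prim y s\<bar> = \<bar>(ind_le t - ind_le s) \<bullet> y\<bar>"
    by (simp add: prim_def inner_diff_left)
  also have "\<dots> \<le> norm (ind_le t - ind_le s) * norm y" by (rule Cauchy_Schwarz_ineq2)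
  also have "\<dots> \<le> sqrt \<bar>t - s\<bar> * norm y" by (intro mult_right_mono norm_ind_le_diff) simp
  finally show ?thesis .
qed

lemma prim_le: "t \<in> I_dom \<Longrightarrow> \<bar>prim y t\<bar> \<le> sqrt (2 * pi) * norm y"
proof -
  assume t: "t \<in> I_dom"
  have "\<bar>prim y t\<bar> \<le> sqrt \<bar>t - (- pi)\<bar> * norm y"
    using prim_diff_le[of y t "- pi"] by (simp add: prim_def ind_le_0)
  also have "\<dots> \<le> sqrt (2 * pi) * norm y" using t by (intro mult_right_mono) auto
  finally show ?thesis .
qed

lemma continuous_on_prim: "continuous_on A (prim y)"
proof -
  have "isCont (prim y) s" for s
    unfolding isCont_def
  proof (rule LIM_zero_cancel, rule Lim_null_comparison)
    show "eventually (\<lambda>t. norm (prim y t - prim y s) \<le> sqrt \<bar>t - s\<bar> * norm y) (at s)"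
      by (simp add: prim_diff_le)
    have "((\<lambda>t. sqrt \<bar>t - s\<bar> * norm y) \<longlongrightarrow> sqrt \<bar>s - s\<bar> * norm y) (at s)" by (intro tendsto_intros)
    then show "((\<lambda>t. sqrt \<bar>t - s\<bar> * norm y) \<longlongrightarrow> 0) (at s)" by simp
  qed
  then show ?thesis by (simp add: continuous_at_imp_continuous_on)
qed

lemma prim_L2: "prim y \<in> L2"
proof -
  have m: "prim y \<in> borel_measurable I_meas" by (rule continuous_measurable_I[OF continuous_on_prim])
  have "integrable I_meas (\<lambda>x. (prim y x)\<^sup>2)"
  proof (rule I.integrable_const_bound[where B = "(sqrt (2 * pi) * norm y)\<^sup>2"])
    show "AE x in I_meas. norm ((prim y x)\<^sup>2) \<le> (sqrt (2 * pi) * norm y)\<^sup>2"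
    proof (rule AE_I2)
      fix x assume "x \<in> space I_meas"
      then have "\<bar>prim y x\<bar>\<^sup>2 \<le> (sqrt (2 * pi) * norm y)\<^sup>2" by (intro power_mono prim_le) auto
      then show "norm ((prim y x)\<^sup>2) \<le> (sqrt (2 * pi) * norm y)\<^sup>2" by simp
    qed
  qed (intro borel_measurable_power m)
  then show ?thesis by (simp add: L2_def m)
qed

lemma prim_add: "prim (y + z) t = prim y t + prim z t"
  and prim_scaleR: "prim (c *\<^sub>R y) t = c * prim y t"
  and prim_diff: "prim (y - z) t = prim y t - prim z t"
  by (simp_all add: prim_def inner_add_right inner_diff_right)

lemma norm_cls_prim: "norm (cls (prim y)) \<le> 2 * pi * norm y"
proof -
  have "norm (cls (prim y)) \<le> (sqrt (2 * pi) * norm y) * sqrt (2 * pi)"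
    by (rule norm_cls_le_bound[OF prim_L2]) (auto intro!: AE_I2 prim_le)
  also have "\<dots> = (sqrt (2 * pi))\<^sup>2 * norm y" by (simp only: power2_eq_square mult_ac)
  finally show ?thesis by simp
qed

lemma bounded_linear_cls_prim: "bounded_linear (\<lambda>y. cls (prim y))"
proof (rule bounded_linear_intro[where K = "2 * pi"])
  show "cls (prim (y + z)) = cls (prim y) + cls (prim z)" for y z
    by (simp add: cls_add[OF prim_L2 prim_L2, symmetric] prim_add[abs_def])
  show "cls (prim (c *\<^sub>R y)) = c *\<^sub>R cls (prim y)" for c y
    by (simp add: cls_scale[OF prim_L2, symmetric] prim_scaleR[abs_def])
  show "norm (cls (prim y)) \<le> norm y * (2 * pi)" for y
    using norm_cls_prim[of y] by (simp add: mult.commute)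
qed

lemma integral_test_derivative:
  assumes \<phi>: "\<phi> \<in> test_functions I_dom"
  shows "(\<integral>x. indicator {..t} x * deriv \<phi> x \<partial>I_meas) = \<phi> t"
proof -
  \<comment> \<open>For \<open>t\<close> left of \<open>- pi\<close> the interval degenerates to a
    point, and beyond \<open>pi\<close> the test function contributes nothing, so one formula serves
    every real \<open>t\<close>.\<close>
  define s where "s = max (- pi) t"
  have d\<phi>: "deriv \<phi> \<in> test_functions I_dom" by (rule test_functions_deriv[OF \<phi>])
  have "(\<integral>x. indicator {..t} x * deriv \<phi> x \<partial>I_meas)
      = (\<integral>x. indicator I_dom x *\<^sub>R (indicator {..t} x * deriv \<phi> x) \<partial>lebesgue)"
    by (rule integral_restrict_space) simp
  also have "\<dots> = (\<integral>x. indicator {- pi..s} x *\<^sub>R deriv \<phi> x \<partial>lebesgue)"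
    by (rule Bochner_Integration.integral_cong)
      (auto simp: indicator_def s_def max_def test_functions_eq_0[OF d\<phi>])
  also have "\<dots> = (\<integral>x. deriv \<phi> x \<partial>lebesgue_on {- pi..s})"
    by (rule integral_restrict_space[symmetric]) simp
  also have "\<dots> = integral {- pi..s} (deriv \<phi>)"
  proof (rule lebesgue_integral_eq_integral)
    show "integrable (lebesgue_on {- pi..s}) (deriv \<phi>)"
      by (rule continuous_imp_integrable_real) (rule test_functions_continuous[OF d\<phi>])
  qed simp
  also have "\<dots> = \<phi> s - \<phi> (- pi)"
  proof (intro integral_unique fundamental_theorem_of_calculus)
    show "- pi \<le> s" by (simp add: s_def)
    fix x
    show "(\<phi> has_vector_derivative deriv \<phi> x) (at x within {- pi..s})"
      using has_field_derivative_at_within[OF test_functions_has_derivative[OF \<phi>]]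
      by (simp add: has_real_derivative_iff_has_vector_derivative)
  qed
  also have "\<dots> = \<phi> t"
    by (simp add: s_def max_def test_functions_eq_0[OF \<phi>])
  finally show ?thesis .
qed

lemma prim_test:
  assumes \<phi>: "\<phi> \<in> test_functions I_dom"
  shows "prim (cls (deriv \<phi>)) t = \<phi> t"
  unfolding prim_def ind_le_def
  by (subst inner_cls)
    (simp_all add: indicator_L2 test_functions_L2[OF test_functions_deriv[OF \<phi>]] L2_inner_def
      integral_test_derivative[OF \<phi>])

section \<open>Weak derivatives as closed subspaces of pairs\<close>

lemma test_functions_add:
  assumes "\<phi> \<in> test_functions S" "\<psi> \<in> test_functions S"
  shows "(\<lambda>x. \<phi> x + \<psi> x) \<in> test_functions S"
proof (rule test_functionsI)
  let ?K = "closure {x. \<phi> x \<noteq> 0} \<union> closure {x. \<psi> x \<noteq> 0}"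
  show "Cn k (\<lambda>x. \<phi> x + \<psi> x)" for k by (intro Cn_add test_functions_Cn[OF assms(1)] test_functions_Cn[OF assms(2)])
  show "compact ?K" "?K \<subseteq> S" using assms by (simp_all add: test_functions_def compact_Un)
  fix x assume x: "x \<notin> ?K"
  then have "x \<notin> {x. \<phi> x \<noteq> 0}" "x \<notin> {x. \<psi> x \<noteq> 0}"
    using closure_subset[of "{x. \<phi> x \<noteq> 0}"] closure_subset[of "{x. \<psi> x \<noteq> 0}"] by blast+
  then show "\<phi> x + \<psi> x = 0" by simp
qed

lemma test_functions_scale:
  assumes "\<phi> \<in> test_functions S"
  shows "(\<lambda>x. c * \<phi> x) \<in> test_functions S"
proof (rule test_functionsI)
  let ?K = "closure {x. \<phi> x \<noteq> 0}"
  show "Cn k (\<lambda>x. c * \<phi> x)" for k by (intro Cn_mult Cn_const test_functions_Cn[OF assms])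
  show "compact ?K" "?K \<subseteq> S" using assms by (simp_all add: test_functions_def)
  fix x assume x: "x \<notin> ?K"
  then have "x \<notin> {x. \<phi> x \<noteq> 0}" using closure_subset[of "{x. \<phi> x \<noteq> 0}"] by blast
  then show "c * \<phi> x = 0" by simp
qed

lemma deriv_test_add:
  "\<phi> \<in> test_functions S \<Longrightarrow> \<psi> \<in> test_functions S \<Longrightarrow> deriv (\<lambda>x. \<phi> x + \<psi> x) = (\<lambda>x. deriv \<phi> x + deriv \<psi> x)"
  by (intro ext DERIV_imp_deriv DERIV_add test_functions_has_derivative)

lemma deriv_test_scale:
  "\<phi> \<in> test_functions S \<Longrightarrow> deriv (\<lambda>x. c * \<phi> x) = (\<lambda>x. c * deriv \<phi> x)"
  by (intro ext DERIV_imp_deriv DERIV_cmult test_functions_has_derivative)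

lemma test_parts:
  assumes \<phi>: "\<phi> \<in> test_functions I_dom" and \<psi>: "\<psi> \<in> test_functions I_dom"
  shows "cls \<phi> \<bullet> cls (deriv \<psi>) = - (cls (deriv \<phi>) \<bullet> cls \<psi>)"
proof -
  note L = test_functions_L2[OF \<phi>] test_functions_L2[OF \<psi>]
    test_functions_L2[OF test_functions_deriv[OF \<phi>]] test_functions_L2[OF test_functions_deriv[OF \<psi>]]
  note c = test_functions_continuous[OF \<phi>] test_functions_continuous[OF \<psi>]
    test_functions_continuous[OF test_functions_deriv[OF \<phi>]] test_functions_continuous[OF test_functions_deriv[OF \<psi>]]
  let ?f = "\<lambda>x. \<phi> x * deriv \<psi> x + deriv \<phi> x * \<psi> x"
  have "cls \<phi> \<bullet> cls (deriv \<psi>) + cls (deriv \<phi>) \<bullet> cls \<psi> = (\<integral>x. ?f x \<partial>I_meas)"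
    unfolding inner_cls[OF L(1) L(4)] inner_cls[OF L(3) L(2)] L2_inner_def
    by (rule Bochner_Integration.integral_add[symmetric])
      (rule L2_mult_integrable[OF L(1) L(4)], rule L2_mult_integrable[OF L(3) L(2)])
  also have "\<dots> = integral I_dom ?f"
    by (intro lebesgue_integral_eq_integral Bochner_Integration.integrable_add
        L2_mult_integrable[OF L(1) L(4)] L2_mult_integrable[OF L(3) L(2)]) simp
  also have "\<dots> = integral {- pi..pi} ?f" by (rule integral_open_interval_real[symmetric])
  also have "\<dots> = \<phi> pi * \<psi> pi - \<phi> (- pi) * \<psi> (- pi)"
  proof (intro integral_unique fundamental_theorem_of_calculus)
    fix x
    have "((\<lambda>x. \<phi> x * \<psi> x) has_real_derivative deriv \<phi> x * \<psi> x + deriv \<psi> x * \<phi> x) (at x within {- pi..pi})"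
      by (rule has_field_derivative_at_within)
        (rule DERIV_mult[OF test_functions_has_derivative[OF \<phi>] test_functions_has_derivative[OF \<psi>]])
    then show "((\<lambda>x. \<phi> x * \<psi> x) has_vector_derivative ?f x) (at x within {- pi..pi})"
      by (simp add: has_real_derivative_iff_has_vector_derivative algebra_simps)
  qed simp
  also have "\<dots> = 0" by (simp add: test_functions_eq_0[OF \<phi>])
  finally show ?thesis by simp
qed

text \<open>The graph of weak differentiation on classes. As a relation it requires no choice of a
  derivative, and its closedness is read off from the defining equations, each continuous in the
  pair.\<close>

definition wd :: "(l2 \<times> l2) set" where
  "wd = {p. \<forall>\<phi>\<in>test_functions I_dom. fst p \<bullet> cls (deriv \<phi>) = - (snd p \<bullet> cls \<phi>)}"

definition wd_test :: "(l2 \<times> l2) set" where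
  "wd_test = (\<lambda>\<phi>. (cls \<phi>, cls (deriv \<phi>))) ` test_functions I_dom"

text \<open>The graph of differentiation on \<open>H1_0\<close>: the product norm of a pair in
  \<open>wd\<close> is the \<open>H1\<close> norm of its first component, so this is the closure
  that defines \<open>H1_0\<close>.\<close>

definition wd0 :: "(l2 \<times> l2) set" where
  "wd0 = closure wd_test"

lemma subspace_wd: "subspace wd"
  by (auto simp: subspace_def wd_def inner_add_left)

lemma closed_wd: "closed wd"
proof -
  have eq: "wd = (\<Inter>\<phi>\<in>test_functions I_dom. {p. fst p \<bullet> cls (deriv \<phi>) = - (snd p \<bullet> cls \<phi>)})"
    by (auto simp: wd_def)
  show ?thesis
    unfolding eq by (intro closed_INT ballI closed_Collect_eq continuous_intros)
qed

lemma wd_test_subset: "wd_test \<subseteq> wd"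
  by (auto simp: wd_test_def wd_def test_parts)

lemma wd0_subset: "wd0 \<subseteq> wd"
  unfolding wd0_def by (rule closure_minimal[OF wd_test_subset closed_wd])

lemma subspace_wd_test: "subspace wd_test"
proof (rule subspaceI)
  have "(\<lambda>x. 0) \<in> test_functions I_dom"
    by (rule test_functionsI[where K = "{}"]) (simp_all add: Cn_const)
  then have "(cls (\<lambda>x. 0), cls (deriv (\<lambda>x. 0))) \<in> wd_test" unfolding wd_test_def by (rule imageI)
  then show "0 \<in> wd_test" by (simp add: cls_zero zero_prod_def)
next
  fix p q assume "p \<in> wd_test" "q \<in> wd_test"
  then obtain \<phi> \<psi> where t: "\<phi> \<in> test_functions I_dom" "\<psi> \<in> test_functions I_dom"
    and pq: "p = (cls \<phi>, cls (deriv \<phi>))" "q = (cls \<psi>, cls (deriv \<psi>))" by (auto simp: wd_test_def)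
  have "p + q = (cls (\<lambda>x. \<phi> x + \<psi> x), cls (deriv (\<lambda>x. \<phi> x + \<psi> x)))"
    using t by (simp add: pq deriv_test_add cls_add test_functions_L2 test_functions_deriv
        test_functions_L2[OF test_functions_deriv])
  then show "p + q \<in> wd_test" unfolding wd_test_def using test_functions_add[OF t] by blast
next
  fix p and c :: real assume "p \<in> wd_test"
  then obtain \<phi> where t: "\<phi> \<in> test_functions I_dom"
    and p: "p = (cls \<phi>, cls (deriv \<phi>))" by (auto simp: wd_test_def)
  have "c *\<^sub>R p = (cls (\<lambda>x. c * \<phi> x), cls (deriv (\<lambda>x. c * \<phi> x)))"
    using t by (simp add: p deriv_test_scale[OF t] cls_scale test_functions_L2[OF t]
        test_functions_L2[OF test_functions_deriv[OF t]])
  then show "c *\<^sub>R p \<in> wd_test" unfolding wd_test_def using test_functions_scale[OF t] by blast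
qed

lemma subspace_closure_normed:
  fixes S :: "'a::real_normed_vector set"
  assumes S: "subspace S"
  shows "subspace (closure S)"
proof (rule subspaceI)
  show "0 \<in> closure S" by (rule subsetD[OF closure_subset subspace_0[OF S]])
next
  fix x y assume "x \<in> closure S" "y \<in> closure S"
  then obtain X Y where "\<And>n. X n \<in> S" "X \<longlonglongrightarrow> x" "\<And>n. Y n \<in> S" "Y \<longlonglongrightarrow> y"
    unfolding closure_sequential by blast
  then have "\<forall>n. X n + Y n \<in> S" "(\<lambda>n. X n + Y n) \<longlonglongrightarrow> x + y"
    using subspace_add[OF S] by (auto intro: tendsto_add)
  then show "x + y \<in> closure S"
    unfolding closure_sequential by (intro exI[of _ "\<lambda>n. X n + Y n"] conjI)
next
  fix x and c :: real assume "x \<in> closure S"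
  then obtain X where "\<And>n. X n \<in> S" "X \<longlonglongrightarrow> x" unfolding closure_sequential by blast
  then have "\<forall>n. c *\<^sub>R X n \<in> S" "(\<lambda>n. c *\<^sub>R X n) \<longlonglongrightarrow> c *\<^sub>R x"
    using subspace_scale[OF S] by (auto intro: tendsto_scaleR)
  then show "c *\<^sub>R x \<in> closure S"
    unfolding closure_sequential by (intro exI[of _ "\<lambda>n. c *\<^sub>R X n"] conjI)
qed

lemma subspace_wd0: "subspace wd0"
  unfolding wd0_def by (rule subspace_closure_normed[OF subspace_wd_test])

lemma wd_unique: "(x, y) \<in> wd \<Longrightarrow> (x, z) \<in> wd \<Longrightarrow> y = z"
proof -
  assume "(x, y) \<in> wd" "(x, z) \<in> wd"
  then have "(y - z) \<bullet> cls \<phi> = 0" if "\<phi> \<in> test_functions I_dom" for \<phi>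
    using that by (auto simp: wd_def inner_diff_left)
  moreover have "test_functions (I_dom - {0, 0}) \<subseteq> test_functions I_dom"
    by (rule test_functions_mono) auto
  ultimately have "y - z = 0"
    by (intro cls_eq_0I[where ?b1.0 = 0 and ?b2.0 = 0]) blast
  then show "y = z" by simp
qed

text \<open>Both sides are continuous in the pair, so the identity passes from test functions to the
  closure. It provides the continuous representative of a function in \<open>H1_0\<close>.\<close>

lemma wd0_prim: "(x, y) \<in> wd0 \<Longrightarrow> x = cls (prim y)"
proof -
  have "wd_test \<subseteq> {p. fst p = cls (prim (snd p))}"
  proof
    fix p assume "p \<in> wd_test"
    then obtain \<phi> where t: "\<phi> \<in> test_functions I_dom" and p: "p = (cls \<phi>, cls (deriv \<phi>))"
      by (auto simp: wd_test_def)
    have "prim (cls (deriv \<phi>)) = \<phi>" by (rule ext) (rule prim_test[OF t])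
    then show "p \<in> {p. fst p = cls (prim (snd p))}" by (simp add: p)
  qed
  moreover have "closed {p :: l2 \<times> l2. fst p = cls (prim (snd p))}"
    by (intro closed_Collect_eq continuous_intros bounded_linear.continuous_on[OF bounded_linear_cls_prim])
  ultimately have "wd0 \<subseteq> {p. fst p = cls (prim (snd p))}" unfolding wd0_def by (rule closure_minimal)
  then show "(x, y) \<in> wd0 \<Longrightarrow> x = cls (prim y)" by auto
qed

text \<open>For a test pair this is the definition of \<open>wd\<close>, and continuity extends it
  to the closure. No boundary term appears because one of the factors vanishes at the ends.\<close>

lemma wd0_parts: "(x, y) \<in> wd0 \<Longrightarrow> (x', y') \<in> wd \<Longrightarrow> x' \<bullet> y = - (y' \<bullet> x)"
proof -
  assume xy': "(x', y') \<in> wd"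
  have "wd_test \<subseteq> {p. x' \<bullet> snd p = - (y' \<bullet> fst p)}"
    using xy' by (auto simp: wd_def wd_test_def)
  moreover have "closed {p. x' \<bullet> snd p = - (y' \<bullet> fst p)}"
    by (intro closed_Collect_eq continuous_intros)
  ultimately have "wd0 \<subseteq> {p. x' \<bullet> snd p = - (y' \<bullet> fst p)}" unfolding wd0_def by (rule closure_minimal)
  then show "(x, y) \<in> wd0 \<Longrightarrow> x' \<bullet> y = - (y' \<bullet> x)" by auto
qed

section \<open>The energy space as a graph\<close>

definition V_rel :: "real \<Rightarrow> l2 \<Rightarrow> l2 \<Rightarrow> l2 \<Rightarrow> bool" where
  "V_rel b x y z \<longleftrightarrow> (x, y) \<in> wd0 \<and> (y, z) \<in> wd \<and> prim y b = 0 \<and> prim y (- b) = 0"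

text \<open>The operator taking \<open>x\<close> to its second derivative \<open>z\<close>. The
  intermediate \<open>y\<close> lies in \<open>wd\<close> without a condition at the ends, so the
  vanishing of the second derivative there is left to the weak form as a natural boundary condition.
  The values of \<open>prim y\<close> at \<open>b\<close> and \<open>- b\<close> are the point
  values of \<open>x\<close>.\<close>

definition V_graph :: "real \<Rightarrow> (l2 \<times> l2) set" where
  "V_graph b = {(x, z). \<exists>y. V_rel b x y z}"

lemma V_rel_diff: "V_rel b x y z \<Longrightarrow> V_rel b x' y' z' \<Longrightarrow> V_rel b (x - x') (y - y') (z - z')"
  using subspace_diff[OF subspace_wd0, of "(x, y)" "(x', y')"] subspace_diff[OF subspace_wd, of "(y, z)" "(y', z')"]
  by (simp add: V_rel_def prim_diff)

text \<open>The first bound is that for primitives. Integration by parts gives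
  \<open>(norm y)\<^sup>2 = - (z \<bullet> x)\<close>, where the first bound splits off a factor
  \<open>norm y\<close>; the third bound composes the other two.\<close>

lemma V_rel_poincare:
  assumes "V_rel b x y z"
  shows "norm x \<le> 2 * pi * norm y" "norm y \<le> 2 * pi * norm z" "norm x \<le> (2 * pi)\<^sup>2 * norm z"
proof -
  have xy: "(x, y) \<in> wd0" and yz: "(y, z) \<in> wd" using assms by (auto simp: V_rel_def)
  show 1: "norm x \<le> 2 * pi * norm y" using norm_cls_prim[of y] wd0_prim[OF xy] by simp
  have "(norm y)\<^sup>2 = - (z \<bullet> x)"
    using wd0_parts[OF xy yz] by (simp add: power2_norm_eq_inner del: dot_square_norm)
  also have "\<dots> \<le> norm z * norm x" using Cauchy_Schwarz_ineq2[of z x] by linarith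
  also have "\<dots> \<le> norm z * (2 * pi * norm y)" by (intro mult_left_mono 1) simp
  finally have "norm y * norm y \<le> (2 * pi * norm z) * norm y" by (simp add: power2_eq_square mult_ac)
  then show 2: "norm y \<le> 2 * pi * norm z"
    by (cases "norm y = 0") (auto simp: mult_le_cancel_right)
  have "norm x \<le> 2 * pi * (2 * pi * norm z)" by (intro order_trans[OF 1] mult_left_mono 2) simp
  then show "norm x \<le> (2 * pi)\<^sup>2 * norm z" by (simp add: power2_eq_square mult_ac)
qed

lemma subspace_V_graph: "subspace (V_graph b)"
proof (rule subspaceI)
  have "V_rel b 0 0 0"
    using subspace_0[OF subspace_wd0] subspace_0[OF subspace_wd] by (simp add: V_rel_def prim_def zero_prod_def)
  then show "0 \<in> V_graph b" by (auto simp: V_graph_def zero_prod_def)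
next
  fix p q assume "p \<in> V_graph b" "q \<in> V_graph b"
  then obtain y y' where "V_rel b (fst p) y (snd p)" "V_rel b (fst q) y' (snd q)" by (auto simp: V_graph_def)
  then have "V_rel b (fst p + fst q) (y + y') (snd p + snd q)"
    using subspace_add[OF subspace_wd0, of "(fst p, y)" "(fst q, y')"] subspace_add[OF subspace_wd, of "(y, snd p)" "(y', snd q)"]
    by (simp add: V_rel_def prim_add)
  then show "p + q \<in> V_graph b" by (cases p, cases q) (auto simp: V_graph_def)
next
  fix p and c :: real assume "p \<in> V_graph b"
  then obtain y where "V_rel b (fst p) y (snd p)" by (auto simp: V_graph_def)
  then have "V_rel b (c *\<^sub>R fst p) (c *\<^sub>R y) (c *\<^sub>R snd p)"
    using subspace_scale[OF subspace_wd0, of "(fst p, y)" c] subspace_scale[OF subspace_wd, of "(y, snd p)" c]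
    by (simp add: V_rel_def prim_scaleR)
  then show "c *\<^sub>R p \<in> V_graph b" by (cases p) (auto simp: V_graph_def)
qed

lemma prim_tendsto: "(Y \<longlongrightarrow> y) F \<Longrightarrow> ((\<lambda>n. prim (Y n) t) \<longlongrightarrow> prim y t) F"
  unfolding prim_def by (intro tendsto_inner tendsto_const)

lemma Cauchy_norm_le:
  fixes X :: "nat \<Rightarrow> 'a::real_normed_vector" and Z :: "nat \<Rightarrow> 'b::real_normed_vector"
  assumes "Cauchy Z" "\<And>m n. norm (X m - X n) \<le> K * norm (Z m - Z n)" "0 < K"
  shows "Cauchy X"
proof (rule metric_CauchyI)
  fix \<epsilon> :: real assume "0 < \<epsilon>"
  then obtain N where N: "\<And>m n. m \<ge> N \<Longrightarrow> n \<ge> N \<Longrightarrow> dist (Z m) (Z n) < \<epsilon> / K"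
    using assms(1,3) unfolding Cauchy_def by (meson divide_pos_pos)
  have "dist (X m) (X n) < \<epsilon>" if "m \<ge> N" "n \<ge> N" for m n
  proof -
    have "norm (X m - X n) \<le> K * norm (Z m - Z n)" by (rule assms(2))
    also have "\<dots> < K * (\<epsilon> / K)" using N[OF that] assms(3) by (intro mult_strict_left_mono) (simp_all add: dist_norm)
    finally show ?thesis using assms(3) by (simp add: dist_norm)
  qed
  then show "\<exists>N. \<forall>m\<ge>N. \<forall>n\<ge>N. dist (X m) (X n) < \<epsilon>" by blast
qed

text \<open>Convergence is given for the outer components only; the Poincare inequality, applied to
  differences, makes the first derivatives Cauchy. Each defining condition is then closed by
  itself.\<close>

lemma closed_V_graph: "closed (V_graph b)"
  unfolding closed_sequential_limits
proof (intro allI impI, elim conjE)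
  fix P p assume P: "\<forall>n. P n \<in> V_graph b" and lim: "P \<longlonglongrightarrow> p"
  have "\<forall>n. \<exists>y. V_rel b (fst (P n)) y (snd (P n))" using P by (auto simp: V_graph_def split_beta)
  then obtain Y where Y: "\<And>n. V_rel b (fst (P n)) (Y n) (snd (P n))" by metis
  have limx: "(\<lambda>n. fst (P n)) \<longlonglongrightarrow> fst p" and limz: "(\<lambda>n. snd (P n)) \<longlonglongrightarrow> snd p"
    using lim by (auto intro: tendsto_fst tendsto_snd)
  have "Cauchy Y"
  proof (rule Cauchy_norm_le)
    show "Cauchy (\<lambda>n. snd (P n))" by (rule LIMSEQ_imp_Cauchy[OF limz])
    show "norm (Y m - Y n) \<le> 2 * pi * norm (snd (P m) - snd (P n))" for m n
      by (rule V_rel_poincare(2)[OF V_rel_diff[OF Y Y]])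
  qed simp
  then obtain y where y: "Y \<longlonglongrightarrow> y" using Cauchy_convergent_iff convergent_def by blast
  have "(fst p, y) \<in> wd0"
  proof (rule closed_sequentially)
    show "closed wd0" by (simp add: wd0_def)
    show "(\<lambda>n. (fst (P n), Y n)) \<longlonglongrightarrow> (fst p, y)" by (rule tendsto_Pair[OF limx y])
    show "(fst (P n), Y n) \<in> wd0" for n using Y[of n] by (simp add: V_rel_def)
  qed
  moreover have "(y, snd p) \<in> wd"
  proof (rule closed_sequentially[OF closed_wd])
    show "(\<lambda>n. (Y n, snd (P n))) \<longlonglongrightarrow> (y, snd p)" by (rule tendsto_Pair[OF y limz])
    show "(Y n, snd (P n)) \<in> wd" for n using Y[of n] by (simp add: V_rel_def)
  qed
  moreover have "prim y b = 0" "prim y (- b) = 0"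
    using prim_tendsto[OF y, of b] prim_tendsto[OF y, of "- b"] Y
    by (simp_all add: V_rel_def LIMSEQ_const_iff)
  ultimately show "p \<in> V_graph b" by (auto simp: V_graph_def V_rel_def split_beta)
qed

text \<open>Rellich's theorem by Arzela-Ascoli: bounded second derivatives bound the first ones,
  whose primitives are uniformly bounded and equicontinuous. Uniform convergence on a bounded
  interval implies convergence in \<open>l2\<close>.\<close>

lemma V_graph_compact:
  assumes X: "\<And>n. X n \<in> V_graph b" and M: "\<And>n. norm (snd (X n)) \<le> M"
  shows "\<exists>r. strict_mono (r :: nat \<Rightarrow> nat) \<and> convergent (\<lambda>n. fst (X (r n)))"
proof -
  have "\<forall>n. \<exists>y. V_rel b (fst (X n)) y (snd (X n))" using X by (auto simp: V_graph_def split_beta)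
  then obtain Y where Y: "\<And>n. V_rel b (fst (X n)) (Y n) (snd (X n))" by metis
  define C where "C = 2 * pi * M"
  have C: "norm (Y n) \<le> C" for n
    unfolding C_def by (rule order_trans[OF V_rel_poincare(2)[OF Y]]) (simp add: M)
  have C0: "0 \<le> C" using order_trans[OF norm_ge_zero C] .
  have prim_bound: "norm (prim (Y n) t) \<le> sqrt (2 * pi) * C" if "t \<in> {- pi..pi}" for n t
  proof -
    have "\<bar>prim (Y n) t\<bar> \<le> sqrt \<bar>t - (- pi)\<bar> * norm (Y n)"
      using prim_diff_le[of "Y n" t "- pi"] by (simp add: prim_def ind_le_0)
    also have "\<dots> \<le> sqrt (2 * pi) * C" using that C0 by (intro mult_mono C) auto
    finally show ?thesis by simp
  qed
  have equi: "\<exists>d>0. \<forall>n t. t \<in> {- pi..pi} \<and> norm (s - t) < d \<longrightarrow> norm (prim (Y n) s - prim (Y n) t) < \<epsilon>"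
    if "0 < \<epsilon>" for s \<epsilon> :: real
  proof (intro exI conjI allI impI)
    \<comment> \<open>Squared because the modulus of continuity is a square root;
      \<open>C + 1\<close> avoids division by 0.\<close>
    let ?d = "(\<epsilon> / (C + 1))\<^sup>2"
    show "0 < ?d" using that C0 by simp
    fix n t assume t: "t \<in> {- pi..pi} \<and> norm (s - t) < ?d"
    have "\<bar>prim (Y n) s - prim (Y n) t\<bar> \<le> sqrt \<bar>s - t\<bar> * norm (Y n)" by (rule prim_diff_le)
    also have "\<dots> \<le> sqrt \<bar>s - t\<bar> * (C + 1)" using C[of n] by (intro mult_left_mono) auto
    also have "\<dots> < \<epsilon> / (C + 1) * (C + 1)"
    proof (rule mult_strict_right_mono)
      have "sqrt \<bar>s - t\<bar> < sqrt ?d" using t by (intro real_sqrt_less_mono) simp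
      then show "sqrt \<bar>s - t\<bar> < \<epsilon> / (C + 1)" using that C0 by simp
    qed (use C0 in simp)
    finally show "norm (prim (Y n) s - prim (Y n) t) < \<epsilon>" using C0 by simp
  qed
  obtain g k where k: "strict_mono (k :: nat \<Rightarrow> nat)"
    and g: "\<And>\<epsilon>. 0 < \<epsilon> \<Longrightarrow> \<exists>N. \<forall>n t. n \<ge> N \<and> t \<in> {- pi..pi} \<longrightarrow> norm (prim (Y (k n)) t - g t) < \<epsilon>"
    by (rule Arzela_Ascoli[where S = "{- pi..pi}" and \<F> = "\<lambda>n. prim (Y n)", OF compact_Icc prim_bound])
      (use equi in blast)+
  have x: "fst (X n) = cls (prim (Y n))" for n using Y[of n] by (simp add: V_rel_def wd0_prim)
  have "Cauchy (\<lambda>n. fst (X (k n)))"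
  proof (rule metric_CauchyI)
    fix \<epsilon> :: real assume \<epsilon>: "0 < \<epsilon>"
    \<comment> \<open>Two functions within \<open>\<delta>\<close> of the common limit differ by at
      most \<open>2 * \<delta>\<close>, which makes half of \<open>\<epsilon>\<close> in norm after
      multiplication by \<open>sqrt (2 * pi)\<close>.\<close>
    define \<delta> where "\<delta> = \<epsilon> / (4 * sqrt (2 * pi))"
    have \<delta>: "0 < \<delta>" using \<epsilon> by (simp add: \<delta>_def)
    then obtain N where N: "\<And>n t. n \<ge> N \<Longrightarrow> t \<in> {- pi..pi} \<Longrightarrow> norm (prim (Y (k n)) t - g t) < \<delta>"
      using g by blast
    have "dist (fst (X (k m))) (fst (X (k n))) < \<epsilon>" if mn: "m \<ge> N" "n \<ge> N" for m n
    proof -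
      have "AE t in I_meas. \<bar>prim (Y (k m)) t - prim (Y (k n)) t\<bar> \<le> 2 * \<delta>"
      proof (rule AE_I2)
        fix t assume "t \<in> space I_meas"
        then have "t \<in> {- pi..pi}" by auto
        from N[OF mn(1) this] N[OF mn(2) this]
        show "\<bar>prim (Y (k m)) t - prim (Y (k n)) t\<bar> \<le> 2 * \<delta>" by simp
      qed
      then have "norm (cls (\<lambda>t. prim (Y (k m)) t - prim (Y (k n)) t)) \<le> 2 * \<delta> * sqrt (2 * pi)"
        using \<delta> by (intro norm_cls_le_bound L2_diff prim_L2) auto
      then show ?thesis using \<epsilon> by (simp add: dist_norm x cls_diff prim_L2 \<delta>_def)
    qed
    then show "\<exists>N. \<forall>m\<ge>N. \<forall>n\<ge>N. dist (fst (X (k m))) (fst (X (k n))) < \<epsilon>" by blast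
  qed
  then show ?thesis using k Cauchy_convergent_iff by blast
qed

text \<open>The source of the density of the domain: a test function vanishing near both points
  meets the point conditions trivially.\<close>

lemma V_graph_test:
  assumes \<phi>: "\<phi> \<in> test_functions (I_dom - {b, - b})"
  shows "(cls \<phi>, cls (deriv (deriv \<phi>))) \<in> V_graph b"
proof -
  have t: "\<phi> \<in> test_functions I_dom" using \<phi> test_functions_mono[of "I_dom - {b, - b}" I_dom] by auto
  have "(cls \<phi>, cls (deriv \<phi>)) \<in> wd_test" using t by (auto simp: wd_test_def)
  then have "(cls \<phi>, cls (deriv \<phi>)) \<in> wd0" unfolding wd0_def by (rule subsetD[OF closure_subset])
  moreover have "(cls (deriv \<phi>), cls (deriv (deriv \<phi>))) \<in> wd_test"
    using test_functions_deriv[OF t] by (auto simp: wd_test_def)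
  then have "(cls (deriv \<phi>), cls (deriv (deriv \<phi>))) \<in> wd" by (rule subsetD[OF wd_test_subset])
  moreover have "prim (cls (deriv \<phi>)) b = 0" "prim (cls (deriv \<phi>)) (- b) = 0"
    by (simp_all add: prim_test[OF t] test_functions_eq_0[OF \<phi>])
  ultimately show ?thesis by (auto simp: V_graph_def V_rel_def)
qed

section \<open>Translation of the Sobolev definitions into graphs\<close>

lemma is_weak_deriv_iff:
  assumes "u \<in> L2" "v \<in> L2"
  shows "is_weak_deriv u v \<longleftrightarrow> (cls u, cls v) \<in> wd"
proof -
  have "L2_inner u (deriv \<phi>) = cls u \<bullet> cls (deriv \<phi>)" "L2_inner v \<phi> = cls v \<bullet> cls \<phi>"
    if "\<phi> \<in> test_functions I_dom" for \<phi>
    using assms test_functions_L2[OF that] test_functions_L2[OF test_functions_deriv[OF that]]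
    by (simp_all add: inner_cls)
  then show ?thesis using assms by (simp add: is_weak_deriv_def wd_def)
qed

text \<open>\<open>wderiv\<close> picks some weak derivative; any two agree almost everywhere, so
  its class is the only possible second component.\<close>

lemma wderiv_eq:
  assumes u: "u \<in> L2" and y: "(cls u, y) \<in> wd"
  shows "u \<in> H1" "wderiv u \<in> L2" "cls (wderiv u) = y"
proof -
  have *: "is_weak_deriv u (fn y)" using u y by (simp add: is_weak_deriv_iff)
  then show "u \<in> H1" using u by (auto simp: H1_def)
  have **: "is_weak_deriv u (wderiv u)" unfolding wderiv_def by (rule someI[where P = "is_weak_deriv u", OF *])
  then show L: "wderiv u \<in> L2" by (simp add: is_weak_deriv_def)
  with ** have "(cls u, cls (wderiv u)) \<in> wd" using u by (simp add: is_weak_deriv_iff)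
  then show "cls (wderiv u) = y" by (rule wd_unique) (rule y)
qed

lemma H1_imp_wd:
  assumes "u \<in> H1"
  shows "u \<in> L2" "(cls u, cls (wderiv u)) \<in> wd"
proof -
  show u: "u \<in> L2" using assms by (simp add: H1_def)
  obtain v where v: "is_weak_deriv u v" using assms by (auto simp: H1_def)
  then have L: "v \<in> L2" by (simp add: is_weak_deriv_def)
  have "(cls u, cls v) \<in> wd" using v u L by (simp add: is_weak_deriv_iff)
  then show "(cls u, cls (wderiv u)) \<in> wd" using wderiv_eq(3)[OF u] by simp
qed

lemma H1_norm_eq:
  assumes "u \<in> L2" "(cls u, y) \<in> wd"
  shows "H1_norm u = norm (cls u, y)"
  using assms wderiv_eq[OF assms] by (simp add: H1_norm_def norm_Pair norm_cls[symmetric])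

text \<open>The \<open>H1\<close> norm of the difference of a test function and \<open>u\<close> is
  the product norm of the difference of the two pairs, so approximating sequences correspond to each
  other.\<close>

lemma H1_0_iff:
  assumes u: "u \<in> L2" and y: "(cls u, y) \<in> wd"
  shows "u \<in> H1_0 \<longleftrightarrow> (cls u, y) \<in> wd0"
proof -
  have norm_eq: "H1_norm (\<lambda>x. \<phi> x - u x) = norm ((cls \<phi>, cls (deriv \<phi>)) - (cls u, y))"
    if "\<phi> \<in> test_functions I_dom" for \<phi>
  proof -
    have L: "\<phi> \<in> L2" by (rule test_functions_L2[OF that])
    have \<phi>: "(cls \<phi>, cls (deriv \<phi>)) \<in> wd" using wd_test_subset that by (auto simp: wd_test_def)
    have "(cls (\<lambda>x. \<phi> x - u x), cls (deriv \<phi>) - y) \<in> wd"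
      using subspace_diff[OF subspace_wd \<phi> y] by (simp add: cls_diff[OF L u])
    then show ?thesis using H1_norm_eq[OF L2_diff[OF L u]] by (simp add: cls_diff[OF L u])
  qed
  show ?thesis
  proof
    assume "u \<in> H1_0"
    then obtain \<phi> where \<phi>: "\<And>n::nat. \<phi> n \<in> test_functions I_dom"
      and lim: "(\<lambda>n. H1_norm (\<lambda>x. \<phi> n x - u x)) \<longlonglongrightarrow> 0" by (auto simp: H1_0_def)
    have "(\<lambda>n. (cls (\<phi> n), cls (deriv (\<phi> n)))) \<longlonglongrightarrow> (cls u, y)"
      using lim unfolding norm_eq[OF \<phi>] by (simp only: tendsto_norm_zero_iff LIM_zero_iff)
    moreover have "(cls (\<phi> n), cls (deriv (\<phi> n))) \<in> wd_test" for n using \<phi> by (auto simp: wd_test_def)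
    ultimately show "(cls u, y) \<in> wd0"
      unfolding wd0_def closure_sequential by (intro exI[of _ "\<lambda>n. (cls (\<phi> n), cls (deriv (\<phi> n)))"]) simp
  next
    assume "(cls u, y) \<in> wd0"
    then obtain P where P: "\<And>n. P n \<in> wd_test" "P \<longlonglongrightarrow> (cls u, y)"
      unfolding wd0_def closure_sequential by blast
    have "\<forall>n. \<exists>\<phi>. \<phi> \<in> test_functions I_dom \<and> P n = (cls \<phi>, cls (deriv \<phi>))"
      using P(1) by (auto simp: wd_test_def)
    then obtain \<phi> where \<phi>: "\<And>n. \<phi> n \<in> test_functions I_dom" "\<And>n. P n = (cls (\<phi> n), cls (deriv (\<phi> n)))"
      by metis
    have "(\<lambda>n. norm (P n - (cls u, y))) \<longlonglongrightarrow> 0"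
      using P(2) by (simp only: tendsto_norm_zero_iff LIM_zero_iff)
    then have "(\<lambda>n. H1_norm (\<lambda>x. \<phi> n x - u x)) \<longlonglongrightarrow> 0"
      by (simp only: norm_eq[OF \<phi>(1)] \<phi>(2))
    then show "u \<in> H1_0" unfolding H1_0_def using \<phi>(1) wderiv_eq(1)[OF u y] by blast
  qed
qed

text \<open>The set where the functions differ is open and null, hence empty.\<close>

lemma continuous_AE_imp_eq:
  fixes f g :: "real \<Rightarrow> real"
  assumes "continuous_on I_dom f" "continuous_on I_dom g" "AE x in I_meas. f x = g x" "t \<in> I_dom"
  shows "f t = g t"
proof (rule ccontr)
  assume ne: "f t \<noteq> g t"
  let ?S = "I_dom \<inter> (\<lambda>x. f x - g x) -` (- {0})"
  have "open ?S"
    by (rule continuous_open_preimage) (intro continuous_intros assms, auto)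
  moreover have "t \<in> ?S" using ne assms(4) by simp
  moreover have "negligible ?S"
  proof -
    have "AE x in lebesgue. x \<in> I_dom \<longrightarrow> f x = g x" using assms(3) by (subst (asm) AE_restrict_space_iff) simp_all
    moreover have "{x \<in> space lebesgue. \<not> (x \<in> I_dom \<longrightarrow> f x = g x)} = ?S" by auto
    ultimately show ?thesis
      using AE_iff_null[of lebesgue "\<lambda>x. x \<in> I_dom \<longrightarrow> f x = g x"] borel_open[OF \<open>open ?S\<close>]
      by (simp add: negligible_iff_null_sets)
  qed
  ultimately show False using open_not_negligible by blast
qed

text \<open>\<open>prim y\<close> is one continuous representative, so the choice is not vacuous,
  and the chosen one agrees with it at every interior point.\<close>

lemma cont_rep_eq:
  assumes u: "u \<in> L2" and y: "(cls u, y) \<in> wd0" and t: "t \<in> I_dom"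
  shows "cont_rep u t = prim y t"
proof -
  have AE: "AE x in I_meas. prim y x = u x"
    using wd0_prim[OF y] cls_eq_iff[OF prim_L2 u, of y] by simp
  have "continuous_on I_dom (cont_rep u) \<and> (AE x in I_meas. cont_rep u x = u x)"
    unfolding cont_rep_def by (rule someI[of _ "prim y"]) (simp add: continuous_on_prim AE)
  then have c: "continuous_on I_dom (cont_rep u)" and AE': "AE x in I_meas. cont_rep u x = u x" by auto
  show ?thesis
  proof (rule continuous_AE_imp_eq[OF c continuous_on_prim _ t])
    show "AE x in I_meas. cont_rep u x = prim y x" using AE AE' by eventually_elim simp
  qed
qed

lemma mult_pi_in_I:
  assumes "0 < a" "a < 1"
  shows "a * pi \<in> I_dom" "- (a * pi) \<in> I_dom"
proof -
  have "0 < a * pi" "a * pi < 1 * pi" using assms by (auto intro: mult_strict_right_mono)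
  then show "a * pi \<in> I_dom" "- (a * pi) \<in> I_dom"
    using pi_gt_zero unfolding greaterThanLessThan_iff by linarith+
qed

lemma V_graph_imp_V_space:
  assumes a: "0 < a" "a < 1" and u: "u \<in> L2" and z: "(cls u, z) \<in> V_graph (a * pi)"
  shows "u \<in> V_space a" "wderiv (wderiv u) \<in> L2" "cls (wderiv (wderiv u)) = z"
proof -
  obtain y where y: "(cls u, y) \<in> wd0" and yz: "(y, z) \<in> wd"
    and pr: "prim y (a * pi) = 0" "prim y (- (a * pi)) = 0" using z by (auto simp: V_graph_def V_rel_def)
  have uy: "(cls u, y) \<in> wd" using y wd0_subset by blast
  have u': "wderiv u \<in> L2" "(cls (wderiv u), z) \<in> wd" using wderiv_eq[OF u uy] yz by auto
  show "wderiv (wderiv u) \<in> L2" "cls (wderiv (wderiv u)) = z" by (rule wderiv_eq[OF u'])+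
  have "a * pi \<in> I_dom" "- (a * pi) \<in> I_dom" by (rule mult_pi_in_I[OF a])+
  then have "cont_rep u (a * pi) = 0" "cont_rep u (- (a * pi)) = 0"
    by (simp_all only: cont_rep_eq[OF u y] pr)
  moreover have "u \<in> H2" unfolding H2_def using wderiv_eq(1)[OF u uy] wderiv_eq(1)[OF u'] by simp
  moreover have "u \<in> H1_0" using H1_0_iff[OF u uy] y by simp
  ultimately show "u \<in> V_space a" by (simp add: V_space_def)
qed

lemma V_space_imp_V_graph:
  assumes a: "0 < a" "a < 1" and u: "u \<in> V_space a"
  shows "u \<in> L2" "(cls u, cls (wderiv (wderiv u))) \<in> V_graph (a * pi)"
proof -
  have u1: "u \<in> H1" "wderiv u \<in> H1" using u by (auto simp: V_space_def H2_def)
  show uL: "u \<in> L2" by (rule H1_imp_wd[OF u1(1)])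
  have wd: "(cls u, cls (wderiv u)) \<in> wd" "(cls (wderiv u), cls (wderiv (wderiv u))) \<in> wd"
    using H1_imp_wd u1 by auto
  have wd0: "(cls u, cls (wderiv u)) \<in> wd0"
    using H1_0_iff[OF uL wd(1)] u by (simp add: V_space_def)
  have "a * pi \<in> I_dom" "- (a * pi) \<in> I_dom" by (rule mult_pi_in_I[OF a])+
  then have "prim (cls (wderiv u)) (a * pi) = 0" "prim (cls (wderiv u)) (- (a * pi)) = 0"
    using u by (simp_all add: cont_rep_eq[OF uL wd0, symmetric] V_space_def)
  then show "(cls u, cls (wderiv (wderiv u))) \<in> V_graph (a * pi)"
    using wd wd0 by (auto simp: V_graph_def V_rel_def)
qed

section \<open>Multiplication operators and the weight\<close>

definition mul :: "(real \<Rightarrow> real) \<Rightarrow> l2 \<Rightarrow> l2" where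
  "mul w x = cls (\<lambda>t. w t * fn x t)"

definition multiplier :: "(real \<Rightarrow> real) \<Rightarrow> bool" where
  "multiplier w \<longleftrightarrow> w \<in> borel_measurable I_meas \<and> (\<exists>C. AE x in I_meas. \<bar>w x\<bar> \<le> C)"

lemma multiplier_L2: "multiplier w \<Longrightarrow> u \<in> L2 \<Longrightarrow> (\<lambda>t. w t * u t) \<in> L2"
  unfolding multiplier_def by (auto intro: L2_bounded_mult)

lemma mul_cls:
  assumes "multiplier w" "u \<in> L2"
  shows "mul w (cls u) = cls (\<lambda>t. w t * u t)"
proof -
  have "AE t in I_meas. fn (cls u) t = u t"
    using cls_eq_iff[OF fn_L2 assms(2), of "cls u"] by simp
  then have "AE t in I_meas. w t * fn (cls u) t = w t * u t" by eventually_elim simp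
  then show ?thesis unfolding mul_def by (simp add: cls_eq_iff multiplier_L2 assms)
qed

lemma bounded_linear_mul:
  assumes w: "multiplier w"
  shows "bounded_linear (mul w)"
proof -
  from w obtain C0 where "AE x in I_meas. \<bar>w x\<bar> \<le> C0" by (auto simp: multiplier_def)
  then have C: "AE x in I_meas. \<bar>w x\<bar> \<le> \<bar>C0\<bar>" by eventually_elim simp
  show ?thesis
  proof (rule bounded_linear_intro[where K = "\<bar>C0\<bar>"])
    fix x y :: l2 and c :: real
    have "mul w (cls (\<lambda>t. fn x t + fn y t)) = cls (\<lambda>t. w t * fn x t + w t * fn y t)"
      by (simp add: mul_cls[OF w] L2_add distrib_left)
    then show "mul w (x + y) = mul w x + mul w y"
      by (simp add: cls_add multiplier_L2[OF w] mul_def)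
    have "mul w (cls (\<lambda>t. c * fn x t)) = cls (\<lambda>t. c * (w t * fn x t))"
      by (simp add: mul_cls[OF w] L2_scale mult.left_commute)
    then show "mul w (c *\<^sub>R x) = c *\<^sub>R mul w x"
      by (simp add: cls_scale multiplier_L2[OF w] mul_def)
    have "(norm (mul w x))\<^sup>2 \<le> \<bar>C0\<bar>\<^sup>2 * (norm (cls (fn x)))\<^sup>2"
      unfolding mul_def norm_cls_power2[OF multiplier_L2[OF w fn_L2]] norm_cls_power2[OF fn_L2]
        integral_mult_right_zero[symmetric]
    proof (rule integral_mono_AE)
      show "AE t in I_meas. (w t * fn x t)\<^sup>2 \<le> \<bar>C0\<bar>\<^sup>2 * (fn x t)\<^sup>2"
        using C
      proof eventually_elim
        case (elim t)
        then have "\<bar>w t\<bar>\<^sup>2 \<le> \<bar>C0\<bar>\<^sup>2" by (intro power_mono) auto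
        then have "\<bar>w t\<bar>\<^sup>2 * (fn x t)\<^sup>2 \<le> \<bar>C0\<bar>\<^sup>2 * (fn x t)\<^sup>2" by (intro mult_right_mono) auto
        then show ?case by (simp add: power_mult_distrib)
      qed
    qed (intro L2_square multiplier_L2[OF w] fn_L2 integrable_mult_right)+
    then have "(norm (mul w x))\<^sup>2 \<le> (norm x * \<bar>C0\<bar>)\<^sup>2" by (simp add: power_mult_distrib mult.commute)
    then show "norm (mul w x) \<le> norm x * \<bar>C0\<bar>" by (rule power2_le_imp_le) simp
  qed
qed

lemma mul_mul_id:
  assumes "multiplier w" "multiplier w'" "AE t in I_meas. w t * w' t = 1"
  shows "mul w (mul w' x) = x"
proof -
  have "mul w (mul w' x) = cls (\<lambda>t. w t * (w' t * fn x t))"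
    unfolding mul_def[of w'] by (rule mul_cls[OF assms(1) multiplier_L2[OF assms(2) fn_L2]])
  also have "\<dots> = cls (fn x)"
  proof (subst cls_eq_iff)
    show "AE t in I_meas. w t * (w' t * fn x t) = fn x t"
      using assms(3) by eventually_elim (simp add: mult.assoc[symmetric])
  qed (simp_all add: multiplier_L2 assms)
  finally show ?thesis by simp
qed

lemma inner_mul:
  assumes "multiplier w"
  shows "mul w x \<bullet> y = x \<bullet> mul w y"
proof -
  have "mul w (cls (fn x)) \<bullet> cls (fn y) = cls (fn x) \<bullet> mul w (cls (fn y))"
    by (simp only: mul_cls[OF assms] fn_L2 inner_cls multiplier_L2[OF assms] L2_inner_def mult_ac)
  then show ?thesis by simp
qed

text \<open>The upper bound on \<open>p\<close> bounds \<open>sqrt p\<close>, the positive lower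
  bound its reciprocal, so multiplication by \<open>sqrt p\<close> is invertible on
  \<open>l2\<close>.\<close>

lemma P_class_multipliers:
  assumes p: "p \<in> P_class \<alpha> \<beta>" and \<alpha>: "0 < \<alpha>"
  defines "w \<equiv> \<lambda>t. sqrt (p t)" and "w' \<equiv> \<lambda>t. 1 / sqrt (p t)"
  shows "multiplier w" "multiplier w'" "AE t in I_meas. w t * w' t = 1" "AE t in I_meas. w' t * w t = 1"
    "AE t in I_meas. w t * w t = p t" "multiplier p"
proof -
  have pm: "p \<in> borel_measurable I_meas" and AE: "AE t in I_meas. \<alpha> \<le> p t \<and> p t \<le> \<beta>"
    using p by (simp_all add: P_class_def)
  have "AE t in I_meas. \<bar>w t\<bar> \<le> sqrt \<beta>"
    using AE by eventually_elim (use \<alpha> in \<open>simp add: w_def\<close>)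
  moreover have "w \<in> borel_measurable I_meas"
    unfolding w_def by (rule borel_measurable_sqrt[THEN measurable_compose[OF pm]] | rule measurable_compose[OF pm borel_measurable_sqrt])
  ultimately show "multiplier w" by (auto simp: multiplier_def)
  show "multiplier p" using p by (simp add: P_class_def multiplier_def)
  have "AE t in I_meas. \<bar>w' t\<bar> \<le> 1 / sqrt \<alpha>"
    using AE by eventually_elim (use \<alpha> in \<open>simp add: w'_def frac_le\<close>)
  moreover have "w' \<in> borel_measurable I_meas"
    using \<open>w \<in> borel_measurable I_meas\<close> unfolding w'_def w_def
    by (intro borel_measurable_divide borel_measurable_const)
  ultimately show "multiplier w'" by (auto simp: multiplier_def)
  show "AE t in I_meas. w t * w' t = 1" "AE t in I_meas. w' t * w t = 1"
    using AE by (eventually_elim, use \<alpha> in \<open>simp add: w_def w'_def\<close>)+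
  show "AE t in I_meas. w t * w t = p t"
    using AE by eventually_elim (use \<alpha> in \<open>simp add: w_def\<close>)
qed

text \<open>Multiplication by \<open>sqrt p\<close> turns the weighted scalar product into the one of \<open>l2\<close>.\<close>

lemma L2p_inner_eq:
  assumes p: "p \<in> P_class \<alpha> \<beta>" and \<alpha>: "0 < \<alpha>" and u: "u \<in> L2" and v: "v \<in> L2"
  defines "J \<equiv> mul (\<lambda>t. sqrt (p t))"
  shows "L2p_inner p u v = J (cls u) \<bullet> J (cls v)"
proof -
  note m = P_class_multipliers[OF p \<alpha>]
  have "J (cls u) \<bullet> J (cls v) = J (J (cls u)) \<bullet> cls v" unfolding J_def by (rule inner_mul[OF m(1), symmetric])
  also have "J (J (cls u)) = cls (\<lambda>t. sqrt (p t) * (sqrt (p t) * u t))"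
    unfolding J_def mul_cls[OF m(1) u] by (rule mul_cls[OF m(1) multiplier_L2[OF m(1) u]])
  also have "\<dots> = cls (\<lambda>t. p t * u t)"
  proof (subst cls_eq_iff)
    show "AE t in I_meas. sqrt (p t) * (sqrt (p t) * u t) = p t * u t"
      using m(5) by eventually_elim (simp only: mult.assoc[symmetric])
  qed (intro multiplier_L2 m u)+
  finally show ?thesis by (simp add: inner_cls multiplier_L2 m(6) u v L2p_inner_def)
qed

text \<open>The graph is transported by \<open>J\<close> in its first component only. The Rayleigh
  quotient thus compares the plain norm of the second derivative with the weighted norm of the
  function, which is the eigenvalue problem of a beam with density \<open>p\<close>.\<close>

theorem weighted_spectral_basis:
  assumes p: "p \<in> P_class \<alpha> \<beta>" and \<alpha>: "0 < \<alpha>"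
  defines "J \<equiv> mul (\<lambda>t. sqrt (p t))"
  obtains e \<omega> \<kappa> where "wave e \<omega> \<kappa>"
    "\<And>x z. (x, z) \<in> V_graph b \<Longrightarrow> \<exists>w. J x = wave.B e \<omega> w \<and> norm w = norm z"
    "\<And>w. \<exists>x z. (x, z) \<in> V_graph b \<and> J x = wave.B e \<omega> w"
proof -
  define K where "K = mul (\<lambda>t. 1 / sqrt (p t))"
  note m = P_class_multipliers[OF p \<alpha>]
  interpret J: bounded_linear J unfolding J_def by (rule bounded_linear_mul[OF m(1)])
  interpret K: bounded_linear K unfolding K_def by (rule bounded_linear_mul[OF m(2)])
  have JK: "J (K x) = x" and KJ: "K (J x) = x" for x
    unfolding J_def K_def by (rule mul_mul_id[OF m(1) m(2) m(3)], rule mul_mul_id[OF m(2) m(1) m(4)])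
  define \<Gamma> where "\<Gamma> = {q. (K (fst q), snd q) \<in> V_graph b}"
  obtain C where C: "0 < C" "\<And>x. norm (J x) \<le> norm x * C" using J.pos_bounded by blast
  have J_iff: "(J x, z) \<in> \<Gamma> \<longleftrightarrow> (x, z) \<in> V_graph b" for x z by (simp add: \<Gamma>_def KJ)
  have 1: "subspace \<Gamma>"
  proof (rule subspaceI)
    show "0 \<in> \<Gamma>" using subspace_0[OF subspace_V_graph, of b] by (simp add: \<Gamma>_def K.zero zero_prod_def)
    show "x + y \<in> \<Gamma>" if "x \<in> \<Gamma>" "y \<in> \<Gamma>" for x y
      using subspace_add[OF subspace_V_graph, of "(K (fst x), snd x)" b "(K (fst y), snd y)"] that
      by (simp add: \<Gamma>_def K.add)
    show "c *\<^sub>R x \<in> \<Gamma>" if "x \<in> \<Gamma>" for x c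
      using subspace_scale[OF subspace_V_graph, of "(K (fst x), snd x)" b c] that
      by (simp add: \<Gamma>_def K.scaleR)
  qed
  have 2: "closed \<Gamma>"
  proof -
    have "continuous_on UNIV (\<lambda>q. (K (fst q), snd q :: l2))"
      by (intro continuous_on_Pair K.continuous_on continuous_on_fst continuous_on_snd continuous_on_id)
    then have "closed ((\<lambda>q. (K (fst q), snd q)) -` V_graph b)"
      using closed_V_graph by (simp add: continuous_on_closed_vimage)
    then show ?thesis by (simp add: \<Gamma>_def vimage_def)
  qed
  have 3: "\<exists>r. strict_mono (r :: nat \<Rightarrow> nat) \<and> convergent (\<lambda>n. fst (X (r n)))"
    if "\<And>n. X n \<in> \<Gamma>" "\<And>n. norm (snd (X n)) \<le> M" for X M
  proof -
    have "\<exists>r. strict_mono (r :: nat \<Rightarrow> nat) \<and> convergent (\<lambda>n. fst (K (fst (X (r n))), snd (X (r n))))"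
      by (rule V_graph_compact[where X = "\<lambda>n. (K (fst (X n)), snd (X n))" and M = M])
        (use that in \<open>auto simp: \<Gamma>_def\<close>)
    then obtain r l where r: "strict_mono (r :: nat \<Rightarrow> nat)" and "(\<lambda>n. K (fst (X (r n)))) \<longlonglongrightarrow> l"
      by (auto simp: convergent_def)
    then have "(\<lambda>n. J (K (fst (X (r n))))) \<longlonglongrightarrow> J l" by (intro J.tendsto)
    then show ?thesis using r by (auto simp: JK convergent_def)
  qed
  have 4: "norm x \<le> C * (2 * pi)\<^sup>2 * norm z" if xz: "(x, z) \<in> \<Gamma>" for x z
  proof -
    obtain y where "V_rel b (K x) y z" using xz by (auto simp: \<Gamma>_def V_graph_def)
    then have "norm (K x) \<le> (2 * pi)\<^sup>2 * norm z" by (rule V_rel_poincare)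
    then have "norm (K x) * C \<le> (2 * pi)\<^sup>2 * norm z * C" using C(1) by (intro mult_right_mono) auto
    then show ?thesis using C(2)[of "K x"] by (simp add: JK mult_ac)
  qed
  have 5: "0 < C * (2 * pi)\<^sup>2" using C by simp
  have 6: "z = 0" if z: "(0, z) \<in> \<Gamma>" for z
  proof -
    obtain y where y: "(0, y) \<in> wd0" and yz: "(y, z) \<in> wd"
      using z by (auto simp: \<Gamma>_def V_graph_def V_rel_def K.zero)
    have "(0, 0) \<in> wd" using subspace_0[OF subspace_wd] by (simp add: zero_prod_def)
    moreover from this have "y = 0" using wd_unique wd0_subset y by blast
    ultimately show "z = 0" using wd_unique yz by blast
  qed
  \<comment> \<open>\<open>J\<close> is self-adjoint and is moved onto \<open>x\<close>, where
    density of the test functions off the two points applies; its inverse \<open>K\<close> leads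
    back to \<open>x\<close>.\<close>
  have 7: "x = 0" if x: "\<And>q. q \<in> \<Gamma> \<Longrightarrow> x \<bullet> fst q = 0" for x
  proof -
    have "J x = 0"
    proof (rule cls_eq_0I)
      fix \<phi> assume "\<phi> \<in> test_functions (I_dom - {b, - b})"
      then have "(J (cls \<phi>), cls (deriv (deriv \<phi>))) \<in> \<Gamma>" using V_graph_test by (simp add: J_iff)
      from x[OF this] show "J x \<bullet> cls \<phi> = 0" unfolding J_def by (simp add: inner_mul[OF m(1)])
    qed
    then have "K (J x) = K 0" by simp
    then show "x = 0" by (simp only: KJ K.zero)
  qed
  obtain e \<omega> \<kappa> where "wave e \<omega> \<kappa>"
    and a: "\<And>x y. (x, y) \<in> \<Gamma> \<Longrightarrow> \<exists>w. x = wave.B e \<omega> w \<and> norm w = norm y"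
    and b: "\<And>w. \<exists>y. (wave.B e \<omega> w, y) \<in> \<Gamma>"
    by (rule spectral_basis[OF 1 2 _ 4 5 6 7]) (use 3 in blast)+
  show ?thesis
  proof
    show "wave e \<omega> \<kappa>" by fact
    show "\<exists>w. J x = wave.B e \<omega> w \<and> norm w = norm z" if "(x, z) \<in> V_graph b" for x z
      using a[of "J x" z] that by (simp add: J_iff)
    show "\<exists>x z. (x, z) \<in> V_graph b \<and> J x = wave.B e \<omega> w" for w
    proof -
      obtain y where "(wave.B e \<omega> w, y) \<in> \<Gamma>" using b by blast
      then have "(K (wave.B e \<omega> w), y) \<in> V_graph b" by (simp add: \<Gamma>_def)
      then show ?thesis using JK by blast
    qed
  qed
qed

section \<open>The lemma of du Bois-Reymond\<close>

text \<open>Passes from Lebesgue integrals over \<open>S\<close> to gauge integrals over a compact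
  interval, for which the fundamental theorem of calculus is available.\<close>

lemma integral_compact_support:
  fixes f :: "real \<Rightarrow> real"
  assumes f: "continuous_on {c..d} f" and zero: "\<And>x. x \<notin> {c..d} \<Longrightarrow> f x = 0"
    and S: "{c..d} \<subseteq> S" "S \<in> sets lebesgue"
  shows "(\<integral>x. f x \<partial>lebesgue_on S) = integral {c..d} f"
proof -
  have "(\<integral>x. f x \<partial>lebesgue_on S) = (\<integral>x. indicator S x *\<^sub>R f x \<partial>lebesgue)"
    by (rule integral_restrict_space) (use S in simp)
  also have "\<dots> = (\<integral>x. indicator {c..d} x *\<^sub>R f x \<partial>lebesgue)"
    by (rule Bochner_Integration.integral_cong) (use zero S in \<open>auto simp: indicator_def\<close>)
  also have "\<dots> = (\<integral>x. f x \<partial>lebesgue_on {c..d})"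
    by (rule integral_restrict_space[symmetric]) simp
  also have "\<dots> = integral {c..d} f"
    by (rule lebesgue_integral_eq_integral[OF continuous_imp_integrable_real[OF f]]) simp
  finally show ?thesis .
qed

lemma test_functions_support_ivl:
  assumes \<eta>: "\<eta> \<in> test_functions S" and S: "open S" "s0 \<in> S"
    and ivl: "\<And>s t. s \<in> S \<Longrightarrow> t \<in> S \<Longrightarrow> {s..t} \<subseteq> S"
  obtains c d where "c < d" "{c..d} \<subseteq> S" "\<And>x. x \<notin> {c<..<d} \<Longrightarrow> \<eta> x = 0"
proof -
  \<comment> \<open>Adding \<open>s0\<close> makes the compact set nonempty, so that minimum and
    maximum exist even for \<open>\<eta> = 0\<close>.\<close>
  let ?K = "insert s0 (closure {x. \<eta> x \<noteq> 0})"
  have K: "compact ?K" "?K \<subseteq> S" "?K \<noteq> {}" using \<eta> S by (auto simp: test_functions_def compact_insert)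
  obtain l u where l: "l \<in> ?K" "\<And>x. x \<in> ?K \<Longrightarrow> l \<le> x" and u: "u \<in> ?K" "\<And>x. x \<in> ?K \<Longrightarrow> x \<le> u"
    using compact_attains_inf[OF K(1,3)] compact_attains_sup[OF K(1,3)] by blast
  have "l \<in> S" "u \<in> S" using l(1) u(1) K(2) by blast+
  obtain \<epsilon>1 where e1: "\<epsilon>1 > 0" "ball l \<epsilon>1 \<subseteq> S" using openE[OF S(1) \<open>l \<in> S\<close>] .
  obtain \<epsilon>2 where e2: "\<epsilon>2 > 0" "ball u \<epsilon>2 \<subseteq> S" using openE[OF S(1) \<open>u \<in> S\<close>] .
  define c where "c = l - \<epsilon>1 / 2"
  define d where "d = u + \<epsilon>2 / 2"
  have "c \<in> ball l \<epsilon>1" "d \<in> ball u \<epsilon>2" using e1(1) e2(1) by (simp_all add: c_def d_def dist_real_def)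
  then have cd: "c \<in> S" "d \<in> S" using e1(2) e2(2) by blast+
  have "l \<le> u" using l(2)[OF u(1)] .
  show ?thesis
  proof
    show "c < d" using e1(1) e2(1) \<open>l \<le> u\<close> by (simp add: c_def d_def)
    show "{c..d} \<subseteq> S" by (rule ivl[OF cd])
    show "\<eta> x = 0" if "x \<notin> {c<..<d}" for x
    proof (rule ccontr)
      assume "\<eta> x \<noteq> 0"
      then have "x \<in> {x. \<eta> x \<noteq> 0}" by simp
      then have "x \<in> ?K" using subsetD[OF closure_subset, of x "{x. \<eta> x \<noteq> 0}"] by blast
      then have "l \<le> x" "x \<le> u" using l(2) u(2) by blast+
      then show False using that e1(1) e2(1) by (simp add: c_def d_def)
    qed
  qed
qed

text \<open>Starting the integral at \<open>c - 1\<close>, where \<open>\<rho>\<close> still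
  vanishes, makes every point from \<open>c\<close> on interior, so that the derivative is two-sided
  there; left of \<open>c\<close> the primitive is locally 0.\<close>

lemma primitive_of_bump:
  assumes \<rho>: "\<And>k. Cn k \<rho>" and zero: "\<And>x. x \<notin> {c..d} \<Longrightarrow> \<rho> x = 0" and cd: "c < d"
  defines "R \<equiv> \<lambda>x. integral {c - 1..x} \<rho>"
  shows "(R has_real_derivative \<rho> x) (at x)" "x < c \<Longrightarrow> R x = 0" "d \<le> x \<Longrightarrow> R x = R d"
proof -
  have d\<rho>: "(\<rho> has_real_derivative deriv \<rho> x) (at x)" for x
    using \<rho>[of "Suc 0"] by (intro DERIV_deriv_real) simp
  have cont: "continuous_on A \<rho>" for A
    by (rule continuous_at_imp_continuous_on) (intro ballI DERIV_isCont[OF d\<rho>])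
  have int: "\<rho> integrable_on {s..t}" for s t by (rule integrable_continuous_real[OF cont])
  have low: "R x = 0" if "x < c" for x
  proof -
    have "R x = integral {c - 1..x} (\<lambda>x. 0)"
      unfolding R_def by (rule integral_cong) (use that zero in auto)
    then show ?thesis by simp
  qed
  then show "x < c \<Longrightarrow> R x = 0" .
  show "R x = R d" if "d \<le> x"
  proof -
    have "R d + integral {d..x} \<rho> = R x"
      unfolding R_def by (rule Henstock_Kurzweil_Integration.integral_combine) (use cd that int in auto)
    moreover have "integral {d..x} \<rho> = integral {d..x} (\<lambda>x. 0)"
    proof (rule integral_spike[where S = "{d}"])
      show "0 = \<rho> t" if "t \<in> {d..x} - {d}" for t using that zero[of t] by auto
    qed simp
    ultimately show ?thesis by simp
  qed
  show "(R has_real_derivative \<rho> x) (at x)"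
  proof (cases "x < c")
    case True
    have ev: "eventually (\<lambda>y. y \<in> {..<c}) (nhds x)" by (rule eventually_nhds_in_open) (use True in simp_all)
    have "eventually (\<lambda>y. R y = 0) (nhds x)" by (rule eventually_mono[OF ev]) (simp add: low)
    then have "(R has_real_derivative 0) (at x) \<longleftrightarrow> ((\<lambda>x. 0) has_real_derivative 0) (at x)"
      by (intro DERIV_cong_ev refl)
    then show ?thesis using True zero[of x] by simp
  next
    case False
    have "(R has_vector_derivative \<rho> x) (at x within {c - 1..x + 1})"
      unfolding R_def by (rule integral_has_vector_derivative[OF cont]) (use False in auto)
    moreover have "at x within {c - 1..x + 1} = at x" by (rule at_within_interior) (use False in auto)
    ultimately show ?thesis by (simp add: has_real_derivative_iff_has_vector_derivative)
  qed
qed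

text \<open>If \<open>Q s < Q t\<close>, test with the primitive of a bump near \<open>s\<close> minus its translate near \<open>t\<close>.\<close>

lemma du_bois_reymond_le:
  fixes Q :: "real \<Rightarrow> real"
  assumes Q: "continuous_on {L..U} Q" and st: "L < s" "s < t" "t < U"
    and weak: "\<And>\<eta>. \<eta> \<in> test_functions {L<..<U} \<Longrightarrow> integral {L..U} (\<lambda>x. Q x * deriv \<eta> x) = 0"
  shows "Q t \<le> Q s"
proof (rule ccontr)
  assume "\<not> Q t \<le> Q s"
  define m where "m = (Q s + Q t) / 2"
  have m: "Q s < m" "m < Q t" using \<open>\<not> Q t \<le> Q s\<close> by (simp_all add: m_def)
  have isC: "isCont Q s" "isCont Q t"
    using continuous_on_interior[OF Q] st by simp_all
  have "eventually (\<lambda>x. Q x < m) (nhds s)" "eventually (\<lambda>x. m < Q x) (nhds t)"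
    using isC m order_tendstoD by (auto simp: isCont_def tendsto_at_iff_tendsto_nhds)
  then obtain d1 d2 where d: "0 < d1" "\<And>x. dist x s < d1 \<Longrightarrow> Q x < m" "0 < d2" "\<And>x. dist x t < d2 \<Longrightarrow> m < Q x"
    unfolding eventually_nhds_metric by metis
  define \<mu> where "\<mu> = min (min d1 d2) (min (s - L) (min (U - t) (t - s)))"
  have \<mu>: "0 < \<mu>" "\<mu> \<le> d1" "\<mu> \<le> d2" "\<mu> \<le> s - L" "\<mu> \<le> U - t" "\<mu> \<le> t - s"
    using d st by (auto simp: \<mu>_def)
  \<comment> \<open>A third of \<open>\<mu>\<close> keeps the bump and its translate inside the
    interval, inside the neighbourhoods where \<open>Q\<close> is below or above \<open>m\<close>,
    and with disjoint supports.\<close>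
  define \<delta> where "\<delta> = \<mu> / 3"
  have \<delta>: "0 < \<delta>" "\<delta> < d1" "\<delta> < d2" "\<delta> < s - L" "\<delta> < U - t" "2 * \<delta> < t - s"
    using \<mu> by (simp_all add: \<delta>_def)
  have "(\<lambda>j. bump j (s - \<delta>) (s + \<delta>) s) \<longlonglongrightarrow> 1"
    using tendsto_bump[of "s - \<delta>" "s + \<delta>" s] \<delta>(1) by simp
  then have "eventually (\<lambda>j. 1 / 2 < bump j (s - \<delta>) (s + \<delta>) s) sequentially"
    by (rule order_tendstoD) simp
  then obtain j0 where j0: "\<And>j. j \<ge> j0 \<Longrightarrow> 1 / 2 < bump j (s - \<delta>) (s + \<delta>) s"
    by (auto simp: eventually_sequentially)
  define j where "j = Suc j0"
  define \<rho> where "\<rho> = bump j (s - \<delta>) (s + \<delta>)"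
  have \<rho>s: "0 < \<rho> s" using j0[of j] by (simp add: \<rho>_def j_def)
  have \<rho>_nonneg: "0 \<le> \<rho> x" for x by (simp add: \<rho>_def bump_bounds)
  have \<rho>Cn: "Cn k \<rho>" for k by (simp add: \<rho>_def Cn_bump)
  have \<rho>0: "\<rho> x = 0" if "x \<notin> {s - \<delta><..<s + \<delta>}" for x
    unfolding \<rho>_def
  proof (rule bump_eq_0)
    have "0 \<le> 1 / real j" by simp
    moreover have "x - (s - \<delta>) \<le> 0 \<or> s + \<delta> - x \<le> 0" using that by auto
    ultimately show "x - (s - \<delta>) \<le> 1 / real j \<or> s + \<delta> - x \<le> 1 / real j" by linarith
  qed (simp add: j_def)
  have \<rho>0': "\<rho> x = 0" if "x \<notin> {s - \<delta>..s + \<delta>}" for x by (rule \<rho>0) (use that in auto)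
  have lt: "s - \<delta> < s + \<delta>" using \<delta>(1) by simp
  define R where "R x = integral {s - \<delta> - 1..x} \<rho>" for x
  have R: "\<And>x. (R has_real_derivative \<rho> x) (at x)" "\<And>x. x < s - \<delta> \<Longrightarrow> R x = 0"
    "\<And>x. s + \<delta> \<le> x \<Longrightarrow> R x = R (s + \<delta>)"
    unfolding R_def using primitive_of_bump[of \<rho> "s - \<delta>" "s + \<delta>", OF \<rho>Cn \<rho>0' lt] by blast+
  \<comment> \<open>To the right of both bumps the two primitives have the same constant value and
    cancel, so \<open>\<eta>\<close> has compact support.\<close>
  define \<eta> where "\<eta> x = R x - R (x - (t - s))" for x
  have d\<eta>: "(\<eta> has_real_derivative \<rho> x - \<rho> (x - (t - s))) (at x)" for x
  proof -
    have "((\<lambda>x. R (x - (t - s))) has_real_derivative \<rho> (x - (t - s)) * 1) (at x)"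
      by (rule DERIV_chain2[OF R(1)]) (auto intro!: derivative_eq_intros)
    then show ?thesis unfolding \<eta>_def using R(1) by (intro DERIV_diff) simp_all
  qed
  have deriv\<eta>: "deriv \<eta> x = \<rho> x - \<rho> (x - (t - s))" for x by (rule DERIV_imp_deriv[OF d\<eta>])
  have \<eta>0: "\<eta> x = 0" if "x \<notin> {s - \<delta>..t + \<delta>}" for x
  proof (cases "x < s - \<delta>")
    case True
    have "R x = 0" by (rule R(2)[OF True])
    moreover have "R (x - (t - s)) = 0" by (rule R(2)) (use True st in simp)
    ultimately show ?thesis by (simp add: \<eta>_def)
  next
    case False
    then have "R x = R (s + \<delta>)" "R (x - (t - s)) = R (s + \<delta>)"
      using that st \<delta>(1) by (auto intro!: R(3))
    then show ?thesis by (simp add: \<eta>_def)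
  qed
  have "\<eta> \<in> test_functions {L<..<U}"
  proof (rule test_functionsI[where K = "{s - \<delta>..t + \<delta>}"])
    show "Cn k \<eta>" for k
    proof (rule Cn_SucD, rule Cn_SucI[OF d\<eta>])
      have "Cn k (\<lambda>x. \<rho> x + (-1) * \<rho> (1 * x + (- (t - s))))"
        by (intro Cn_add Cn_mult Cn_const Cn_affine \<rho>Cn)
      moreover have "(\<lambda>x. \<rho> x + (-1) * \<rho> (1 * x + (- (t - s)))) = (\<lambda>x. \<rho> x - \<rho> (x - (t - s)))"
        by (rule ext) (simp add: algebra_simps)
      ultimately show "Cn k (\<lambda>x. \<rho> x - \<rho> (x - (t - s)))" by (simp only:)
    qed
    show "{s - \<delta>..t + \<delta>} \<subseteq> {L<..<U}" using \<delta> by auto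
  qed (simp_all add: \<eta>0)
  then have w: "integral {L..U} (\<lambda>x. Q x * deriv \<eta> x) = 0" by (rule weak)
  have "((\<lambda>x. deriv \<eta> x) has_integral (\<eta> U - \<eta> L)) {L..U}"
  proof (rule fundamental_theorem_of_calculus)
    fix x
    show "(\<eta> has_vector_derivative deriv \<eta> x) (at x within {L..U})"
      using has_field_derivative_at_within[OF d\<eta>] by (simp add: deriv\<eta> has_real_derivative_iff_has_vector_derivative)
  qed (use st in simp)
  moreover have "\<eta> U = 0" "\<eta> L = 0" using \<delta> by (auto intro!: \<eta>0)
  ultimately have "((\<lambda>x. deriv \<eta> x) has_integral 0) {L..U}" by simp
  \<comment> \<open>The derivative of \<open>\<eta>\<close> has integral 0, so the constant level
    \<open>m\<close> may be subtracted from \<open>Q\<close> without changing the integral.\<close>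
  then have w': "((\<lambda>x. m * deriv \<eta> x) has_integral m * 0) {L..U}" by (rule has_integral_mult_right)
  have c\<rho>: "continuous_on A \<rho>" for A
    using \<rho>Cn[of "Suc 0"] by (auto intro!: continuous_at_imp_continuous_on DERIV_isCont[OF DERIV_deriv_real])
  have c\<eta>: "continuous_on A (deriv \<eta>)" for A
  proof -
    have "continuous_on A (\<lambda>x. \<rho> (x - (t - s)))"
      by (rule continuous_on_compose2[OF c\<rho>[of UNIV]]) (auto intro!: continuous_intros)
    then show ?thesis using c\<rho>[of A] by (simp add: deriv\<eta>[abs_def] continuous_on_diff)
  qed
  have "(\<lambda>x. Q x * deriv \<eta> x) integrable_on {L..U}"
    by (intro integrable_continuous_real continuous_on_mult Q c\<eta>)
  then have "((\<lambda>x. Q x * deriv \<eta> x) has_integral 0) {L..U}" using w by (simp add: has_integral_integral)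
  from has_integral_diff[OF w' this]
  have "integral {L..U} (\<lambda>x. m * deriv \<eta> x - Q x * deriv \<eta> x) = 0" by (simp add: integral_unique)
  \<comment> \<open>Near \<open>s\<close> the derivative of \<open>\<eta>\<close> is nonnegative and
    \<open>Q\<close> lies below \<open>m\<close>; near \<open>t\<close> both signs are reversed. A
    nonnegative continuous function with integral 0 vanishes, whereas this one is positive at
    \<open>s\<close>.\<close>
  moreover have nonneg: "0 \<le> m * deriv \<eta> x - Q x * deriv \<eta> x" for x
  proof -
    have "0 \<le> (m - Q x) * \<rho> x"
    proof (cases "\<rho> x = 0")
      case False
      then have "x \<in> {s - \<delta><..<s + \<delta>}" using \<rho>0 by blast
      then have "dist x s < d1" using \<delta> by (auto simp: dist_real_def abs_less_iff)
      from d(2)[OF this] show ?thesis by (intro mult_nonneg_nonneg \<rho>_nonneg) simp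
    qed simp
    moreover have "0 \<le> (Q x - m) * \<rho> (x - (t - s))"
    proof (cases "\<rho> (x - (t - s)) = 0")
      case False
      then have "x - (t - s) \<in> {s - \<delta><..<s + \<delta>}" using \<rho>0 by blast
      then have "dist x t < d2" using \<delta> by (auto simp: dist_real_def abs_less_iff)
      from d(4)[OF this] show ?thesis by (intro mult_nonneg_nonneg \<rho>_nonneg) simp
    qed simp
    ultimately show ?thesis by (simp add: deriv\<eta> algebra_simps)
  qed
  moreover have "continuous_on {L..U} (\<lambda>x. m * deriv \<eta> x - Q x * deriv \<eta> x)"
    by (intro continuous_on_diff continuous_on_mult continuous_on_const Q c\<eta>)
  ultimately have "\<forall>x\<in>{L..U}. m * deriv \<eta> x - Q x * deriv \<eta> x = 0"
    using integral_eq_0_iff[of L U "\<lambda>x. m * deriv \<eta> x - Q x * deriv \<eta> x"] st by simp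
  then have "(m - Q s) * deriv \<eta> s = 0" using st by (simp add: algebra_simps)
  moreover have "deriv \<eta> s = \<rho> s"
    using \<rho>0[of "s - (t - s)"] \<delta> by (simp add: deriv\<eta>)
  ultimately show False using m \<rho>s by simp
qed

text \<open>With a primitive \<open>R\<close> of \<open>r\<close>, integration by parts makes
  \<open>q + R\<close> orthogonal to all derivatives of test functions. The one-sided lemma, applied
  to this sum and to its negative, shows that it is constant.\<close>

lemma du_bois_reymond:
  fixes q r :: "real \<Rightarrow> real"
  assumes S: "open S" and ivl: "\<And>s t. s \<in> S \<Longrightarrow> t \<in> S \<Longrightarrow> {s..t} \<subseteq> S"
    and q: "continuous_on S q" and r: "continuous_on S r"
    and weak: "\<And>\<eta>. \<eta> \<in> test_functions S \<Longrightarrow>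
      (\<integral>x. q x * deriv \<eta> x \<partial>lebesgue_on S) = (\<integral>x. r x * \<eta> x \<partial>lebesgue_on S)"
    and st: "s \<in> S" "t \<in> S" "s < t"
  shows "q t - q s = - integral {s..t} r"
proof -
  obtain \<epsilon>1 where e1: "\<epsilon>1 > 0" "ball s \<epsilon>1 \<subseteq> S" using openE[OF S st(1)] .
  obtain \<epsilon>2 where e2: "\<epsilon>2 > 0" "ball t \<epsilon>2 \<subseteq> S" using openE[OF S st(2)] .
  define L where "L = s - \<epsilon>1 / 2"
  define U where "U = t + \<epsilon>2 / 2"
  have "L \<in> ball s \<epsilon>1" "U \<in> ball t \<epsilon>2" using e1(1) e2(1) by (simp_all add: L_def U_def dist_real_def)
  then have LU: "L \<in> S" "U \<in> S" using e1(2) e2(2) by blast+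
  have ord: "L < s" "s < t" "t < U" using e1(1) e2(1) st by (simp_all add: L_def U_def)
  have sub: "{L..U} \<subseteq> S" by (rule ivl[OF LU])
  have S_meas: "S \<in> sets lebesgue" using S by simp
  have qc: "continuous_on {L..U} q" and rc: "continuous_on {L..U} r"
    by (rule continuous_on_subset[OF q sub], rule continuous_on_subset[OF r sub])
  have rint: "r integrable_on {x..y}" if "{x..y} \<subseteq> {L..U}" for x y
    by (rule integrable_continuous_real[OF continuous_on_subset[OF rc that]])
  define R where "R x = integral {L..x} r" for x
  have dR: "(R has_vector_derivative r x) (at x within {L..U})" if "x \<in> {L..U}" for x
    unfolding R_def by (rule integral_has_vector_derivative[OF rc that])
  have Rc: "continuous_on {L..U} R" by (rule continuous_on_vector_derivative[OF dR])
  have Qc: "continuous_on {L..U} (\<lambda>x. q x + R x)" by (intro continuous_on_add qc Rc)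
  have Q0: "integral {L..U} (\<lambda>x. (q x + R x) * deriv \<eta> x) = 0" if \<eta>: "\<eta> \<in> test_functions {L<..<U}" for \<eta>
  proof -
    have "{L<..<U} \<subseteq> S" by (rule subset_trans[OF greaterThanLessThan_subseteq_atLeastAtMost_iff[THEN iffD2] sub]) simp
    then have \<eta>S: "\<eta> \<in> test_functions S" using \<eta> test_functions_mono by blast
    note d\<eta> = test_functions_deriv[OF \<eta>]
    have z: "\<eta> x = 0" "deriv \<eta> x = 0" if "x \<notin> {L..U}" for x
      using that by (auto intro: test_functions_eq_0[OF \<eta>] test_functions_eq_0[OF d\<eta>])
    note c = test_functions_continuous[OF \<eta>] test_functions_continuous[OF d\<eta>]
    have "integral {L..U} (\<lambda>x. q x * deriv \<eta> x) = (\<integral>x. q x * deriv \<eta> x \<partial>lebesgue_on S)"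
      by (rule integral_compact_support[symmetric, OF _ _ sub S_meas]) (auto intro!: continuous_on_mult qc c simp: z)
    also have "\<dots> = (\<integral>x. r x * \<eta> x \<partial>lebesgue_on S)" by (rule weak[OF \<eta>S])
    also have "\<dots> = integral {L..U} (\<lambda>x. r x * \<eta> x)"
      by (rule integral_compact_support[OF _ _ sub S_meas]) (auto intro!: continuous_on_mult rc c simp: z)
    finally have 1: "integral {L..U} (\<lambda>x. q x * deriv \<eta> x) = integral {L..U} (\<lambda>x. r x * \<eta> x)" .
    have "((\<lambda>x. R x * deriv \<eta> x + r x * \<eta> x) has_integral (R U * \<eta> U - R L * \<eta> L)) {L..U}"
    proof (rule fundamental_theorem_of_calculus)
      fix x assume x: "x \<in> {L..U}"
      have "(\<eta> has_vector_derivative deriv \<eta> x) (at x within {L..U})"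
        using has_field_derivative_at_within[OF test_functions_has_derivative[OF \<eta>]]
        by (simp add: has_real_derivative_iff_has_vector_derivative)
      then show "((\<lambda>x. R x * \<eta> x) has_vector_derivative R x * deriv \<eta> x + r x * \<eta> x) (at x within {L..U})"
        by (rule has_vector_derivative_mult[OF dR[OF x]])
    qed (use ord in simp)
    then have "integral {L..U} (\<lambda>x. R x * deriv \<eta> x + r x * \<eta> x) = 0"
      by (simp add: integral_unique test_functions_eq_0[OF \<eta>])
    moreover have int: "(\<lambda>x. f x * g x) integrable_on {L..U}" if "continuous_on {L..U} f" "continuous_on {L..U} g" for f g :: "real \<Rightarrow> real"
      by (intro integrable_continuous_real continuous_on_mult that)
    ultimately have "integral {L..U} (\<lambda>x. R x * deriv \<eta> x) + integral {L..U} (\<lambda>x. q x * deriv \<eta> x) = 0"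
      by (simp add: 1 Henstock_Kurzweil_Integration.integral_add int Rc rc c)
    then show ?thesis
      by (simp add: distrib_right Henstock_Kurzweil_Integration.integral_add int Rc qc c)
  qed
  have "q t + R t \<le> q s + R s" by (rule du_bois_reymond_le[OF Qc ord Q0])
  moreover have "- (q t + R t) \<le> - (q s + R s)"
  proof (rule du_bois_reymond_le[OF continuous_on_minus[OF Qc] ord])
    show "integral {L..U} (\<lambda>x. - (q x + R x) * deriv \<eta> x) = 0" if "\<eta> \<in> test_functions {L<..<U}" for \<eta>
      using Q0[OF that] by (simp only: mult_minus_left integral_neg neg_0_equal_iff_equal minus_zero)
  qed
  moreover have "R s + integral {s..t} r = R t"
    unfolding R_def using ord
    by (intro Henstock_Kurzweil_Integration.integral_combine rint) auto
  ultimately show ?thesis by linarith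
qed

section \<open>Weak solutions\<close>

lemma time_ivl_cases:
  assumes "0 < T"
  obtains r where "0 < r" "time_ivl T = {0..r}" "open_time_ivl T = {0<..<r}"
  | "time_ivl T = {0..}" "open_time_ivl T = {0<..}"
proof (cases T)
  case (real r)
  then show ?thesis using assms by (intro that(1)[of r]) (auto simp: time_ivl_def open_time_ivl_def)
next
  case PInf
  then show ?thesis by (intro that(2)) (auto simp: time_ivl_def open_time_ivl_def)
qed (use assms in simp)

lemma time_ivl_facts:
  assumes T: "0 < T"
  shows "0 \<in> time_ivl T" "open_time_ivl T \<subseteq> time_ivl T" "open (open_time_ivl T)"
    "\<And>s t. s \<in> open_time_ivl T \<Longrightarrow> t \<in> open_time_ivl T \<Longrightarrow> {s..t} \<subseteq> open_time_ivl T"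
    "\<And>t. t \<in> time_ivl T \<Longrightarrow> {0..t} \<subseteq> time_ivl T" "\<And>t. t \<in> time_ivl T \<Longrightarrow> {0<..<t} \<subseteq> open_time_ivl T"
    "time_ivl T \<subseteq> {0..}" "\<exists>t. 0 < t \<and> t \<in> open_time_ivl T"
    "\<And>t. t \<in> time_ivl T \<Longrightarrow> at t within time_ivl T \<noteq> bot"
proof -
  show "0 \<in> time_ivl T" "open_time_ivl T \<subseteq> time_ivl T" "open (open_time_ivl T)"
    "\<And>s t. s \<in> open_time_ivl T \<Longrightarrow> t \<in> open_time_ivl T \<Longrightarrow> {s..t} \<subseteq> open_time_ivl T"
    "\<And>t. t \<in> time_ivl T \<Longrightarrow> {0..t} \<subseteq> time_ivl T" "\<And>t. t \<in> time_ivl T \<Longrightarrow> {0<..<t} \<subseteq> open_time_ivl T"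
    "time_ivl T \<subseteq> {0..}"
    using T by (cases rule: time_ivl_cases; auto)+
  show ex: "\<exists>t. 0 < t \<and> t \<in> open_time_ivl T"
    using T
  proof (cases rule: time_ivl_cases)
    case (1 r)
    then show ?thesis by (intro exI[of _ "r / 2"]) simp
  next
    case 2
    then show ?thesis by (intro exI[of _ 1]) simp
  qed
  show "at t within time_ivl T \<noteq> bot" if t: "t \<in> time_ivl T" for t
    using T
  proof (cases rule: time_ivl_cases)
    case (1 r)
    then show ?thesis using t by (simp add: trivial_limit_within islimpt_Icc)
  next
    case 2
    then have "{t..t + 1} \<subseteq> time_ivl T" using t by auto
    moreover have "t islimpt {t..t + 1}" by (simp add: islimpt_Icc)
    ultimately have "t islimpt time_ivl T" by (rule islimpt_subset[rotated])
    then show ?thesis by (simp add: trivial_limit_within)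
  qed
qed

lemma tendsto_at_right_0_time_ivl:
  assumes T: "0 < T" and f: "(f \<longlongrightarrow> l) (at 0 within time_ivl T)"
  shows "(f \<longlongrightarrow> l) (at_right (0::real))"
proof -
  obtain t where t: "0 < t" "t \<in> open_time_ivl T" using time_ivl_facts(8)[OF T] by blast
  then have "{0<..<t} \<subseteq> time_ivl T" using time_ivl_facts(2,6)[OF T] by blast
  then have "(f \<longlongrightarrow> l) (at 0 within {0<..<t})" by (rule tendsto_within_subset[OF f])
  moreover have "at 0 within {0<..<t} = at_right 0"
    by (rule at_within_nhd[where S = "{..<t}"]) (use t in auto)
  ultimately show ?thesis by simp
qed

text \<open>The interface between functions on the interval and the abstract equation.
  \<open>J\<close> stands for multiplication by \<open>sqrt p\<close>; the last two assumptions say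
  that it maps the energy space onto the range of \<open>B\<close>, with \<open>norm w\<close> equal
  to the norm of the second derivative.\<close>

locale beam = wave e \<omega> \<kappa> for e :: "nat \<Rightarrow> l2" and \<omega> \<kappa> +
  fixes a :: real and p :: "real \<Rightarrow> real" and J :: "l2 \<Rightarrow> l2"
  assumes a: "0 < a" "a < 1"
    and bounded_linear_J: "bounded_linear J"
    and J_inj: "J x = J y \<Longrightarrow> x = y"
    and J_surj: "\<exists>x. J x = y"
    and L2p_inner_J: "u \<in> L2 \<Longrightarrow> v \<in> L2 \<Longrightarrow> L2p_inner p u v = J (cls u) \<bullet> J (cls v)"
    and V_graph_B: "(x, z) \<in> V_graph (a * pi) \<Longrightarrow> \<exists>w. J x = B w \<and> norm w = norm z"
    and B_V_graph: "\<exists>x z. (x, z) \<in> V_graph (a * pi) \<and> J x = B w"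
begin

interpretation J: bounded_linear J by (rule bounded_linear_J)

definition Jc :: "(real \<Rightarrow> real) \<Rightarrow> l2" where "Jc u = J (cls u)"

text \<open>The element of \<open>l2\<close> representing \<open>u\<close> of \<^term>\<open>V_space a\<close>: the square root of the operator applied to \<open>u\<close>.\<close>

definition W :: "(real \<Rightarrow> real) \<Rightarrow> l2" where "W u = (THE w. Jc u = B w)"

lemma Jc_diff: "u \<in> L2 \<Longrightarrow> v \<in> L2 \<Longrightarrow> Jc (\<lambda>x. u x - v x) = Jc u - Jc v"
  and Jc_add: "u \<in> L2 \<Longrightarrow> v \<in> L2 \<Longrightarrow> Jc (\<lambda>x. u x + v x) = Jc u + Jc v"
  and Jc_scale: "u \<in> L2 \<Longrightarrow> Jc (\<lambda>x. c * u x) = c *\<^sub>R Jc u"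
  by (simp_all add: Jc_def cls_diff cls_add cls_scale J.diff J.add J.scaleR)

lemma L2p_norm_eq: "u \<in> L2 \<Longrightarrow> L2p_norm p u = norm (Jc u)"
  by (simp add: L2p_norm_def L2p_inner_J Jc_def norm_eq_sqrt_inner)

lemma Jc_eq_iff: "u \<in> L2 \<Longrightarrow> v \<in> L2 \<Longrightarrow> Jc u = Jc v \<longleftrightarrow> (AE x in I_meas. u x = v x)"
  using J_inj by (auto simp: Jc_def cls_eq_iff[symmetric])

lemma Jc_surj: "\<exists>u\<in>L2. Jc u = x"
proof -
  obtain y where "J y = x" using J_surj by blast
  then have "Jc (fn y) = x" by (simp add: Jc_def)
  then show ?thesis using fn_L2 by blast
qed

lemma V_imp: "u \<in> V_space a \<Longrightarrow> u \<in> L2" "u \<in> V_space a \<Longrightarrow> (cls u, cls (wderiv (wderiv u))) \<in> V_graph (a * pi)"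
  using V_space_imp_V_graph[OF a] by auto

lemma V_intro:
  assumes "u \<in> L2" "(cls u, z) \<in> V_graph (a * pi)"
  shows "u \<in> V_space a" "wderiv (wderiv u) \<in> L2" "cls (wderiv (wderiv u)) = z"
  using V_graph_imp_V_space[OF a assms] by auto

lemma W_eqI: "Jc u = B w \<Longrightarrow> W u = w"
  unfolding W_def using B_inj by (intro the_equality) auto

lemma Jc_eq_B_W: "u \<in> V_space a \<Longrightarrow> Jc u = B (W u)"
  using V_graph_B[OF V_imp(2)] W_eqI unfolding Jc_def[symmetric] by metis

lemma V_norm_eq: "u \<in> V_space a \<Longrightarrow> V_norm u = norm (W u)"
  and V_norm_cls: "u \<in> V_space a \<Longrightarrow> V_norm u = norm (cls (wderiv (wderiv u)))"
proof -
  assume u: "u \<in> V_space a"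
  have L: "wderiv (wderiv u) \<in> L2" by (rule V_intro(2)[OF V_imp[OF u]])
  then show *: "V_norm u = norm (cls (wderiv (wderiv u)))"
    by (simp add: V_norm_def V_inner_def inner_cls norm_eq_sqrt_inner)
  obtain w where "Jc u = B w" "norm w = norm (cls (wderiv (wderiv u)))"
    using V_graph_B[OF V_imp(2)[OF u]] by (auto simp: Jc_def)
  then show "V_norm u = norm (W u)" using W_eqI * by simp
qed

lemma L2_norm_wderiv2: "u \<in> V_space a \<Longrightarrow> L2_norm (wderiv (wderiv u)) = norm (W u)"
  by (simp add: V_norm_eq[symmetric] V_norm_def V_inner_def L2_norm_def)

lemma V_add:
  assumes u: "u \<in> V_space a" and v: "v \<in> V_space a"
  shows "(\<lambda>x. u x + v x) \<in> V_space a"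
    "cls (wderiv (wderiv (\<lambda>x. u x + v x))) = cls (wderiv (wderiv u)) + cls (wderiv (wderiv v))"
    "W (\<lambda>x. u x + v x) = W u + W v"
proof -
  have L: "(\<lambda>x. u x + v x) \<in> L2" by (intro L2_add V_imp u v)
  have "(cls (\<lambda>x. u x + v x), cls (wderiv (wderiv u)) + cls (wderiv (wderiv v))) \<in> V_graph (a * pi)"
    using subspace_add[OF subspace_V_graph V_imp(2)[OF u] V_imp(2)[OF v]]
    by (simp add: cls_add V_imp(1)[OF u] V_imp(1)[OF v])
  from V_intro[OF L this] show "(\<lambda>x. u x + v x) \<in> V_space a"
    "cls (wderiv (wderiv (\<lambda>x. u x + v x))) = cls (wderiv (wderiv u)) + cls (wderiv (wderiv v))" by auto
  show "W (\<lambda>x. u x + v x) = W u + W v"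
    by (rule W_eqI) (simp add: Jc_add V_imp(1)[OF u] V_imp(1)[OF v] Jc_eq_B_W u v B.add)
qed

lemma V_scale:
  assumes u: "u \<in> V_space a"
  shows "(\<lambda>x. c * u x) \<in> V_space a" "W (\<lambda>x. c * u x) = c *\<^sub>R W u"
proof -
  have L: "(\<lambda>x. c * u x) \<in> L2" by (intro L2_scale V_imp u)
  have "(cls (\<lambda>x. c * u x), c *\<^sub>R cls (wderiv (wderiv u))) \<in> V_graph (a * pi)"
    using subspace_scale[OF subspace_V_graph V_imp(2)[OF u], of c]
    by (simp add: cls_scale V_imp(1)[OF u])
  from V_intro(1)[OF L this] show "(\<lambda>x. c * u x) \<in> V_space a" .
  show "W (\<lambda>x. c * u x) = c *\<^sub>R W u"
    by (rule W_eqI) (simp add: Jc_scale V_imp(1)[OF u] Jc_eq_B_W u B.scaleR)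
qed

lemma V_diff:
  assumes u: "u \<in> V_space a" and v: "v \<in> V_space a"
  shows "(\<lambda>x. u x - v x) \<in> V_space a" "W (\<lambda>x. u x - v x) = W u - W v"
  using V_add[OF u V_scale(1)[OF v, of "- 1"]] V_scale(2)[OF v, of "- 1"] by simp_all

text \<open>\<open>V_graph_B\<close> matches norms only. Since \<open>W\<close> and the second
  derivative both respect sums, polarisation gives the scalar products.\<close>

lemma V_inner_eq:
  assumes u: "u \<in> V_space a" and v: "v \<in> V_space a"
  shows "V_inner u v = W u \<bullet> W v"
proof -
  let ?z = "\<lambda>u. cls (wderiv (wderiv u))"
  have n: "norm (W u) = norm (?z u)" if "u \<in> V_space a" for u
    using V_norm_eq[OF that] V_norm_cls[OF that] by simp
  have pol: "x \<bullet> y = ((norm (x + y))\<^sup>2 - (norm x)\<^sup>2 - (norm y)\<^sup>2) / 2" for x y :: l2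
    by (simp add: power2_norm_eq_inner inner_add_left inner_add_right inner_commute del: dot_square_norm)
  have "norm (W u + W v) = norm (?z u + ?z v)"
    using n[OF V_add(1)[OF u v]] V_add(2,3)[OF u v] by simp
  then have "W u \<bullet> W v = ?z u \<bullet> ?z v" by (simp add: pol n u v)
  then show ?thesis
    by (simp add: V_inner_def inner_cls V_intro(2)[OF V_imp[OF u]] V_intro(2)[OF V_imp[OF v]])
qed

lemma W_surj: "\<exists>u\<in>V_space a. W u = w"
proof -
  obtain x z where xz: "(x, z) \<in> V_graph (a * pi)" "J x = B w" using B_V_graph by blast
  have "fn x \<in> V_space a" using V_intro(1)[OF fn_L2, of x z] xz(1) by simp
  moreover have "W (fn x) = w" by (rule W_eqI) (simp add: Jc_def xz)
  ultimately show ?thesis by blast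
qed

section \<open>Translation of time regularity and of the weak form\<close>

lemma has_deriv_in_L2_iff:
  "has_deriv_in L2 (L2p_norm p) A u v \<longleftrightarrow> (\<forall>t\<in>A. u t \<in> L2 \<and> v t \<in> L2) \<and>
    (\<forall>t\<in>A. ((\<lambda>s. Jc (u s)) has_vector_derivative Jc (v t)) (at t within A))"
proof -
  have "((\<lambda>s. L2p_norm p (\<lambda>x. (u s x - u t x) / (s - t) - v t x)) \<longlongrightarrow> 0) (at t within A) \<longleftrightarrow>
      ((\<lambda>s. Jc (u s)) has_vector_derivative Jc (v t)) (at t within A)"
    if L: "\<forall>t\<in>A. u t \<in> L2 \<and> v t \<in> L2" and t: "t \<in> A" for t
  proof -
    have "((\<lambda>s. L2p_norm p (\<lambda>x. (u s x - u t x) / (s - t) - v t x)) \<longlongrightarrow> 0) (at t within A) \<longleftrightarrow>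
        ((\<lambda>s. norm ((Jc (u s) - Jc (u t)) /\<^sub>R (s - t) - Jc (v t))) \<longlongrightarrow> 0) (at t within A)"
    proof (rule Lim_cong_within[OF refl refl refl])
      fix s assume "s \<in> A"
      then have us: "u s \<in> L2" "u t \<in> L2" "v t \<in> L2" using L t by auto
      have d: "(\<lambda>x. u s x - u t x) \<in> L2" by (rule L2_diff[OF us(1,2)])
      have "(\<lambda>x. inverse (s - t) * (u s x - u t x)) \<in> L2" by (rule L2_scale[OF d])
      then have "L2p_norm p (\<lambda>x. inverse (s - t) * (u s x - u t x) - v t x)
          = norm ((Jc (u s) - Jc (u t)) /\<^sub>R (s - t) - Jc (v t))"
        by (simp add: L2p_norm_eq L2_diff us Jc_diff Jc_scale[OF d])
      then show "L2p_norm p (\<lambda>x. (u s x - u t x) / (s - t) - v t x)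
          = norm ((Jc (u s) - Jc (u t)) /\<^sub>R (s - t) - Jc (v t))"
        by (simp add: divide_inverse mult.commute)
    qed
    then show ?thesis
      by (simp add: has_vector_derivative_iff_quotient tendsto_norm_zero_iff LIM_zero_iff)
  qed
  then show ?thesis unfolding has_deriv_in_def by blast
qed

lemma Ck_0_L2_iff:
  "Ck_in 0 L2 (L2p_norm p) A u \<longleftrightarrow> (\<forall>t\<in>A. u t \<in> L2) \<and> continuous_on A (\<lambda>t. Jc (u t))"
proof -
  have "((\<lambda>s. L2p_norm p (\<lambda>x. u s x - u t x)) \<longlongrightarrow> 0) (at t within A) \<longleftrightarrow>
      ((\<lambda>s. Jc (u s)) \<longlongrightarrow> Jc (u t)) (at t within A)" if L: "\<forall>t\<in>A. u t \<in> L2" and t: "t \<in> A" for t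
  proof -
    have "((\<lambda>s. L2p_norm p (\<lambda>x. u s x - u t x)) \<longlongrightarrow> 0) (at t within A) \<longleftrightarrow>
        ((\<lambda>s. norm (Jc (u s) - Jc (u t))) \<longlongrightarrow> 0) (at t within A)"
      by (rule Lim_cong_within[OF refl refl refl]) (use L t in \<open>simp add: L2p_norm_eq L2_diff Jc_diff\<close>)
    then show ?thesis by (simp add: tendsto_norm_zero_iff LIM_zero_iff)
  qed
  then show ?thesis unfolding Ck_in.simps continuous_on_def by blast
qed

lemma Ck_0_V_iff:
  "Ck_in 0 (V_space a) V_norm A u \<longleftrightarrow> (\<forall>t\<in>A. u t \<in> V_space a) \<and> continuous_on A (\<lambda>t. W (u t))"
proof -
  have "((\<lambda>s. V_norm (\<lambda>x. u s x - u t x)) \<longlongrightarrow> 0) (at t within A) \<longleftrightarrow>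
      ((\<lambda>s. W (u s)) \<longlongrightarrow> W (u t)) (at t within A)" if L: "\<forall>t\<in>A. u t \<in> V_space a" and t: "t \<in> A" for t
  proof -
    have "((\<lambda>s. V_norm (\<lambda>x. u s x - u t x)) \<longlongrightarrow> 0) (at t within A) \<longleftrightarrow>
        ((\<lambda>s. norm (W (u s) - W (u t))) \<longlongrightarrow> 0) (at t within A)"
      by (rule Lim_cong_within[OF refl refl refl]) (use L t in \<open>simp add: V_norm_eq V_diff\<close>)
    then show ?thesis by (simp add: tendsto_norm_zero_iff LIM_zero_iff)
  qed
  then show ?thesis unfolding Ck_in.simps continuous_on_def by blast
qed

text \<open>The derivative is chosen among all that exist. Its class is unique at each time because
  every point of the interval, end points included, is an accumulation point.\<close>

lemma tderiv_eq:
  assumes T: "0 < T" and v: "has_deriv_in L2 (L2p_norm p) (time_ivl T) u v"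
  shows "has_deriv_in L2 (L2p_norm p) (time_ivl T) u (tderiv p T u)"
    "\<And>t. t \<in> time_ivl T \<Longrightarrow> tderiv p T u t \<in> L2"
    "\<And>t. t \<in> time_ivl T \<Longrightarrow> Jc (tderiv p T u t) = Jc (v t)"
proof -
  show *: "has_deriv_in L2 (L2p_norm p) (time_ivl T) u (tderiv p T u)"
    unfolding tderiv_def by (rule someI[where P = "has_deriv_in L2 (L2p_norm p) (time_ivl T) u", OF v])
  fix t assume t: "t \<in> time_ivl T"
  show "tderiv p T u t \<in> L2" using * t by (simp add: has_deriv_in_L2_iff)
  show "Jc (tderiv p T u t) = Jc (v t)"
    by (rule vector_derivative_unique_within[where f = "\<lambda>s. Jc (u s)", OF time_ivl_facts(9)[OF T t]])
      (use * v t in \<open>simp_all add: has_deriv_in_L2_iff\<close>)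
qed

text \<open>\<open>\<xi> = W \<phi>\<close> runs through all of \<open>l2\<close> as
  \<open>\<phi>\<close> runs through the energy space. Weighted products with \<open>\<phi>\<close>
  become products with \<open>B \<xi>\<close>, and \<open>B\<close> is moved to the other
  factor.\<close>

lemma weak_form_iff:
  assumes T: "0 < T" and u: "\<And>t. t \<in> time_ivl T \<Longrightarrow> u t \<in> V_space a"
    and v: "\<And>t. t \<in> time_ivl T \<Longrightarrow> v t \<in> L2"
  defines "w \<equiv> \<lambda>t. W (u t)" and "y \<equiv> \<lambda>t. Jc (v t)"
  shows "(\<forall>\<phi> \<in> V_space a. \<forall>\<eta> \<in> test_functions (open_time_ivl T).
        (\<integral>s. L2p_inner p (v s) \<phi> * deriv \<eta> s \<partial>(lebesgue_on (open_time_ivl T))) =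
        (\<integral>s. (L2_inner (wderiv (wderiv (u s))) (wderiv (wderiv \<phi>)) +
               (L2p_norm p (u s))\<^sup>2 * L2p_inner p (u s) \<phi>) * \<eta> s
           \<partial>(lebesgue_on (open_time_ivl T)))) \<longleftrightarrow>
    (\<forall>\<xi>. \<forall>\<eta> \<in> test_functions (open_time_ivl T).
        (\<integral>s. (B (y s) \<bullet> \<xi>) * deriv \<eta> s \<partial>(lebesgue_on (open_time_ivl T))) =
        (\<integral>s. ((w s + B (cube (B (w s)))) \<bullet> \<xi>) * \<eta> s \<partial>(lebesgue_on (open_time_ivl T))))"
    (is "(\<forall>\<phi>\<in>_. \<forall>\<eta>\<in>_. ?P \<phi> \<eta>) \<longleftrightarrow> (\<forall>\<xi>. \<forall>\<eta>\<in>_. ?Q \<xi> \<eta>)")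
proof -
  have eq: "?P \<phi> \<eta> \<longleftrightarrow> ?Q (W \<phi>) \<eta>" if \<phi>: "\<phi> \<in> V_space a" for \<phi> \<eta>
  proof (rule arg_cong2[where f = "(=)"]; rule Bochner_Integration.integral_cong[OF refl])
    fix s assume "s \<in> space (lebesgue_on (open_time_ivl T))"
    then have s: "s \<in> time_ivl T" using time_ivl_facts(2)[OF T] by auto
    note us = u[OF s] V_imp(1)[OF u[OF s]] and vs = v[OF s] and \<phi>L = V_imp(1)[OF \<phi>]
    show "L2p_inner p (v s) \<phi> * deriv \<eta> s = (B (y s) \<bullet> W \<phi>) * deriv \<eta> s"
      by (simp add: L2p_inner_J vs \<phi>L Jc_def[symmetric] Jc_eq_B_W[OF \<phi>] self_adjoint(1) y_def)
    have "L2_inner (wderiv (wderiv (u s))) (wderiv (wderiv \<phi>)) = w s \<bullet> W \<phi>"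
      unfolding w_def V_inner_def[symmetric] by (rule V_inner_eq[OF us(1) \<phi>])
    moreover have "(L2p_norm p (u s))\<^sup>2 * L2p_inner p (u s) \<phi> = B (cube (B (w s))) \<bullet> W \<phi>"
      by (simp add: L2p_norm_eq us L2p_inner_J \<phi>L Jc_def[symmetric] Jc_eq_B_W \<phi> w_def cube_def
          self_adjoint(1))
    ultimately show "(L2_inner (wderiv (wderiv (u s))) (wderiv (wderiv \<phi>)) +
        (L2p_norm p (u s))\<^sup>2 * L2p_inner p (u s) \<phi>) * \<eta> s = ((w s + B (cube (B (w s)))) \<bullet> W \<phi>) * \<eta> s"
      by (simp add: inner_add_left)
  qed
  show ?thesis
  proof
    assume P: "\<forall>\<phi>\<in>V_space a. \<forall>\<eta>\<in>test_functions (open_time_ivl T). ?P \<phi> \<eta>"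
    show "\<forall>\<xi>. \<forall>\<eta>\<in>test_functions (open_time_ivl T). ?Q \<xi> \<eta>"
    proof (intro allI ballI)
      fix \<xi> \<eta> assume \<eta>: "\<eta> \<in> test_functions (open_time_ivl T)"
      obtain \<phi> where \<phi>: "\<phi> \<in> V_space a" "W \<phi> = \<xi>" using W_surj by blast
      have "?P \<phi> \<eta>" using P \<phi>(1) \<eta> by blast
      then show "?Q \<xi> \<eta>" unfolding eq[OF \<phi>(1)] \<phi>(2) .
    qed
  next
    assume Q: "\<forall>\<xi>. \<forall>\<eta>\<in>test_functions (open_time_ivl T). ?Q \<xi> \<eta>"
    show "\<forall>\<phi>\<in>V_space a. \<forall>\<eta>\<in>test_functions (open_time_ivl T). ?P \<phi> \<eta>"
      using Q by (intro ballI) (simp only: eq)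
  qed
qed

text \<open>For fixed \<open>\<xi>\<close> the weak form is scalar, and the lemma of du Bois-Reymond
  integrates it between interior times. Continuity reaches the end points, and as
  \<open>\<xi>\<close> is arbitrary the integrated equation holds in \<open>l2\<close>, where it can
  be differentiated because \<open>F\<close> is continuous.\<close>

lemma weak_solution_imp_wave_sol:
  assumes T: "0 < T" and g: "g \<in> V_space a" and h: "h \<in> L2"
    and sol: "weak_solution p a T g h u" and t: "t \<in> time_ivl T" "0 < t"
  defines "w \<equiv> \<lambda>t. W (u t)" and "y \<equiv> \<lambda>t. Jc (tderiv p T u t)"
  shows "wave_sol {0..t} w y" "w 0 = W g" "y 0 = Jc h"
proof -
  let ?A = "time_ivl T" and ?O = "open_time_ivl T"
  note A = time_ivl_facts[OF T]
  from sol have u: "\<And>t. t \<in> ?A \<Longrightarrow> u t \<in> V_space a" and wc: "continuous_on ?A w"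
    by (auto simp: weak_solution_def Ck_0_V_iff w_def simp del: Ck_in.simps)
  have "Ck_in (Suc 0) L2 (L2p_norm p) ?A u"
    using sol by (simp only: weak_solution_def One_nat_def)
  then obtain v where v: "has_deriv_in L2 (L2p_norm p) ?A u v" "Ck_in 0 L2 (L2p_norm p) ?A v"
    unfolding Ck_in.simps(2) by (elim exE conjE)
  note td = tderiv_eq[OF T v(1)]
  have "continuous_on ?A (\<lambda>t. Jc (v t))" using v(2) by (simp add: Ck_0_L2_iff del: Ck_in.simps)
  then have yc: "continuous_on ?A y"
    unfolding y_def by (subst continuous_on_cong[OF refl td(3)])
  have dBw: "((\<lambda>s. B (w s)) has_vector_derivative y s) (at s within ?A)" if s: "s \<in> ?A" for s
  proof -
    have "((\<lambda>s. Jc (u s)) has_vector_derivative y s) (at s within ?A)"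
      using td(1) s by (simp add: has_deriv_in_L2_iff y_def)
    then show ?thesis
      by (rule has_vector_derivative_transform[OF s, rotated]) (simp add: w_def Jc_eq_B_W u)
  qed
  define F where "F s = w s + B (cube (B (w s)))" for s
  have Fc: "continuous_on ?A F" unfolding F_def by (intro continuous_intros wc)
  note weak0 = sol[unfolded weak_solution_def, THEN conjunct2, THEN conjunct2, THEN conjunct2, THEN conjunct2]
  have weak: "\<forall>\<xi>. \<forall>\<eta> \<in> test_functions ?O.
        (\<integral>s. (B (y s) \<bullet> \<xi>) * deriv \<eta> s \<partial>(lebesgue_on ?O)) = (\<integral>s. (F s \<bullet> \<xi>) * \<eta> s \<partial>(lebesgue_on ?O))"
    unfolding F_def w_def y_def
    by (rule iffD1[OF weak_form_iff[where u = u and v = "tderiv p T u"] weak0]) (rule T, erule u, erule td(2))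
  have sub: "{0..t} \<subseteq> ?A" and subO: "{0<..<t} \<subseteq> ?O" using A(5,6)[OF t(1)] by auto
  have Fint: "F integrable_on {x..z}" if "{x..z} \<subseteq> {0..t}" for x z
    by (rule integrable_continuous_real) (rule continuous_on_subset[OF Fc order_trans[OF that sub]])
  have By: "B (y x) = B (y 0) - integral {0..x} F" if x: "x \<in> {0..t}" for x
  proof -
    have "B (y x) \<bullet> \<xi> = (B (y 0) - integral {0..x} F) \<bullet> \<xi>" for \<xi>
    proof -
      define q where "q s = B (y s) \<bullet> \<xi>" for s
      define D where "D s = q s + integral {0..s} F \<bullet> \<xi>" for s
      have qc: "continuous_on ?A q" unfolding q_def by (intro continuous_intros yc)
      have rc: "continuous_on ?A (\<lambda>s. F s \<bullet> \<xi>)" by (intro continuous_intros Fc)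
      have Fcomb: "integral {0..z} F = integral {0..x} F + integral {x..z} F"
        if "0 \<le> x" "x \<le> z" "z \<le> t" for x z
        using that by (intro Henstock_Kurzweil_Integration.integral_combine[symmetric] Fint) auto
      have Fin: "integral {x..z} (\<lambda>s. F s \<bullet> \<xi>) = integral {x..z} F \<bullet> \<xi>" if "{x..z} \<subseteq> {0..t}" for x z
        using integral_linear[OF Fint[OF that] bounded_linear_inner_left[of \<xi>]] by (simp add: o_def)
      have inc: "D x = D z" if "x \<in> {0<..<t}" "z \<in> {0<..<t}" "x < z" for x z
      proof -
        have "q z - q x = - integral {x..z} (\<lambda>s. F s \<bullet> \<xi>)"
        proof (rule du_bois_reymond[OF A(3) A(4) _ _ _ _ _ that(3)])
          show "continuous_on ?O q" by (rule continuous_on_subset[OF qc A(2)])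
          show "continuous_on ?O (\<lambda>s. F s \<bullet> \<xi>)" by (rule continuous_on_subset[OF rc A(2)])
          show "x \<in> ?O" "z \<in> ?O" using that subO by auto
          fix \<eta> assume "\<eta> \<in> test_functions ?O"
          then show "(\<integral>s. q s * deriv \<eta> s \<partial>lebesgue_on ?O) = (\<integral>s. (F s \<bullet> \<xi>) * \<eta> s \<partial>lebesgue_on ?O)"
            unfolding q_def by (rule bspec[OF spec[OF weak]])
        qed
        then show ?thesis using that by (simp add: D_def Fcomb[of x z] Fin inner_add_left)
      qed
      \<comment> \<open>The midpoint serves as an interior reference; the end points follow by
        continuity.\<close>
      have const: "D x = D (t / 2)" if "x \<in> {0<..<t}" for x
      proof -
        have mid: "t / 2 \<in> {0<..<t}" using t(2) by simp
        consider "x < t / 2" | "x = t / 2" | "t / 2 < x" by linarith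
        then show ?thesis
        proof cases
          case 1
          then show ?thesis by (rule inc[OF that mid])
        next
          case 3
          then show ?thesis by (rule inc[OF mid that, symmetric])
        qed (rule arg_cong)
      qed
      have "continuous_on {0..t} D"
        unfolding D_def
        by (intro continuous_on_add continuous_on_inner continuous_on_const
            continuous_on_subset[OF qc sub] indefinite_integral_continuous_1[OF Fint[OF subset_refl]])
      then have Dc: "continuous_on (closure {0<..<t}) D" using t(2) by simp
      have "D x = D (t / 2)" if "x \<in> {0..t}" for x
        by (rule continuous_constant_on_closure[OF Dc const]) (use that t(2) in simp_all)
      from this[OF x] this[of 0] have "D x = D 0" using t(2) by (metis atLeastAtMost_iff less_imp_le order_refl)
      then show ?thesis by (simp add: D_def q_def inner_diff_left)
    qed
    \<comment> \<open>The arbitrary \<open>\<xi>\<close> is taken to be the difference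
      itself.\<close>
    then have "(B (y x) - (B (y 0) - integral {0..x} F)) \<bullet> (B (y x) - (B (y 0) - integral {0..x} F)) = 0"
      by (simp only: inner_diff_left[of "B (y x)"] diff_self)
    then show ?thesis by simp
  qed
  have dBy: "((\<lambda>s. B (y s)) has_vector_derivative - F s) (at s within {0..t})" if s: "s \<in> {0..t}" for s
  proof -
    have "((\<lambda>x. B (y 0) - integral {0..x} F) has_vector_derivative 0 - F s) (at s within {0..t})"
      by (intro has_vector_derivative_diff has_vector_derivative_const
          integral_has_vector_derivative[OF continuous_on_subset[OF Fc sub] s])
    then have "((\<lambda>x. B (y 0) - integral {0..x} F) has_vector_derivative - F s) (at s within {0..t})" by simp
    then show ?thesis by (rule has_vector_derivative_transform[OF s By, rotated]) 
  qed
  show "wave_sol {0..t} w y"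
    unfolding wave_sol_def
  proof (intro conjI ballI)
    show "continuous_on {0..t} w" "continuous_on {0..t} y"
      by (rule continuous_on_subset[OF wc sub], rule continuous_on_subset[OF yc sub])
    fix s assume s: "s \<in> {0..t}"
    show "((\<lambda>s. B (w s)) has_vector_derivative y s) (at s within {0..t})"
      using dBw[of s] s sub by (blast intro: has_vector_derivative_within_subset)
    show "((\<lambda>s. B (y s)) has_vector_derivative - w s - B (cube (B (w s)))) (at s within {0..t})"
      using dBy[OF s] by (simp add: F_def)
  qed
  \<comment> \<open>The initial conditions are limits from the right; continuity of \<open>w\<close>
    and \<open>y\<close> up to 0 turns them into values at 0.\<close>
  have ne: "at_right (0::real) \<noteq> bot" by simp
  have ev: "eventually (\<lambda>s. s \<in> ?A) (at_right 0)"
    using eventually_at_right_real[OF t(2)] sub by (auto elim!: eventually_mono)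
  have "((\<lambda>s. norm (w s - W g)) \<longlongrightarrow> 0) (at_right 0)"
  proof (rule Lim_transform_eventually)
    show "((\<lambda>s. V_norm (\<lambda>x. u s x - g x)) \<longlongrightarrow> 0) (at_right 0)" using sol by (simp add: weak_solution_def)
    show "eventually (\<lambda>s. V_norm (\<lambda>x. u s x - g x) = norm (w s - W g)) (at_right 0)"
      using ev by eventually_elim (simp add: V_norm_eq V_diff u g w_def)
  qed
  then have "(w \<longlongrightarrow> W g) (at_right 0)" by (simp add: tendsto_norm_zero_iff LIM_zero_iff)
  moreover have "(w \<longlongrightarrow> w 0) (at_right 0)"
    by (rule tendsto_at_right_0_time_ivl[OF T]) (use wc A(1) in \<open>simp add: continuous_on_def\<close>)
  ultimately show "w 0 = W g" using tendsto_unique[OF ne] by blast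
  have "((\<lambda>s. norm (y s - Jc h)) \<longlongrightarrow> 0) (at_right 0)"
  proof (rule Lim_transform_eventually)
    show "((\<lambda>s. L2p_norm p (\<lambda>x. tderiv p T u s x - h x)) \<longlongrightarrow> 0) (at_right 0)"
      using sol by (simp add: weak_solution_def)
    show "eventually (\<lambda>s. L2p_norm p (\<lambda>x. tderiv p T u s x - h x) = norm (y s - Jc h)) (at_right 0)"
      using ev by eventually_elim (simp add: L2p_norm_eq L2_diff Jc_diff td(2) h y_def)
  qed
  then have "(y \<longlongrightarrow> Jc h) (at_right 0)" by (simp add: tendsto_norm_zero_iff LIM_zero_iff)
  moreover have "(y \<longlongrightarrow> y 0) (at_right 0)"
    by (rule tendsto_at_right_0_time_ivl[OF T]) (use yc A(1) in \<open>simp add: continuous_on_def\<close>)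
  ultimately show "y 0 = Jc h" using tendsto_unique[OF ne] by blast
qed

text \<open>The weak form follows from the product rule for \<open>B (y s) \<bullet> \<xi>\<close>
  times \<open>\<eta> s\<close> on an interval containing the support of \<open>\<eta>\<close>,
  where the boundary terms vanish.\<close>

lemma wave_sol_imp_weak_solution:
  assumes T: "0 < T" and g: "g \<in> V_space a" and h: "h \<in> L2"
    and sol: "wave_sol (time_ivl T) w y" and init: "w 0 = W g" "y 0 = Jc h"
    and u: "\<And>t. u t \<in> V_space a" "\<And>t. W (u t) = w t"
  shows "weak_solution p a T g h u" "\<And>t. t \<in> time_ivl T \<Longrightarrow> tderiv p T u t \<in> L2"
    "\<And>t. t \<in> time_ivl T \<Longrightarrow> Jc (tderiv p T u t) = y t"
proof -
  let ?A = "time_ivl T" and ?O = "open_time_ivl T"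
  note A = time_ivl_facts[OF T]
  have wc: "continuous_on ?A w" "continuous_on ?A y"
    and dBw: "\<And>t. t \<in> ?A \<Longrightarrow> ((\<lambda>s. B (w s)) has_vector_derivative y t) (at t within ?A)"
    and dBy: "\<And>t. t \<in> ?A \<Longrightarrow> ((\<lambda>s. B (y s)) has_vector_derivative - w t - B (cube (B (w t)))) (at t within ?A)"
    using sol by (auto simp: wave_sol_def)
  have "\<forall>t. \<exists>v\<in>L2. Jc v = y t" using Jc_surj by blast
  then obtain v where v: "\<And>t. v t \<in> L2" "\<And>t. Jc (v t) = y t" by metis
  have Ju: "Jc (u t) = B (w t)" for t by (simp add: Jc_eq_B_W u)
  have hd: "has_deriv_in L2 (L2p_norm p) ?A u v"
    using dBw by (simp add: has_deriv_in_L2_iff Ju v V_imp(1)[OF u(1)])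
  note td = tderiv_eq[OF T hd, unfolded v(2)]
  show "\<And>t. t \<in> ?A \<Longrightarrow> tderiv p T u t \<in> L2" "\<And>t. t \<in> ?A \<Longrightarrow> Jc (tderiv p T u t) = y t"
    by (fact td)+
  have ev: "eventually (\<lambda>s. s \<in> ?A) (at_right 0)"
  proof -
    obtain t where "0 < t" "t \<in> ?O" using A(8) by blast
    then have "{0..t} \<subseteq> ?A" using A(2,5) by blast
    then show ?thesis using eventually_at_right_real[OF \<open>0 < t\<close>] by (auto elim!: eventually_mono)
  qed
  have lim: "((\<lambda>s. norm (f s - f 0)) \<longlongrightarrow> 0) (at_right 0)" if "continuous_on ?A f" for f :: "real \<Rightarrow> l2"
  proof -
    have "(f \<longlongrightarrow> f 0) (at_right 0)"
      by (rule tendsto_at_right_0_time_ivl[OF T]) (use that A(1) in \<open>simp add: continuous_on_def\<close>)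
    then show ?thesis by (simp add: tendsto_norm_zero_iff LIM_zero_iff)
  qed
  show "weak_solution p a T g h u"
    unfolding weak_solution_def
  proof (intro conjI)
    show "Ck_in 0 (V_space a) V_norm ?A u" by (simp add: Ck_0_V_iff u wc del: Ck_in.simps)
    show "Ck_in 1 L2 (L2p_norm p) ?A u"
      unfolding One_nat_def Ck_in.simps(2) using hd Ck_0_L2_iff[of ?A v] by (auto simp: v wc)
    show "((\<lambda>t. V_norm (\<lambda>x. u t x - g x)) \<longlongrightarrow> 0) (at_right 0)"
    proof (rule Lim_transform_eventually[OF lim[OF wc(1)]])
      show "eventually (\<lambda>s. norm (w s - w 0) = V_norm (\<lambda>x. u s x - g x)) (at_right 0)"
        by (simp add: V_norm_eq V_diff u g init)
    qed
    show "((\<lambda>t. L2p_norm p (\<lambda>x. tderiv p T u t x - h x)) \<longlongrightarrow> 0) (at_right 0)"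
    proof (rule Lim_transform_eventually[OF lim[OF wc(2)]])
      show "eventually (\<lambda>s. norm (y s - y 0) = L2p_norm p (\<lambda>x. tderiv p T u s x - h x)) (at_right 0)"
        using ev by eventually_elim (simp add: L2p_norm_eq L2_diff Jc_diff td h init)
    qed
    show "\<forall>\<phi> \<in> V_space a. \<forall>\<eta> \<in> test_functions ?O.
        (\<integral>s. L2p_inner p (tderiv p T u s) \<phi> * deriv \<eta> s \<partial>(lebesgue_on ?O)) =
        (\<integral>s. (L2_inner (wderiv (wderiv (u s))) (wderiv (wderiv \<phi>)) +
               (L2p_norm p (u s))\<^sup>2 * L2p_inner p (u s) \<phi>) * \<eta> s \<partial>(lebesgue_on ?O))"
    proof (subst weak_form_iff[where u = u and v = "tderiv p T u", OF T u(1) td(2)], assumption, intro allI ballI)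
      fix \<xi> \<eta> assume \<eta>: "\<eta> \<in> test_functions ?O"
      define q where "q s = B (y s) \<bullet> \<xi>" for s
      define r where "r s = (w s + B (cube (B (w s)))) \<bullet> \<xi>" for s
      obtain s0 where s0: "s0 \<in> ?O" using A(8) by blast
      obtain c d where cd: "c < d" "{c..d} \<subseteq> ?O" and z: "\<And>x. x \<notin> {c<..<d} \<Longrightarrow> \<eta> x = 0"
        using test_functions_support_ivl[OF \<eta> A(3) s0 A(4)] by blast
      have cdA: "{c..d} \<subseteq> ?A" using cd(2) A(2) by blast
      have z': "deriv \<eta> x = 0" if "x \<notin> {c..d}" for x
      proof -
        have ev: "eventually (\<lambda>y. y \<in> - {c..d}) (nhds x)"
          by (rule eventually_nhds_in_open) (use that in \<open>simp_all add: open_Compl\<close>)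
        have "eventually (\<lambda>y. \<eta> y = 0) (nhds x)" by (rule eventually_mono[OF ev]) (auto intro: z)
        then have "(\<eta> has_real_derivative 0) (at x) \<longleftrightarrow> ((\<lambda>x. 0) has_real_derivative 0) (at x)"
          by (intro DERIV_cong_ev refl)
        then show ?thesis by (intro DERIV_imp_deriv) simp
      qed
      have qc: "continuous_on {c..d} q" and rc: "continuous_on {c..d} r"
        unfolding q_def r_def
        by (intro continuous_intros continuous_on_subset[OF wc(1) cdA] continuous_on_subset[OF wc(2) cdA])+
      note c\<eta> = test_functions_continuous[OF \<eta>] test_functions_continuous[OF test_functions_deriv[OF \<eta>]]
      have dq: "(q has_vector_derivative - r s) (at s within {c..d})" if "s \<in> {c..d}" for s
      proof -
        have "((\<lambda>s. B (y s)) has_vector_derivative - w s - B (cube (B (w s)))) (at s within {c..d})"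
          using dBy[of s] that cdA by (blast intro: has_vector_derivative_within_subset)
        from bounded_linear.has_vector_derivative[OF bounded_linear_inner_left this, of \<xi>]
        show ?thesis by (simp add: q_def[abs_def] r_def inner_diff_left inner_add_left)
      qed
      have "((\<lambda>s. q s * deriv \<eta> s + (- r s) * \<eta> s) has_integral (q d * \<eta> d - q c * \<eta> c)) {c..d}"
      proof (rule fundamental_theorem_of_calculus)
        fix x assume x: "x \<in> {c..d}"
        have "(\<eta> has_vector_derivative deriv \<eta> x) (at x within {c..d})"
          using has_field_derivative_at_within[OF test_functions_has_derivative[OF \<eta>]]
          by (simp add: has_real_derivative_iff_has_vector_derivative)
        then show "((\<lambda>x. q x * \<eta> x) has_vector_derivative q x * deriv \<eta> x + (- r x) * \<eta> x) (at x within {c..d})"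
          by (rule has_vector_derivative_mult[OF dq[OF x]])
      qed (use cd in simp)
      then have "integral {c..d} (\<lambda>s. q s * deriv \<eta> s - r s * \<eta> s) = 0"
        by (simp add: integral_unique z)
      moreover have int: "(\<lambda>s. q s * deriv \<eta> s) integrable_on {c..d}" "(\<lambda>s. r s * \<eta> s) integrable_on {c..d}"
        by (intro integrable_continuous_real continuous_on_mult qc rc c\<eta>)+
      ultimately have "integral {c..d} (\<lambda>s. q s * deriv \<eta> s) = integral {c..d} (\<lambda>s. r s * \<eta> s)"
        by (simp add: Henstock_Kurzweil_Integration.integral_diff)
      moreover have "?O \<in> sets lebesgue" using A(3) by simp
      then have "(\<integral>s. q s * deriv \<eta> s \<partial>lebesgue_on ?O) = integral {c..d} (\<lambda>s. q s * deriv \<eta> s)"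
          "(\<integral>s. r s * \<eta> s \<partial>lebesgue_on ?O) = integral {c..d} (\<lambda>s. r s * \<eta> s)"
        using cd(2) z z' by (auto intro!: integral_compact_support continuous_on_mult qc rc c\<eta>)
      ultimately have "(\<integral>s. q s * deriv \<eta> s \<partial>lebesgue_on ?O) = (\<integral>s. r s * \<eta> s \<partial>lebesgue_on ?O)" by simp
      moreover have "(\<integral>s. q s * deriv \<eta> s \<partial>lebesgue_on ?O)
          = (\<integral>s. (B (Jc (tderiv p T u s)) \<bullet> \<xi>) * deriv \<eta> s \<partial>lebesgue_on ?O)"
        by (rule Bochner_Integration.integral_cong[OF refl]) (use A(2) in \<open>auto simp: q_def td(3)\<close>)
      ultimately show "(\<integral>s. (B (Jc (tderiv p T u s)) \<bullet> \<xi>) * deriv \<eta> s \<partial>lebesgue_on ?O) =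
          (\<integral>s. ((W (u s) + B (cube (B (W (u s))))) \<bullet> \<xi>) * \<eta> s \<partial>lebesgue_on ?O)"
        by (simp add: r_def u)
    qed
  qed
qed

section \<open>Functionals on the energy space\<close>

lemma zero_V: "(\<lambda>x. 0) \<in> V_space a" "V_norm (\<lambda>x. 0) = 0"
proof -
  obtain u where "u \<in> V_space a" using W_surj by blast
  then have "(\<lambda>x. 0 * u x) \<in> V_space a" "V_norm (\<lambda>x. 0 * u x) = 0"
    by (simp_all only: V_norm_eq V_scale) (simp_all add: V_scale)
  then show "(\<lambda>x. 0) \<in> V_space a" "V_norm (\<lambda>x. 0) = 0" by simp_all
qed

lemma V_dualI:
  assumes F: "\<And>\<phi>. \<phi> \<in> V_space a \<Longrightarrow> F \<phi> = \<zeta> \<bullet> W \<phi>"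
  shows "F \<in> V_dual a"
proof -
  have "\<bar>F \<phi>\<bar> \<le> norm \<zeta> * V_norm \<phi>" if "\<phi> \<in> V_space a" for \<phi>
    using Cauchy_Schwarz_ineq2[of \<zeta> "W \<phi>"] that by (simp add: F V_norm_eq)
  then show ?thesis
    unfolding V_dual_def by (auto simp: F V_add V_scale inner_add_right)
qed

text \<open>Cauchy-Schwarz over the unit ball, which contains 0. Limits in the dual norm then follow
  by squeezing from limits of the representing vectors in \<open>l2\<close>.\<close>

lemma V_dual_norm_bounds:
  assumes F: "\<And>\<phi>. \<phi> \<in> V_space a \<Longrightarrow> F \<phi> = \<zeta> \<bullet> W \<phi>"
  shows "0 \<le> V_dual_norm a F" "V_dual_norm a F \<le> norm \<zeta>"
proof -
  let ?U = "{\<phi> \<in> V_space a. V_norm \<phi> \<le> 1}"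
  have le: "\<bar>F \<phi>\<bar> \<le> norm \<zeta>" if "\<phi> \<in> ?U" for \<phi>
  proof -
    have "\<bar>F \<phi>\<bar> \<le> norm \<zeta> * norm (W \<phi>)"
      using Cauchy_Schwarz_ineq2[of \<zeta> "W \<phi>"] that by (simp add: F)
    also have "\<dots> \<le> norm \<zeta> * 1" using that by (intro mult_left_mono) (auto simp: V_norm_eq)
    finally show ?thesis by simp
  qed
  have z: "(\<lambda>x. 0) \<in> ?U" by (simp add: zero_V)
  show "V_dual_norm a F \<le> norm \<zeta>"
    unfolding V_dual_norm_def by (rule cSUP_least) (use z le in auto)
  have "bdd_above ((\<lambda>\<phi>. \<bar>F \<phi>\<bar>) ` ?U)" using le by (intro bdd_aboveI2)
  then have "\<bar>F (\<lambda>x. 0)\<bar> \<le> V_dual_norm a F"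
    unfolding V_dual_norm_def by (rule cSUP_upper[OF z])
  then show "0 \<le> V_dual_norm a F" by linarith
qed

lemma has_deriv_in_V_dual:
  assumes \<zeta>: "\<And>t. t \<in> A \<Longrightarrow> (\<zeta> has_vector_derivative \<zeta>' t) (at t within A)"
    and F: "\<And>t \<phi>. t \<in> A \<Longrightarrow> \<phi> \<in> V_space a \<Longrightarrow> F t \<phi> = \<zeta> t \<bullet> W \<phi>"
    and F': "\<And>t \<phi>. t \<in> A \<Longrightarrow> \<phi> \<in> V_space a \<Longrightarrow> F' t \<phi> = \<zeta>' t \<bullet> W \<phi>"
  shows "has_deriv_in (V_dual a) (V_dual_norm a) A F F'"
  unfolding has_deriv_in_def
proof (intro ballI conjI)
  fix t assume t: "t \<in> A"
  show "F t \<in> V_dual a" by (rule V_dualI) (rule F[OF t])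
  show "F' t \<in> V_dual a" by (rule V_dualI) (rule F'[OF t])
  have eq: "(F s \<phi> - F t \<phi>) / (s - t) - F' t \<phi> = ((\<zeta> s - \<zeta> t) /\<^sub>R (s - t) - \<zeta>' t) \<bullet> W \<phi>"
    if "s \<in> A" "\<phi> \<in> V_space a" for s \<phi>
    using that t by (simp add: F F' inner_diff_left divide_inverse mult.commute)
  show "((\<lambda>s. V_dual_norm a (\<lambda>\<phi>. (F s \<phi> - F t \<phi>) / (s - t) - F' t \<phi>)) \<longlongrightarrow> 0) (at t within A)"
  proof (rule tendsto_sandwich[OF _ _ tendsto_const])
    show "((\<lambda>s. norm ((\<zeta> s - \<zeta> t) /\<^sub>R (s - t) - \<zeta>' t)) \<longlongrightarrow> 0) (at t within A)"
      using \<zeta>[OF t] by (simp add: has_vector_derivative_iff_quotient tendsto_norm_zero_iff LIM_zero_iff)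
    show "eventually (\<lambda>s. 0 \<le> V_dual_norm a (\<lambda>\<phi>. (F s \<phi> - F t \<phi>) / (s - t) - F' t \<phi>)) (at t within A)"
      unfolding eventually_at_filter by (rule eventuallyI) (use V_dual_norm_bounds(1)[OF eq] in auto)
    show "eventually (\<lambda>s. V_dual_norm a (\<lambda>\<phi>. (F s \<phi> - F t \<phi>) / (s - t) - F' t \<phi>)
        \<le> norm ((\<zeta> s - \<zeta> t) /\<^sub>R (s - t) - \<zeta>' t)) (at t within A)"
      unfolding eventually_at_filter by (rule eventuallyI) (use V_dual_norm_bounds(2)[OF eq] in auto)
  qed
qed

lemma Ck_0_V_dual:
  assumes \<zeta>: "continuous_on A \<zeta>"
    and F: "\<And>t \<phi>. t \<in> A \<Longrightarrow> \<phi> \<in> V_space a \<Longrightarrow> F t \<phi> = \<zeta> t \<bullet> W \<phi>"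
  shows "Ck_in 0 (V_dual a) (V_dual_norm a) A F"
  unfolding Ck_in.simps
proof (intro ballI conjI)
  fix t assume t: "t \<in> A"
  show "F t \<in> V_dual a" by (rule V_dualI) (rule F[OF t])
  have eq: "F s \<phi> - F t \<phi> = (\<zeta> s - \<zeta> t) \<bullet> W \<phi>" if "s \<in> A" "\<phi> \<in> V_space a" for s \<phi>
    using that t by (simp add: F inner_diff_left)
  show "((\<lambda>s. V_dual_norm a (\<lambda>\<phi>. F s \<phi> - F t \<phi>)) \<longlongrightarrow> 0) (at t within A)"
  proof (rule tendsto_sandwich[OF _ _ tendsto_const])
    show "((\<lambda>s. norm (\<zeta> s - \<zeta> t)) \<longlongrightarrow> 0) (at t within A)"
      using \<zeta> t by (simp add: continuous_on_def tendsto_norm_zero_iff LIM_zero_iff)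
    show "eventually (\<lambda>s. 0 \<le> V_dual_norm a (\<lambda>\<phi>. F s \<phi> - F t \<phi>)) (at t within A)"
      unfolding eventually_at_filter by (rule eventuallyI) (use V_dual_norm_bounds(1)[OF eq] in auto)
    show "eventually (\<lambda>s. V_dual_norm a (\<lambda>\<phi>. F s \<phi> - F t \<phi>) \<le> norm (\<zeta> s - \<zeta> t)) (at t within A)"
      unfolding eventually_at_filter by (rule eventuallyI) (use V_dual_norm_bounds(2)[OF eq] in auto)
  qed
qed

theorem weak_solution_theory:
  assumes T: "0 < T" and g: "g \<in> V_space a" and h: "h \<in> L2"
  shows "\<exists>u. weak_solution p a T g h u \<and>
           (\<forall>v. weak_solution p a T g h v \<longrightarrow>
              (\<forall>t \<in> time_ivl T. AE x in I_meas. v t x = u t x)) \<and>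
           Ck_in 2 (V_dual a) (V_dual_norm a) (time_ivl T)
             (\<lambda>t \<phi>. L2_inner (\<lambda>x. p x * u t x) \<phi>) \<and>
           (\<forall>t \<in> time_ivl T. 0 < t \<longrightarrow>
              1 / 2 * (L2p_norm p (tderiv p T u t))\<^sup>2 +
              1 / 2 * (L2_norm (wderiv (wderiv (u t))))\<^sup>2 +
              1 / 4 * L2p_norm p (u t) ^ 4 =
              1 / 2 * (L2p_norm p h)\<^sup>2 +
              1 / 2 * (L2_norm (wderiv (wderiv g)))\<^sup>2 +
              1 / 4 * L2p_norm p g ^ 4)"
proof -
  let ?A = "time_ivl T"
  note A = time_ivl_facts[OF T]
  obtain w y where sol: "wave_sol {0..} w y" and init: "w 0 = W g" "y 0 = Jc h"
    and en: "\<And>t. 0 \<le> t \<Longrightarrow> energy (w t) (y t) = energy (W g) (Jc h)"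
    using wave_sol_exists[of "W g" "Jc h"] by blast
  have mono: "wave_sol S w y" if "S \<subseteq> {0..}" for S
    using sol that unfolding wave_sol_def
    by (blast intro: continuous_on_subset has_vector_derivative_within_subset)
  \<comment> \<open>One global solution serves every \<open>T\<close>, finite or infinite, by
    restriction.\<close>
  have solA: "wave_sol ?A w y" by (rule mono[OF A(7)])
  have "\<forall>t. \<exists>u\<in>V_space a. W u = w t" using W_surj by blast
  then obtain u where u: "\<And>t. u t \<in> V_space a" "\<And>t. W (u t) = w t" by metis
  note ws = wave_sol_imp_weak_solution[OF T g h solA init u]
  have Ju: "Jc (u t) = B (w t)" for t by (simp add: Jc_eq_B_W u)
  show ?thesis
  proof (intro exI[of _ u] conjI allI impI ballI)
    show "weak_solution p a T g h u" by (fact ws)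
  next
    fix v t assume v: "weak_solution p a T g h v" and t: "t \<in> ?A"
    have vV: "v s \<in> V_space a" if "s \<in> ?A" for s
      using v that by (simp add: weak_solution_def Ck_0_V_iff del: Ck_in.simps)
    have "W (v t) = w t"
    \<comment> \<open>The comparison runs on \<open>{0..t}\<close> with positive \<open>t\<close>.
      At \<open>t = 0\<close> the value comes from the initial condition, obtained through any
      positive time \<open>s\<close>.\<close>
    proof (cases "t = 0")
      case True
      obtain s where "0 < s" "s \<in> ?A" using A(2,8) by blast
      from weak_solution_imp_wave_sol(2)[OF T g h v this(2,1)] show ?thesis using init True by simp
    next
      case False
      then have t0: "0 < t" using t A(7) by auto
      note vs = weak_solution_imp_wave_sol[OF T g h v t t0]
      show ?thesis
        by (rule wave_sol_unique[OF vs(1) mono]) (use vs init t0 in auto)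
    qed
    then have "Jc (v t) = Jc (u t)" by (simp add: Jc_eq_B_W vV t u)
    then show "AE x in I_meas. v t x = u t x"
      using Jc_eq_iff[OF V_imp(1)[OF vV[OF t]] V_imp(1)[OF u(1)]] by simp
  next
    \<comment> \<open>One factor \<open>B\<close> comes from \<open>u\<close>, the other from the
      test function. Together they allow two time derivatives: the first is represented by
      \<open>B (y t)\<close>, the second by \<open>- w t - B (cube (B (w t)))\<close>, which is
      continuous.\<close>
    have F0: "L2_inner (\<lambda>x. p x * u t x) \<phi> = B (B (w t)) \<bullet> W \<phi>" if "\<phi> \<in> V_space a" for t \<phi>
    proof -
      have "L2_inner (\<lambda>x. p x * u t x) \<phi> = Jc (u t) \<bullet> Jc \<phi>"
        using L2p_inner_J[OF V_imp(1)[OF u(1)] V_imp(1)[OF that]] by (simp add: L2p_inner_def Jc_def)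
      then show ?thesis by (simp add: Ju Jc_eq_B_W that self_adjoint(1))
    qed
    have "has_deriv_in (V_dual a) (V_dual_norm a) ?A (\<lambda>t \<phi>. L2_inner (\<lambda>x. p x * u t x) \<phi>) (\<lambda>t \<phi>. B (y t) \<bullet> W \<phi>)"
      by (rule has_deriv_in_V_dual[where \<zeta> = "\<lambda>t. B (B (w t))" and \<zeta>' = "\<lambda>t. B (y t)"])
        (use solA in \<open>auto simp: F0 wave_sol_def intro: B.has_vector_derivative\<close>)
    moreover have "has_deriv_in (V_dual a) (V_dual_norm a) ?A (\<lambda>t \<phi>. B (y t) \<bullet> W \<phi>)
        (\<lambda>t \<phi>. (- w t - B (cube (B (w t)))) \<bullet> W \<phi>)"
      by (rule has_deriv_in_V_dual) (use solA in \<open>auto simp: wave_sol_def\<close>)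
    moreover have "continuous_on ?A w" using solA by (simp add: wave_sol_def)
    then have "continuous_on ?A (\<lambda>t. - w t - B (cube (B (w t))))" by (intro continuous_intros)
    then have "Ck_in 0 (V_dual a) (V_dual_norm a) ?A (\<lambda>t \<phi>. (- w t - B (cube (B (w t)))) \<bullet> W \<phi>)"
      by (rule Ck_0_V_dual) simp
    ultimately show "Ck_in 2 (V_dual a) (V_dual_norm a) ?A (\<lambda>t \<phi>. L2_inner (\<lambda>x. p x * u t x) \<phi>)"
      unfolding numeral_2_eq_2 Ck_in.simps(2) by blast
  next
    fix t assume t: "t \<in> ?A"
    then have "0 \<le> t" using A(7) by auto
    then show "1 / 2 * (L2p_norm p (tderiv p T u t))\<^sup>2 + 1 / 2 * (L2_norm (wderiv (wderiv (u t))))\<^sup>2 +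
        1 / 4 * L2p_norm p (u t) ^ 4 =
        1 / 2 * (L2p_norm p h)\<^sup>2 + 1 / 2 * (L2_norm (wderiv (wderiv g)))\<^sup>2 + 1 / 4 * L2p_norm p g ^ 4"
      using en[of t]
      by (simp add: energy_def L2p_norm_eq ws(2,3)[OF t] L2_norm_wderiv2 u g h V_imp(1)[OF u(1)] V_imp(1)[OF g]
          Ju Jc_eq_B_W[OF g])
  qed
qed

end

theorem theorem2p3:
  fixes \<alpha> \<beta> a :: real and p g h :: "real \<Rightarrow> real" and T :: ereal
  assumes "0 < \<alpha>" "\<alpha> < 1" "1 < \<beta>"
    and "0 < a" "a < 1"
    and "p \<in> P_class \<alpha> \<beta>"
    and "0 < T"
    and "g \<in> V_space a"
    and "h \<in> L2"
  shows "\<exists>u. weak_solution p a T g h u \<and>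
           (\<forall>v. weak_solution p a T g h v \<longrightarrow>
              (\<forall>t \<in> time_ivl T. AE x in I_meas. v t x = u t x)) \<and>
           Ck_in 2 (V_dual a) (V_dual_norm a) (time_ivl T)
             (\<lambda>t \<phi>. L2_inner (\<lambda>x. p x * u t x) \<phi>) \<and>
           (\<forall>t \<in> time_ivl T. 0 < t \<longrightarrow>
              1 / 2 * (L2p_norm p (tderiv p T u t))\<^sup>2 +
              1 / 2 * (L2_norm (wderiv (wderiv (u t))))\<^sup>2 +
              1 / 4 * L2p_norm p (u t) ^ 4 =
              1 / 2 * (L2p_norm p h)\<^sup>2 +
              1 / 2 * (L2_norm (wderiv (wderiv g)))\<^sup>2 +
              1 / 4 * L2p_norm p g ^ 4)"
proof -
  note p = assms(6) and \<alpha> = assms(1)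
  note m = P_class_multipliers[OF p \<alpha>]
  let ?J = "mul (\<lambda>t. sqrt (p t))" and ?K = "mul (\<lambda>t. 1 / sqrt (p t))"
  obtain e \<omega> \<kappa> where wave: "wave e \<omega> \<kappa>"
    and fwd: "\<And>x z. (x, z) \<in> V_graph (a * pi) \<Longrightarrow> \<exists>w. ?J x = wave.B e \<omega> w \<and> norm w = norm z"
    and bwd: "\<And>w. \<exists>x z. (x, z) \<in> V_graph (a * pi) \<and> ?J x = wave.B e \<omega> w"
    using weighted_spectral_basis[OF p \<alpha>] by blast
  \<comment> \<open>Multiplication by the reciprocal root inverts \<open>J\<close>, which supplies
    the injectivity and surjectivity that the interface asks for.\<close>
  have KJ: "?K (?J x) = x" and JK: "?J (?K x) = x" for x
    by (rule mul_mul_id[OF m(2) m(1) m(4)], rule mul_mul_id[OF m(1) m(2) m(3)])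
  interpret wave e \<omega> \<kappa> by (rule wave)
  interpret beam e \<omega> \<kappa> a p ?J
  proof (rule beam.intro[OF wave], rule beam_axioms.intro)
    show "x = y" if "?J x = ?J y" for x y using KJ that by metis
    show "\<exists>x. ?J x = y" for y using JK by blast
  qed (fact assms bounded_linear_mul[OF m(1)] L2p_inner_eq[OF p \<alpha>] fwd bwd)+
  show ?thesis by (rule weak_solution_theory) (use assms in auto)
qed

end
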